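(* Let $1\le p\le\infty$. (i) For every $m_1>-d\left|\frac12-\frac1p\right|$ there exist a real-valued $\Phi\in\mathbf{SG}^{1,1}$ satisfying the non-degeneracy condition $$\left|\det\left(\frac{\partial^2\Phi}{\partial x_i\partial\eta_l}(x,\eta)\right)\right|>\delta>0\quad\text{for all }(x,\eta)\in\mathbb{R}^{2d}$$ for some $\delta>0$, and a symbol $\sigma\in\mathbf{SG}^{m_1,-\infty}$, compactly supported with respect to $x$, such that the operator $$Af(x)=\int_{\mathbb{R}^d} e^{2\pi i\Phi(x,\eta)}\sigma(x,\eta)\hat f(\eta)\,d\eta,\qquad f\in\mathcal{S}(\mathbb{R}^d),$$ does not extend to a bounded operator on $M^p(\mathbb{R}^d)$ if $p<\infty$, nor on $\tilde M^\infty(\mathbb{R}^d)$ if $p=\infty$. (ii) For every $m_2>-d\left|\frac12-\frac1p\right|$ there exist a real-valued $\Phi\in\mathbf{SG}^{1,1}$ satisfying the same non-degeneracy condition for some $\delta>0$, and a symbol $\sigma\in\mathbf{SG}^{-\infty,m_2}$, compactly supported with respect to $\eta$, such that the corresponding operator $A$ (given by the same formula) does not extend to a bounded operator on $M^p(\mathbb{R}^d)$ if $p<\infty$, nor on $\tilde M^\infty(\mathbb{R}^d)$ if $p=\infty$.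
   Context: The Fourier transform is $\hat f(\eta)=\int f(t)e^{-2\pi i t\cdot\eta}\,dt$; $\langle y\rangle=(1+|y|^2)^{1/2}$; $1/\infty=0$. For $m_1,m_2\in\mathbb{R}$, $\mathbf{SG}^{m_1,m_2}$ is the class of $\sigma\in C^\infty(\mathbb{R}^{2d})$ such that for all multi-indices $\alpha,\beta$ there is $C_{\alpha,\beta}$ with $$|\partial_\eta^\alpha\partial_x^\beta\sigma(x,\eta)|\le C_{\alpha,\beta}\langle\eta\rangle^{m_1-|\alpha|}\langle x\rangle^{m_2-|\beta|}\quad\text{for all }(x,\eta)\in\mathbb{R}^{2d}.$$ $\mathbf{SG}^{m_1,-\infty}=\bigcap_{m_2\in\mathbb{R}}\mathbf{SG}^{m_1,m_2}$ and $\mathbf{SG}^{-\infty,m_2}=\bigcap_{m_1\in\mathbb{R}}\mathbf{SG}^{m_1,m_2}$. A symbol is compactly supported with respect to $x$ (resp. $\eta$) if there is $R>0$ with $\sigma(x,\eta)=0$ whenever $|x|\ge R$ (resp. $|\eta|\ge R$). Modulation spaces: fix a non-zero window $g\in\mathcal{S}(\mathbb{R}^d)$. The short-time Fourier transform of $f\in\mathcal{S}'(\mathbb{R}^d)$ is $V_gf(x,\eta)=\int f(t)\overline{g(t-x)}e^{-2\pi i\eta\cdot t}\,dt$ (understood as a distributional pairing). $M^p(\mathbb{R}^d)$ is the space of $f\in\mathcal{S}'(\mathbb{R}^d)$ with $\|f\|_{M^p}:=\|V_gf\|_{L^p(\mathbb{R}^{2d})}<\infty$; different windows give equivalent norms.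 $\tilde M^\infty(\mathbb{R}^d)$ is the closure of $\mathcal{S}(\mathbb{R}^d)$ in the $M^\infty$-norm. *)

theory Defs
  imports "HOL-Analysis.Analysis" "HOL-Probability.Essential_Supremum"
begin

definition japanese :: "'a::real_normed_vector \<Rightarrow> real" where
  "japanese y = sqrt (1 + (norm y)\<^sup>2)"

definition dir_deriv ::
  "'a::real_normed_vector \<Rightarrow> ('a \<Rightarrow> 'b::real_normed_vector) \<Rightarrow> 'a \<Rightarrow> 'b" where
  "dir_deriv v F z = frechet_derivative F (at z) v"

definition iter_deriv ::
  "'a::real_normed_vector list \<Rightarrow> ('a \<Rightarrow> 'b::real_normed_vector) \<Rightarrow> 'a \<Rightarrow> 'b" where
  "iter_deriv vs F = foldr dir_deriv vs F"

definition smooth :: "('a::euclidean_space \<Rightarrow> 'b::real_normed_vector) \<Rightarrow> bool" where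
  "smooth F \<longleftrightarrow> (\<forall>vs \<in> lists Basis. \<forall>z. iter_deriv vs F differentiable (at z))"

text \<open>A multi-index \<open>\<alpha>\<close> is encoded as the list of the coordinates in which one differentiates,
  repeated according to multiplicity, so that \<open>length \<alpha>\<close> is its order. Since partial derivatives
  of smooth functions commute, lists with the same multiset of entries give the same derivative.\<close>

definition multi_deriv ::
  "'n::finite list \<Rightarrow> (real ^ 'n \<Rightarrow> 'b::real_normed_vector) \<Rightarrow> real ^ 'n \<Rightarrow> 'b" where
  "multi_deriv \<alpha> F = iter_deriv (map (\<lambda>i. axis i 1) \<alpha>) F"

text \<open>Points of \<open>\<real>\<^sup>2\<^sup>d\<close> are pairs \<open>(x, \<eta>)\<close>; \<open>phase_deriv \<alpha> \<beta> F\<close> is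
  \<open>\<partial>\<^sub>\<eta>\<^sup>\<alpha> \<partial>\<^sub>x\<^sup>\<beta> F\<close>.\<close>

definition phase_deriv ::
  "'n::finite list \<Rightarrow> 'n list \<Rightarrow> ((real ^ 'n) \<times> (real ^ 'n) \<Rightarrow> 'b::real_normed_vector)
    \<Rightarrow> (real ^ 'n) \<times> (real ^ 'n) \<Rightarrow> 'b" where
  "phase_deriv \<alpha> \<beta> F =
     iter_deriv (map (\<lambda>i. (0, axis i 1)) \<alpha> @ map (\<lambda>i. (axis i 1, 0)) \<beta>) F"

definition SG ::
  "real \<Rightarrow> real \<Rightarrow> ((real ^ 'n::finite) \<times> (real ^ 'n) \<Rightarrow> 'b::real_normed_vector) set" where
  "SG m1 m2 = {\<sigma>. smooth \<sigma> \<and>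
     (\<forall>\<alpha> \<beta>. \<exists>C. \<forall>x \<eta>. norm (phase_deriv \<alpha> \<beta> \<sigma> (x, \<eta>))
        \<le> C * japanese \<eta> powr (m1 - real (length \<alpha>)) * japanese x powr (m2 - real (length \<beta>)))}"

definition SG_minf_x ::
  "real \<Rightarrow> ((real ^ 'n::finite) \<times> (real ^ 'n) \<Rightarrow> 'b::real_normed_vector) set" where
  "SG_minf_x m1 = (\<Inter>m2. SG m1 m2)"

definition SG_minf_eta ::
  "real \<Rightarrow> ((real ^ 'n::finite) \<times> (real ^ 'n) \<Rightarrow> 'b::real_normed_vector) set" where
  "SG_minf_eta m2 = (\<Inter>m1. SG m1 m2)"

definition compact_supp_x :: "((real ^ 'n::finite) \<times> (real ^ 'n) \<Rightarrow> 'b::real_normed_vector) \<Rightarrow> bool" where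
  "compact_supp_x \<sigma> \<longleftrightarrow> (\<exists>R>0. \<forall>x \<eta>. norm x \<ge> R \<longrightarrow> \<sigma> (x, \<eta>) = 0)"

definition compact_supp_eta :: "((real ^ 'n::finite) \<times> (real ^ 'n) \<Rightarrow> 'b::real_normed_vector) \<Rightarrow> bool" where
  "compact_supp_eta \<sigma> \<longleftrightarrow> (\<exists>R>0. \<forall>x \<eta>. norm \<eta> \<ge> R \<longrightarrow> \<sigma> (x, \<eta>) = 0)"

definition nondegenerate :: "((real ^ 'n::finite) \<times> (real ^ 'n) \<Rightarrow> real) \<Rightarrow> bool" where
  "nondegenerate \<Phi> \<longleftrightarrow> (\<exists>\<delta>>0. \<forall>x \<eta>.
     \<bar>det (\<chi> i l. dir_deriv (axis i 1, 0) (dir_deriv (0, axis l 1) \<Phi>) (x, \<eta>))\<bar> > \<delta>)"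

definition schwartz :: "(real ^ 'n::finite \<Rightarrow> complex) set" where
  "schwartz = {f. smooth f \<and>
     (\<forall>k::nat. \<forall>\<alpha>. bounded (range (\<lambda>x. japanese x ^ k * norm (multi_deriv \<alpha> f x))))}"

definition schwartz_seminorm :: "nat \<Rightarrow> (real ^ 'n::finite \<Rightarrow> complex) \<Rightarrow> real" where
  "schwartz_seminorm k f =
     (\<Sum>\<alpha> | length \<alpha> \<le> k. SUP x. japanese x ^ k * norm (multi_deriv \<alpha> f x))"

type_synonym 'n functional = "(real ^ 'n \<Rightarrow> complex) \<Rightarrow> complex"

text \<open>Tempered distributions are continuous linear functionals on the Schwartz space. Only their
  values on Schwartz functions matter; they are normalised to vanish elsewhere, so that equality
  of distributions is equality of functionals and the vector space operations are pointwise.\<close>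

definition tempered :: "'n::finite functional set" where
  "tempered = {u.
     (\<forall>\<phi>. \<phi> \<notin> schwartz \<longrightarrow> u \<phi> = 0) \<and>
     (\<forall>\<phi>\<in>schwartz. \<forall>\<psi>\<in>schwartz. u (\<lambda>t. \<phi> t + \<psi> t) = u \<phi> + u \<psi>) \<and>
     (\<forall>c. \<forall>\<phi>\<in>schwartz. u (\<lambda>t. c * \<phi> t) = c * u \<phi>) \<and>
     (\<exists>C k. \<forall>\<phi>\<in>schwartz. norm (u \<phi>) \<le> C * schwartz_seminorm k \<phi>)}"

definition distr_of :: "(real ^ 'n::finite \<Rightarrow> complex) \<Rightarrow> 'n functional" where
  "distr_of f = (\<lambda>\<phi>. if \<phi> \<in> schwartz then (LINT t|lborel. f t * \<phi> t) else 0)"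

definition stft ::
  "(real ^ 'n::finite \<Rightarrow> complex) \<Rightarrow> 'n functional \<Rightarrow> (real ^ 'n) \<times> (real ^ 'n) \<Rightarrow> complex" where
  "stft g u = (\<lambda>(x, \<eta>). u (\<lambda>t. cnj (g (t - x)) * cis (- 2 * pi * (\<eta> \<bullet> t))))"

definition Lp_norm :: "ennreal \<Rightarrow> 'a measure \<Rightarrow> ('a \<Rightarrow> complex) \<Rightarrow> ennreal" where
  "Lp_norm p M F =
     (if p = \<infinity> then esssup M (\<lambda>z. ennreal (norm (F z)))
      else let I = (\<integral>\<^sup>+ z. ennreal (norm (F z) powr enn2real p) \<partial>M)
           in if I = \<infinity> then \<infinity> else ennreal (enn2real I powr (1 / enn2real p)))"

definition mod_norm ::
  "(real ^ 'n::finite \<Rightarrow> complex) \<Rightarrow> ennreal \<Rightarrow> 'n functional \<Rightarrow> ennreal" where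
  "mod_norm g p u = Lp_norm p lborel (stft g u)"

definition mod_space ::
  "(real ^ 'n::finite \<Rightarrow> complex) \<Rightarrow> ennreal \<Rightarrow> 'n functional set" where
  "mod_space g p = {u \<in> tempered. mod_norm g p u < \<infinity>}"

definition mod_space_tilde_inf :: "(real ^ 'n::finite \<Rightarrow> complex) \<Rightarrow> 'n functional set" where
  "mod_space_tilde_inf g = {u \<in> mod_space g \<infinity>.
     \<forall>\<epsilon>>0. \<exists>f\<in>schwartz. mod_norm g \<infinity> (\<lambda>\<phi>. u \<phi> - distr_of f \<phi>) < ennreal \<epsilon>}"

definition fourier :: "(real ^ 'n::finite \<Rightarrow> complex) \<Rightarrow> real ^ 'n \<Rightarrow> complex" where
  "fourier f \<eta> = (LINT t|lborel. f t * cis (- 2 * pi * (t \<bullet> \<eta>)))"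

definition FIO ::
  "((real ^ 'n::finite) \<times> (real ^ 'n) \<Rightarrow> real) \<Rightarrow> ((real ^ 'n) \<times> (real ^ 'n) \<Rightarrow> complex)
    \<Rightarrow> (real ^ 'n \<Rightarrow> complex) \<Rightarrow> real ^ 'n \<Rightarrow> complex" where
  "FIO \<Phi> \<sigma> f x = (LINT \<eta>|lborel. cis (2 * pi * \<Phi> (x, \<eta>)) * \<sigma> (x, \<eta>) * fourier f \<eta>)"

definition extends_to_bounded_operator ::
  "((real ^ 'n::finite \<Rightarrow> complex) \<Rightarrow> real ^ 'n \<Rightarrow> complex)
    \<Rightarrow> 'n functional set \<Rightarrow> ('n functional \<Rightarrow> ennreal) \<Rightarrow> bool" where
  "extends_to_bounded_operator A X N \<longleftrightarrow> (\<exists>T.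
     (\<forall>u\<in>X. T u \<in> X) \<and>
     (\<forall>u\<in>X. \<forall>v\<in>X. T (\<lambda>\<phi>. u \<phi> + v \<phi>) = (\<lambda>\<phi>. T u \<phi> + T v \<phi>)) \<and>
     (\<forall>c. \<forall>u\<in>X. T (\<lambda>\<phi>. c * u \<phi>) = (\<lambda>\<phi>. c * T u \<phi>)) \<and>
     (\<exists>C::real. \<forall>u\<in>X. N (T u) \<le> ennreal C * N u) \<and>
     (\<forall>f\<in>schwartz. T (distr_of f) = distr_of (A f)))"

end

theory Submission
  imports Defs "HOL-Probability.Probability"
begin

text \<open>
  Take \<open>\<Phi>(x, \<eta>) = \<eta> \<bullet> (x + s(x) e)\<close> with a unit vector \<open>e\<close> and \<open>s\<close> smooth with compact support,
  and \<open>\<sigma>(x, \<eta>) = G(x) \<langle>\<eta>\<rangle>\<^sup>m\<close>: up to the factor \<open>\<langle>\<eta>\<rangle>\<^sup>m\<close> the operator is a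
  nonlinear change of variables. The test functions are a Gaussian \<open>M\<close> modulated by \<open>n e\<close> and
  the chirp \<open>E(y) = exp (2 \<pi> i n (e \<bullet> y + l |y|\<^sup>2 / 2)) \<gamma>(y)\<close>, with \<open>\<gamma>\<close> a Gaussian. The modulation
  norms of \<open>M\<close> do not depend on \<open>n\<close>, whereas for \<open>q \<ge> 2\<close> the \<open>M\<^sup>q\<close> norm of \<open>E\<close> is at
  most \<open>C n\<^bsup>-d (1/2 - 1/q)\<^esup>\<close>: interpolate between the isometry of the short-time Fourier
  transform on \<open>L\<^sup>2\<close> and its supremum, which is controlled by the supremum of the Fourier
  transform of \<open>E\<close>, a complex Gaussian.

  If \<open>p \<le> 2\<close>, take \<open>s(x) = l |x|\<^sup>2 / 2\<close> near \<open>0\<close>; the operator maps \<open>M\<close> to about \<open>n\<^sup>m G E\<close>,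
  which is paired with \<open>E\<close> in the dual space. If \<open>p \<ge> 2\<close>, choose \<open>s\<close> such that the change of
  variables straightens the phase of \<open>E\<close> to \<open>e \<bullet> x\<close>; the operator maps
  \<open>n\<^sup>m \<langle>D\<rangle>\<^bsup>-m\<^esup> E\<close> to \<open>n\<^sup>m G M\<close> times a Gaussian, which is paired with \<open>M\<close>. In
  both cases the pairing is at least \<open>c n\<^sup>m\<close>, and duality contradicts boundedness as
  \<open>n \<rightarrow> \<infinity>\<close>. Exchanging the roles of \<open>x\<close> and \<open>\<eta>\<close> exchanges the function and the
  Fourier transform of the functional in the bilinear form, and as modulation norms are invariant
  under the Fourier transform this yields the second statement for the conjugate exponent.
\<close>


section \<open>Symbol classes\<close>

text \<open>The linear term n e in the test functions does two things. It places their frequencies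
  near n e, where the weight of the symbol has size n^m, and it turns the displacement s(x) e into
  the phase n s(x), whose second derivatives grow like n. Such a chirp has modulus of order one, but
  its Fourier transform is spread over a ball of radius about n with height about n^{-d/2}. This
  height is the source of the exponent d |1/2 - 1/p|. The displacement has a fixed direction, so the
  mixed Hessian of the phase is the identity plus a matrix of rank one, with determinant one plus
  the derivative of \<open>s\<close> along e. Non-degeneracy becomes smallness of that derivative,
  achieved by a small \<open>l\<close> that stays fixed while n grows. A globally quadratic
  \<open>s\<close> would leave SG^{1,1}; hence the cutoffs, equal to 1 on the support of the
  amplitude. Schwartz functions belong to every space considered, so a bounded extension implies an
  estimate on Schwartz functions, and this estimate is contradicted. Their images may grow
  polynomially in the second statement, so the duality inequality has to admit such growth.\<close>

lemma dir_deriv_eqI: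
  assumes "(F has_derivative D) (at z)"
  shows "dir_deriv v F z = D v"
  unfolding dir_deriv_def using frechet_derivative_at[OF assms] by simp

lemma has_derivative_dir_deriv:
  assumes "F differentiable (at z)"
  shows "(F has_derivative (\<lambda>v. dir_deriv v F z)) (at z)"
  unfolding dir_deriv_def using assms by (simp add: frechet_derivative_works[symmetric])

text \<open>\<open>symk W s k m F\<close> controls the derivatives of \<open>F\<close> up to order \<open>k\<close>: the weight is \<open>W m\<close>,
  and differentiating in the direction \<open>v\<close> shifts its index by \<open>s v\<close>.\<close>

primrec symk ::
  "('i::ab_group_add \<Rightarrow> 'a::euclidean_space \<Rightarrow> real) \<Rightarrow> ('a \<Rightarrow> 'i) \<Rightarrow> nat \<Rightarrow> 'i \<Rightarrow> ('a \<Rightarrow> 'b::real_normed_vector) \<Rightarrow> bool"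
where
  "symk W s 0 m F \<longleftrightarrow> (\<exists>C. \<forall>z. norm (F z) \<le> C * W m z)"
| "symk W s (Suc k) m F \<longleftrightarrow> (\<exists>C. \<forall>z. norm (F z) \<le> C * W m z) \<and> (\<forall>z. F differentiable (at z)) \<and>
     (\<forall>v\<in>Basis. symk W s k (m + s v) (dir_deriv v F))"

definition symb ::
  "('i::ab_group_add \<Rightarrow> 'a::euclidean_space \<Rightarrow> real) \<Rightarrow> ('a \<Rightarrow> 'i) \<Rightarrow> 'i \<Rightarrow> ('a \<Rightarrow> 'b::real_normed_vector) \<Rightarrow> bool"
where "symb W s m F \<longleftrightarrow> (\<forall>k. symk W s k m F)"

lemma symbI: "(\<And>k. symk W s k m F) \<Longrightarrow> symb W s m F"
  by (simp add: symb_def)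

lemma symbD: "symb W s m F \<Longrightarrow> symk W s k m F"
  by (simp add: symb_def)

text \<open>Lets the derivative be given by any formula \<open>D\<close>. An induction step then
  computes the derivative in closed form and recognises it as built from functions already
  covered.\<close>

lemma symk_SucI:
  assumes "\<exists>C. \<forall>z. norm (F z) \<le> C * W m z"
    and "\<And>z. (F has_derivative D z) (at z)"
    and "\<And>v. v \<in> Basis \<Longrightarrow> symk W s k (m + s v) (\<lambda>z. D z v)"
  shows "symk W s (Suc k) m F"
proof -
  have "dir_deriv v F = (\<lambda>z. D z v)" for v
    using dir_deriv_eqI[OF assms(2)] by auto
  then show ?thesis
    using assms by (auto simp: differentiable_def)
qed

lemma symk_Suc: "symk W s (Suc k) m F \<Longrightarrow> symk W s k m F"
proof (induction k arbitrary: m F)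
  case (Suc k)
  from Suc.prems show ?case
    by (subst symk.simps(2)) (use Suc.IH in \<open>auto simp del: symk.simps(2) simp: symk.simps(2)[of W s "Suc k"]\<close>)
qed simp

lemma symb_deriv:
  assumes "symb W s m F"
  shows symb_dir_deriv: "v \<in> Basis \<Longrightarrow> symb W s (m + s v) (dir_deriv v F)"
    and symb_bound: "\<exists>C. \<forall>z. norm (F z) \<le> C * W m z"
    and symb_differentiable: "F differentiable (at z)"
    and symb_has_derivative: "(F has_derivative (\<lambda>v. dir_deriv v F z)) (at z)"
proof -
  show "v \<in> Basis \<Longrightarrow> symb W s (m + s v) (dir_deriv v F)"
    using symbD[OF assms, of "Suc _"] by (auto intro!: symbI)
  show "\<exists>C. \<forall>z. norm (F z) \<le> C * W m z"
    using symbD[OF assms, of 0] by simp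
  show "F differentiable (at z)"
    using symbD[OF assms, of 1] by simp
  then show "(F has_derivative (\<lambda>v. dir_deriv v F z)) (at z)"
    by (rule has_derivative_dir_deriv)
qed

lemma symb_continuous: "symb W s m F \<Longrightarrow> continuous_on A F"
  by (meson continuous_at_imp_continuous_on differentiable_imp_continuous_within symb_differentiable)

lemma symb_iter_deriv:
  assumes "symb W s m F" "vs \<in> lists Basis"
  shows "symb W s (m + sum_list (map s vs)) (iter_deriv vs F)"
  using assms(2)
proof (induction vs)
  case Nil
  then show ?case using assms by (simp add: iter_deriv_def)
next
  case (Cons v vs)
  then have "symb W s (m + sum_list (map s vs)) (iter_deriv vs F)" "v \<in> Basis" by auto
  from symb_dir_deriv[OF this] show ?case
    by (simp add: iter_deriv_def add_ac)
qed

lemma symb_smooth: "symb W s m F \<Longrightarrow> smooth F"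
  unfolding smooth_def by (blast intro: symb_differentiable symb_iter_deriv)

text \<open>Multiplicativity in the index is what the Leibniz rule requires: orders add under
  products. One locale serves both the real orders on Euclidean space and the pairs of orders on
  phase space.\<close>

locale weight =
  fixes W :: "'i::ab_group_add \<Rightarrow> 'a::euclidean_space \<Rightarrow> real" and s :: "'a \<Rightarrow> 'i"
  assumes W_pos: "0 < W m z" and W_add: "W (m + m') z = W m z * W m' z"
begin

lemma bound_pos:
  assumes "\<exists>C. \<forall>z. norm (F z) \<le> C * W m z"
  obtains C where "C > 0" "\<And>z. norm (F z) \<le> C * W m z"
proof -
  obtain C where C: "\<And>z. norm (F z) \<le> C * W m z" using assms by auto
  have "norm (F z) \<le> (\<bar>C\<bar> + 1) * W m z" for z
    using C[of z] mult_right_mono[of C "\<bar>C\<bar> + 1" "W m z"] W_pos[of m z] by linarith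
  then show ?thesis using that[of "\<bar>C\<bar> + 1"] by auto
qed

lemma symk_zero: "symk W s k m (\<lambda>z. 0)"
proof (induction k arbitrary: m)
  case 0
  show ?case by (auto intro: exI[of _ 0])
next
  case (Suc k)
  show ?case
    by (rule symk_SucI[where D="\<lambda>z v. 0"]) (auto intro: exI[of _ 0] Suc)
qed

lemma symk_add:
  "symk W s k m F \<Longrightarrow> symk W s k m G \<Longrightarrow> symk W s k m (\<lambda>z. F z + G z)"
proof (induction k arbitrary: m F G)
  have bd: "\<exists>C. \<forall>z. norm (F z + G z) \<le> C * W m z"
    if F: "\<exists>C. \<forall>z. norm (F z) \<le> C * W m z" and G: "\<exists>C. \<forall>z. norm (G z) \<le> C * W m z" for F G :: "'a \<Rightarrow> 'b" and m
  proof -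
    obtain C D where "\<And>z. norm (F z) \<le> C * W m z" "\<And>z. norm (G z) \<le> D * W m z" using F G by auto
    then have "norm (F z + G z) \<le> (C + D) * W m z" for z
      by (smt (verit) distrib_right norm_triangle_ineq)
    then show ?thesis by blast
  qed
  {
    case 0
    then show ?case using bd[of F m G] by simp
  next
    case (Suc k)
    show ?case
    proof (rule symk_SucI[where D="\<lambda>z v. dir_deriv v F z + dir_deriv v G z"])
      show "\<exists>C. \<forall>z. norm (F z + G z) \<le> C * W m z" using bd Suc.prems by auto
      show "((\<lambda>z. F z + G z) has_derivative (\<lambda>v. dir_deriv v F z + dir_deriv v G z)) (at z)" for z
        using Suc.prems by (auto intro!: has_derivative_add has_derivative_dir_deriv)
      show "symk W s k (m + s v) (\<lambda>z. dir_deriv v F z + dir_deriv v G z)" if "v \<in> Basis" for v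
        using Suc.prems that by (intro Suc.IH) auto
    qed
  }
qed

text \<open>The two Leibniz terms carry the indices m + (m' + s v) and (m + s v) + m', which agree
  because the index group is commutative.\<close>

lemma symk_bilinear:
  assumes "bounded_bilinear B"
  shows "symk W s k m F \<Longrightarrow> symk W s k m' G \<Longrightarrow> symk W s k (m + m') (\<lambda>z. B (F z) (G z))"
proof (induction k arbitrary: m m' F G)
  interpret B: bounded_bilinear B by fact
  have bd: "\<exists>C. \<forall>z. norm (B (F z) (G z)) \<le> C * W (m + m') z"
    if F: "\<exists>C. \<forall>z. norm (F z) \<le> C * W m z" and G: "\<exists>C. \<forall>z. norm (G z) \<le> C * W m' z" for F G m m'
  proof -
    obtain C where C: "C > 0" "\<And>z. norm (F z) \<le> C * W m z" using bound_pos[OF F] by blast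
    obtain D where D: "D > 0" "\<And>z. norm (G z) \<le> D * W m' z" using bound_pos[OF G] by blast
    obtain K where K: "K > 0" "\<And>a b. norm (B a b) \<le> norm a * norm b * K" using B.pos_bounded by blast
    have "norm (B (F z) (G z)) \<le> (C * D * K) * W (m + m') z" for z
    proof -
      have "norm (B (F z) (G z)) \<le> norm (F z) * norm (G z) * K" by (rule K)
      also have "\<dots> \<le> (C * W m z) * (D * W m' z) * K"
        using C D K W_pos by (intro mult_right_mono mult_mono) (auto intro: less_imp_le)
      finally show ?thesis by (simp add: W_add mult_ac)
    qed
    then show ?thesis by blast
  qed
  {
    case 0
    then show ?case using bd[of F m G m'] by simp
  next
    case (Suc k)
    show ?case
    proof (rule symk_SucI[where D="\<lambda>z v. B (F z) (dir_deriv v G z) + B (dir_deriv v F z) (G z)"])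
      show "\<exists>C. \<forall>z. norm (B (F z) (G z)) \<le> C * W (m + m') z" using bd Suc.prems by auto
      show "((\<lambda>z. B (F z) (G z)) has_derivative (\<lambda>v. B (F z) (dir_deriv v G z) + B (dir_deriv v F z) (G z))) (at z)" for z
        using Suc.prems by (auto intro!: B.FDERIV has_derivative_dir_deriv)
      show "symk W s k (m + m' + s v) (\<lambda>z. B (F z) (dir_deriv v G z) + B (dir_deriv v F z) (G z))" if "v \<in> Basis" for v
      proof (rule symk_add)
        have "symk W s k (m + (m' + s v)) (\<lambda>z. B (F z) (dir_deriv v G z))"
          using Suc.prems that by (intro Suc.IH) (auto simp: symk_Suc[OF Suc.prems(1)] symk_Suc[OF Suc.prems(2)] simp del: symk.simps(2) intro: symk.simps(2)[THEN iffD1, THEN conjunct2, THEN conjunct2, rule_format])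
        then show "symk W s k (m + m' + s v) (\<lambda>z. B (F z) (dir_deriv v G z))" by (simp add: add_ac)
        have "symk W s k ((m + s v) + m') (\<lambda>z. B (dir_deriv v F z) (G z))"
          using Suc.prems that by (intro Suc.IH) (auto simp: symk_Suc[OF Suc.prems(1)] symk_Suc[OF Suc.prems(2)] simp del: symk.simps(2) intro: symk.simps(2)[THEN iffD1, THEN conjunct2, THEN conjunct2, rule_format])
        then show "symk W s k (m + m' + s v) (\<lambda>z. B (dir_deriv v F z) (G z))" by (simp add: add_ac)
      qed
    qed
  }
qed

lemmas symk_mult = symk_bilinear[OF bounded_bilinear_mult]

lemma symk_linear:
  assumes "bounded_linear L"
  shows "symk W s k m F \<Longrightarrow> symk W s k m (\<lambda>z. L (F z))"
proof (induction k arbitrary: m F)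
  have bd: "\<exists>C. \<forall>z. norm (L (F z)) \<le> C * W m z"
    if F: "\<exists>C. \<forall>z. norm (F z) \<le> C * W m z" for F m
  proof -
    obtain C where C: "C > 0" "\<And>z. norm (F z) \<le> C * W m z" using bound_pos[OF F] by blast
    obtain K where K: "K > 0" "\<And>a. norm (L a) \<le> norm a * K" using bounded_linear.pos_bounded[OF assms] by blast
    have "norm (L (F z)) \<le> (C * K) * W m z" for z
      using order_trans[OF K(2)[of "F z"] mult_right_mono[OF C(2)[of z], of K]] K(1) by (simp add: mult_ac)
    then show ?thesis by blast
  qed
  {
    case 0
    then show ?case using bd[of F m] by simp
  next
    case (Suc k)
    show ?case
    proof (rule symk_SucI[where D="\<lambda>z v. L (dir_deriv v F z)"])
      show "\<exists>C. \<forall>z. norm (L (F z)) \<le> C * W m z" using bd Suc.prems by auto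
      show "((\<lambda>z. L (F z)) has_derivative (\<lambda>v. L (dir_deriv v F z))) (at z)" for z
        using Suc.prems by (auto intro!: bounded_linear.has_derivative[OF assms] has_derivative_dir_deriv)
      show "symk W s k (m + s v) (\<lambda>z. L (dir_deriv v F z))" if "v \<in> Basis" for v
        using Suc.prems that by (intro Suc.IH) auto
    qed
  }
qed

lemma symk_minus: "symk W s k m F \<Longrightarrow> symk W s k m (\<lambda>z. - F z)"
  by (rule symk_linear[OF bounded_linear_minus[OF bounded_linear_ident]])

lemma symk_diff: "symk W s k m F \<Longrightarrow> symk W s k m G \<Longrightarrow> symk W s k m (\<lambda>z. F z - G z)"
  using symk_add[OF _ symk_minus, of k m F G] by simp

lemma symk_cmult: "symk W s k m F \<Longrightarrow> symk W s k m (\<lambda>z. c * F z :: 'b::real_normed_algebra)"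
  by (rule symk_linear[OF bounded_linear_mult_right])

lemma symk_scale: "symk W s k m F \<Longrightarrow> symk W s k m (\<lambda>z. c *\<^sub>R F z)"
  by (rule symk_linear[OF bounded_linear_scaleR_right])

lemma symk_of_real: "symk W s k m F \<Longrightarrow> symk W s k m (\<lambda>z. complex_of_real (F z))"
  by (rule symk_linear[OF bounded_linear_of_real])

lemma symk_sum: "finite A \<Longrightarrow> (\<And>i. i \<in> A \<Longrightarrow> symk W s k m (F i)) \<Longrightarrow> symk W s k m (\<lambda>z. \<Sum>i\<in>A. F i z)"
  by (induction A rule: finite_induct) (auto intro: symk_add symk_zero)

lemma symb_add: "symb W s m F \<Longrightarrow> symb W s m G \<Longrightarrow> symb W s m (\<lambda>z. F z + G z)"
  and symb_diff: "symb W s m F \<Longrightarrow> symb W s m G \<Longrightarrow> symb W s m (\<lambda>z. F z - G z)"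
  and symb_linear: "bounded_linear L \<Longrightarrow> symb W s m F \<Longrightarrow> symb W s m (\<lambda>z. L (F z))"
  and symb_sum: "finite A \<Longrightarrow> (\<And>i. i \<in> A \<Longrightarrow> symb W s m (H i)) \<Longrightarrow> symb W s m (\<lambda>z. \<Sum>i\<in>A. H i z)"
  and symb_bilinear: "bounded_bilinear B \<Longrightarrow> symb W s m P \<Longrightarrow> symb W s m' Q \<Longrightarrow> symb W s (m + m') (\<lambda>z. B (P z) (Q z))"
  by (auto intro!: symbI dest: symbD intro: symk_add symk_diff symk_linear symk_sum symk_bilinear)

lemmas symb_mult = symb_bilinear[OF bounded_bilinear_mult]
lemmas symb_cmult = symb_linear[OF bounded_linear_mult_right]
lemmas symb_of_real = symb_linear[OF bounded_linear_of_real]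
lemmas symb_cnj = symb_linear[OF bounded_linear_cnj]

end


section \<open>Powers of the Japanese bracket as weights on Euclidean space\<close>

lemma japanese_ge_1: "1 \<le> japanese x"
  by (simp add: japanese_def)

lemma japanese_pos [simp]: "0 < japanese x" "0 \<le> japanese x" "japanese x \<noteq> 0"
  using japanese_ge_1[of x] by auto

lemma norm_le_japanese: "norm x \<le> japanese x"
  unfolding japanese_def by (rule real_le_rsqrt) simp

lemma japanese_le: "japanese x \<le> 1 + norm x"
  unfolding japanese_def by (rule real_le_lsqrt) (auto simp: power2_eq_square algebra_simps)

lemma japanese_sq: "(japanese x)\<^sup>2 = 1 + (norm x)\<^sup>2"
  by (simp add: japanese_def)

lemma japanese_minus [simp]: "japanese (- x) = japanese x"
  by (simp add: japanese_def)

lemma japanese_add: "japanese (x + y) \<le> 2 * japanese x * japanese y"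
proof (rule power2_le_imp_le)
  have "(norm (x + y))\<^sup>2 \<le> (norm x + norm y)\<^sup>2"
    by (intro power_mono norm_triangle_ineq) auto
  also have "\<dots> \<le> 2 * (norm x)\<^sup>2 + 2 * (norm y)\<^sup>2"
    using sum_squares_bound[of "norm x" "norm y"] by (simp add: power2_sum)
  finally have "1 + (norm (x + y))\<^sup>2 \<le> 4 * ((1 + (norm x)\<^sup>2) * (1 + (norm y)\<^sup>2))"
  proof -
    assume "(norm (x + y))\<^sup>2 \<le> 2 * (norm x)\<^sup>2 + 2 * (norm y)\<^sup>2"
    moreover have "4 * ((1 + (norm x)\<^sup>2) * (1 + (norm y)\<^sup>2))
        = 4 + 4 * (norm x)\<^sup>2 + 4 * (norm y)\<^sup>2 + 4 * ((norm x)\<^sup>2 * (norm y)\<^sup>2)"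
      by (simp add: algebra_simps)
    moreover have "0 \<le> (norm x)\<^sup>2" "0 \<le> (norm y)\<^sup>2" "0 \<le> (norm x)\<^sup>2 * (norm y)\<^sup>2" by simp_all
    ultimately show ?thesis by linarith
  qed
  then show "(japanese (x + y))\<^sup>2 \<le> (2 * japanese x * japanese y)\<^sup>2"
    by (simp add: power_mult_distrib japanese_sq mult.assoc)
qed simp

text \<open>Peetre's inequality. For negative exponents it comes from \<open>japanese_add\<close>
  applied to x = (x + y) + (- y), since a negative power reverses the estimate.\<close>

lemma japanese_powr_ge:
  "japanese (x + y) powr m \<le> (2 powr \<bar>m\<bar>) * japanese x powr m * japanese y powr \<bar>m\<bar>"
proof (cases "m \<ge> 0")
  case True
  then have "japanese (x + y) powr m \<le> (2 * japanese x * japanese y) powr m"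
    by (intro powr_mono2 japanese_add) auto
  then show ?thesis using True by (simp add: powr_mult)
next
  case False
  have "japanese x \<le> 2 * japanese (x + y) * japanese (- y)"
    using japanese_add[of "x + y" "- y"] by simp
  then have "(2 * japanese (x + y) * japanese y) powr m \<le> japanese x powr m"
    using False by (intro powr_mono2') (auto intro: less_imp_le)
  then have "2 powr m * japanese (x + y) powr m * japanese y powr m \<le> japanese x powr m"
    by (simp add: powr_mult)
  then have "japanese (x + y) powr m \<le> inverse (2 powr m) * japanese x powr m * inverse (japanese y powr m)"
    by (simp add: field_simps)
  then show ?thesis using False by (simp add: powr_minus)
qed

abbreviation jw :: "real \<Rightarrow> 'a::real_normed_vector \<Rightarrow> real" where
  "jw m x \<equiv> japanese x powr m"

interpretation jw: weight "jw :: real \<Rightarrow> 'a::euclidean_space \<Rightarrow> real" s for s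
  by unfold_locales (auto simp: powr_add)

abbreviation moderate :: "real \<Rightarrow> ('a::euclidean_space \<Rightarrow> 'b::real_normed_vector) \<Rightarrow> bool" where
  "moderate \<equiv> symb jw (\<lambda>_. 1)"

text \<open>Each derivative gains one power of the weight, which is the behaviour that the SG
  estimates demand in each of the two variables.\<close>

abbreviation classical :: "real \<Rightarrow> ('a::euclidean_space \<Rightarrow> 'b::real_normed_vector) \<Rightarrow> bool" where
  "classical \<equiv> symb jw (\<lambda>_. - 1)"

lemma powr_mono_japanese: "m \<le> m' \<Longrightarrow> jw m x \<le> jw m' x"
  using japanese_ge_1[of x] by (simp add: powr_mono)

lemma symk_jw_mono:
  assumes "m \<le> m'" "c \<le> c'" "symk jw (\<lambda>_. c) k m F"
  shows "symk jw (\<lambda>_. c') k m' F"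
  using assms(1,3)
proof (induction k arbitrary: m m' F)
  have bd: "\<exists>C. \<forall>z. norm (F z) \<le> C * jw m' z"
    if le: "m \<le> m'" and F: "\<exists>C. \<forall>z. norm (F z) \<le> C * jw m z" for F :: "'a \<Rightarrow> 'b" and m m'
  proof -
    obtain C where C: "C > 0" "\<And>z. norm (F z) \<le> C * jw m z" using jw.bound_pos[OF F] by blast
    have "norm (F z) \<le> C * jw m' z" for z
      using C(2)[of z] mult_left_mono[OF powr_mono_japanese[OF le, of z], of C] C(1) by linarith
    then show ?thesis by blast
  qed
  {
    case 0
    then show ?case using bd[of m m' F] by simp
  next
    case (Suc k)
    have "symk jw (\<lambda>_. c') k (m' + c') (dir_deriv v F)" if "v \<in> Basis" for v
      using Suc.prems assms(2) that by (intro Suc.IH[of "m + c"]) auto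
    with Suc.prems bd[of m m' F] show ?case by simp
  }
qed

lemma symk_const: "0 \<le> m \<Longrightarrow> symk jw s k m (\<lambda>z::'a::euclidean_space. c)"
proof (cases k)
  assume m: "0 \<le> m"
  have bd: "\<exists>C. \<forall>z::'a. norm c \<le> C * jw m z"
    using powr_mono_japanese[OF m] by (intro exI[of _ "norm c"]) (auto intro!: mult_le_cancel_left1[THEN iffD2])
  {
    case 0
    with bd show ?thesis by simp
  next
    case (Suc n)
    show ?thesis unfolding Suc using bd
      by (intro symk_SucI[where D="\<lambda>z v. 0"]) (auto intro: jw.symk_zero)
  }
qed

text \<open>The derivative is constant, hence of order 0, and \<open>- 1 \<le> c\<close> makes its
  permitted order 1 + c non-negative. Both scales, c = 1 and c = - 1, are covered.\<close>

lemma symk_bounded_linear: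
  fixes L :: "'a::euclidean_space \<Rightarrow> 'b::real_normed_vector"
  assumes "bounded_linear L" "- 1 \<le> c"
  shows "symk jw (\<lambda>_. c) k 1 L"
proof -
  interpret bounded_linear L by fact
  obtain K where K: "K > 0" "\<And>x. norm (L x) \<le> norm x * K" using pos_bounded by blast
  have bd: "norm (L z) \<le> K * jw 1 z" for z
    using order_trans[OF K(2)[of z] mult_right_mono[OF norm_le_japanese[of z], of K]] K(1) by (simp add: mult_ac)
  show ?thesis
  proof (cases k)
    case 0
    then show ?thesis using bd by (auto intro!: exI[of _ K])
  next
    case (Suc n)
    have "symk jw (\<lambda>_. c) n (1 + c) (\<lambda>z. L v)" for v
      by (rule symk_const) (use assms in auto)
    then show ?thesis unfolding Suc using bd
      by (intro symk_SucI[where D="\<lambda>z. L"]) (auto intro: bounded_linear_imp_has_derivative assms)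
  qed
qed

lemma japanese_powr_eq: "jw m x = (1 + x \<bullet> x) powr (m / 2)"
  by (simp add: japanese_def powr_half_sqrt[symmetric] power2_norm_eq_inner powr_powr add_nonneg_nonneg)

lemma jw_has_derivative:
  fixes x :: "'a::real_inner"
  shows "(jw m has_derivative (\<lambda>v. m * (jw (m - 2) x * (x \<bullet> v)))) (at x)"
proof -
  have p: "1 + y \<bullet> y > 0" for y :: 'a by (simp add: add_pos_nonneg)
  have "((\<lambda>x. (1 + x \<bullet> x) powr (m / 2)) has_derivative
     (\<lambda>v. (1 + x \<bullet> x) powr (m / 2) * (0 * ln (1 + x \<bullet> x) + (2 * (x \<bullet> v)) * (m / 2) / (1 + x \<bullet> x)))) (at x)"
    by (rule has_derivative_powr) (use p in \<open>auto intro!: derivative_eq_intros simp: inner_commute\<close>)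
  moreover have "(1 + x \<bullet> x) powr ((m - 2) / 2) = (1 + x \<bullet> x) powr (m / 2) / (1 + x \<bullet> x)"
    using p[of x] by (simp add: powr_diff diff_divide_distrib)
  ultimately show ?thesis
    unfolding japanese_powr_eq by (simp add: field_simps)
qed

text \<open>The derivative is a multiple of \<open>jw (m - 2)\<close> times a linear function, so
  the induction closes when it runs over all \<open>m\<close> at once; minus two plus one is the
  required gain of one order.\<close>

lemma symk_jw: "symk jw (\<lambda>_. - 1) k m (jw m :: 'a::euclidean_space \<Rightarrow> real)"
proof (induction k arbitrary: m)
  case 0
  show ?case by (auto intro: exI[of _ 1])
next
  case (Suc k)
  show ?case
  proof (rule symk_SucI[OF _ jw_has_derivative])
    show "\<exists>C. \<forall>z::'a. norm (jw m z) \<le> C * jw m z" by (auto intro: exI[of _ 1])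
    fix v :: 'a
    have "symk jw (\<lambda>_. - 1) k (m - 2 + 1) (\<lambda>z::'a. jw (m - 2) z * (z \<bullet> v))"
      by (intro jw.symk_mult Suc symk_bounded_linear bounded_linear_inner_left) simp
    then show "symk jw (\<lambda>_. - 1) k (m + - 1) (\<lambda>z. m * (jw (m - 2) z * (z \<bullet> v)))"
      by (intro jw.symk_cmult) simp
  qed
qed

text \<open>Differentiation multiplies the exponential by a factor of order 1, exactly the cost that
  \<open>moderate\<close> permits. A bound on the exponential itself therefore controls all
  derivatives, in particular for complex quadratic exponents.\<close>

lemma symk_exp:
  fixes q :: "'a::euclidean_space \<Rightarrow> complex"
  assumes bd: "\<exists>C. \<forall>z. norm (exp (q z)) \<le> C * jw m z"
    and q: "\<And>z. (q has_derivative D z) (at z)"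
    and D: "\<And>v k. v \<in> Basis \<Longrightarrow> symk jw (\<lambda>_. 1) k 1 (\<lambda>z. D z v)"
  shows "symk jw (\<lambda>_. 1) k m (\<lambda>z. exp (q z))"
proof -
  have "\<forall>m. (\<exists>C. \<forall>z. norm (exp (q z)) \<le> C * jw m z) \<longrightarrow> symk jw (\<lambda>_. 1) k m (\<lambda>z. exp (q z))"
  proof (induction k)
    case 0
    then show ?case by simp
  next
    case (Suc k)
    show ?case
    proof (intro allI impI)
      fix m
      assume bd: "\<exists>C. \<forall>z. norm (exp (q z)) \<le> C * jw m z"
      show "symk jw (\<lambda>_. 1) (Suc k) m (\<lambda>z. exp (q z))"
      proof (rule symk_SucI)
        show "\<exists>C. \<forall>z. norm (exp (q z)) \<le> C * jw m z" by (fact bd)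
        show "((\<lambda>z. exp (q z)) has_derivative (\<lambda>v. D z v * exp (q z))) (at z)" for z
          using has_derivative_compose[OF q[of z] DERIV_exp[unfolded has_field_derivative_def]]
          by (simp add: mult.commute)
        show "symk jw (\<lambda>_. 1) k (m + 1) (\<lambda>z. D z v * exp (q z))" if "v \<in> Basis" for v
          using jw.symk_mult[OF D[OF that] Suc.IH[rule_format, OF bd]] by (simp add: add.commute)
      qed
    qed
  qed
  then show ?thesis using bd by blast
qed


section \<open>Integration on Euclidean space\<close>

text \<open>Comparison with a product of one-dimensional densities 1/(1 + t^2). Each factor 1 + t^2
  is at most the squared bracket, so one factor per coordinate produces the exponent minus twice the
  dimension.\<close>

lemma integrable_japanese:
  assumes "m \<le> - 2 * real DIM('a)"
  shows "integrable lborel (jw m :: 'a::euclidean_space \<Rightarrow> real)"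
proof (rule Bochner_Integration.integrable_bound)
  let ?f = "\<lambda>x::'a. \<Prod>b\<in>Basis. 1 / (1 + (x \<bullet> b)\<^sup>2)"
  have 1: "integrable lborel (\<lambda>x::real. inverse (1 + x\<^sup>2))"
    using integrable_inverse_1_plus_square by (simp add: set_integrable_def)
  have "(\<integral>\<^sup>+x. ennreal (inverse (1 + x\<^sup>2)) \<partial>lborel) < \<infinity>"
    using integrable_iff_bounded[THEN iffD1, OF 1] by simp
  moreover have "(\<integral>\<^sup>+x. (\<Prod>b\<in>Basis. ennreal (inverse (1 + (x \<bullet> b)\<^sup>2))) \<partial>(lborel :: 'a measure))
      = (\<Prod>b\<in>(Basis::'a set). (\<integral>\<^sup>+x. ennreal (inverse (1 + x\<^sup>2)) \<partial>lborel))"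
    by (rule nn_integral_lborel_prod) auto
  moreover have "(\<Prod>b\<in>Basis. ennreal (inverse (1 + (x \<bullet> b)\<^sup>2))) = ennreal (?f x)" for x :: 'a
    by (subst prod_ennreal) (simp_all add: inverse_eq_divide)
  ultimately have "(\<integral>\<^sup>+x. ennreal (?f x) \<partial>lborel) < \<infinity>"
    by (simp only: prod_constant power_less_top_ennreal infinity_ennreal_def) simp
  then show "integrable lborel ?f"
    by (subst integrable_iff_bounded) (simp add: abs_prod)
  show "AE x in lborel. norm (jw m x) \<le> norm (?f x)"
  proof (rule AE_I2)
    fix x :: 'a
    have "jw m x \<le> jw (- 2 * real DIM('a)) x" using assms by (rule powr_mono_japanese)
    also have "\<dots> = 1 / (1 + (norm x)\<^sup>2) ^ DIM('a)"
      by (simp add: japanese_powr_eq powr_minus powr_realpow add_pos_nonneg power2_norm_eq_inner inverse_eq_divide)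
    also have "\<dots> \<le> 1 / (\<Prod>b\<in>(Basis::'a set). 1 + (x \<bullet> b)\<^sup>2)"
    proof -
      have "(x \<bullet> b)\<^sup>2 \<le> (norm x)\<^sup>2" if "b \<in> Basis" for b
        using Basis_le_norm[OF that, of x] by (metis abs_le_square_iff abs_norm_cancel)
      then have "(\<Prod>b\<in>(Basis::'a set). 1 + (x \<bullet> b)\<^sup>2) \<le> (\<Prod>b\<in>(Basis::'a set). 1 + (norm x)\<^sup>2)"
        by (intro prod_mono) auto
      then show ?thesis
        by (intro divide_left_mono mult_pos_pos prod_pos) (auto intro: add_pos_nonneg simp: prod_constant[symmetric] simp del: prod_constant intro!: prod_pos)
    qed
    also have "\<dots> = ?f x" by (simp add: prod_dividef)
    finally show "norm (jw m x) \<le> norm (?f x)" by (simp add: abs_prod)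
  qed
qed (simp add: japanese_def)

lemma japanese_measurable [measurable]: "japanese \<in> borel_measurable (borel :: 'a::euclidean_space measure)"
  unfolding japanese_def by measurable

lemma nn_integral_affine:
  fixes f :: "'a::euclidean_space \<Rightarrow> ennreal"
  assumes [measurable]: "f \<in> borel_measurable borel" and c: "c \<noteq> 0"
  shows "(\<integral>\<^sup>+x. f x \<partial>lborel) = \<bar>c\<bar> ^ DIM('a) * (\<integral>\<^sup>+x. f (t + c *\<^sub>R x) \<partial>lborel)"
  by (subst lborel_affine[OF c, of t])
     (simp add: nn_integral_density nn_integral_distr nn_integral_cmult ennreal_power)

lemma integral_affine:
  fixes f :: "'a::euclidean_space \<Rightarrow> 'b::{banach, second_countable_topology}"
  assumes [measurable]: "f \<in> borel_measurable borel" and c: "c \<noteq> 0"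
  shows "(LINT x|lborel. f x) = \<bar>c\<bar> ^ DIM('a) *\<^sub>R (LINT x|lborel. f (t + c *\<^sub>R x))"
  by (subst lborel_affine[OF c, of t])
     (simp add: integral_density integral_distr)

lemma integrable_affine:
  fixes f :: "'a::euclidean_space \<Rightarrow> 'b::{banach, second_countable_topology}"
  assumes "integrable lborel f" and c: "c \<noteq> 0"
  shows "integrable lborel (\<lambda>x. f (t + c *\<^sub>R x))"
proof -
  have [measurable]: "f \<in> borel_measurable borel" using assms by auto
  have "(\<integral>\<^sup>+x. ennreal (norm (f x)) \<partial>lborel) < \<infinity>"
    using assms by (simp add: integrable_iff_bounded)
  then show ?thesis
    using c by (subst (asm) nn_integral_affine[where c=c and t=t]) (auto simp: integrable_iff_bounded ennreal_mult_less_top)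
qed

lemma integral_shift:
  fixes f :: "'a::euclidean_space \<Rightarrow> 'b::{banach, second_countable_topology}"
  shows "f \<in> borel_measurable borel \<Longrightarrow> (LINT x|lborel. f (x + t)) = (LINT x|lborel. f x)"
    and "integrable lborel f \<Longrightarrow> integrable lborel (\<lambda>x. f (x + t))"
  using integral_affine[of f 1 t] integrable_affine[of f 1 t] by (auto simp: add.commute)

lemma nn_integral_shift:
  fixes f :: "'a::euclidean_space \<Rightarrow> ennreal"
  shows "f \<in> borel_measurable borel \<Longrightarrow> (\<integral>\<^sup>+x. f (x + t) \<partial>lborel) = (\<integral>\<^sup>+x. f x \<partial>lborel)"
  using nn_integral_affine[of f 1 t] by (auto simp: add.commute)

lemma integrable_pair_bound:
  fixes F :: "'a::euclidean_space \<times> 'b::euclidean_space \<Rightarrow> 'c::{banach, second_countable_topology}"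
  assumes [measurable]: "F \<in> borel_measurable borel"
    and a: "integrable lborel a" and b: "integrable lborel b"
    and bd: "\<And>x y. norm (F (x, y)) \<le> a x * b y"
  shows "integrable (lborel \<Otimes>\<^sub>M lborel) F"
proof (rule Bochner_Integration.integrable_bound)
  have [measurable]: "a \<in> borel_measurable borel" "b \<in> borel_measurable borel" using a b by auto
  show "integrable (lborel \<Otimes>\<^sub>M lborel) (\<lambda>z. a (fst z) * b (snd z))"
  proof (rule lborel_pair.Fubini_integrable)
    show "integrable lborel (\<lambda>x. LINT y|lborel. norm (a (fst (x, y)) * b (snd (x, y))))"
      using a by (simp add: abs_mult)
  qed (use b in \<open>auto intro!: AE_I2\<close>)
  show "AE z in lborel \<Otimes>\<^sub>M lborel. norm (F z) \<le> norm (a (fst z) * b (snd z))"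
    by (rule AE_I2) (metis abs_ge_self bd order_trans prod.collapse real_norm_def)
qed (simp add: lborel_prod)

lemma fubini_bound:
  fixes F :: "'a::euclidean_space \<Rightarrow> 'b::euclidean_space \<Rightarrow> 'c::{banach, second_countable_topology}"
  assumes "(\<lambda>z. F (fst z) (snd z)) \<in> borel_measurable (borel \<Otimes>\<^sub>M borel)"
    and "integrable lborel a" and "integrable lborel b"
    and "\<And>x y. norm (F x y) \<le> a x * b y"
  shows "(LINT x|lborel. LINT y|lborel. F x y) = (LINT y|lborel. LINT x|lborel. F x y)"
proof -
  have "integrable (lborel \<Otimes>\<^sub>M lborel) (\<lambda>z. F (fst z) (snd z))"
    by (rule integrable_pair_bound[OF assms(1)[unfolded borel_prod] assms(2,3)]) (simp add: assms(4))
  moreover have "(\<lambda>z. F (fst z) (snd z)) = case_prod F" by auto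
  ultimately show ?thesis using lborel_pair.Fubini_integral[of F] by (simp only:)
qed

section \<open>Schwartz functions\<close>

lemma Basis_vec: "(Basis :: (real^'n) set) = range (\<lambda>i. axis i 1)"
  by (auto simp: Basis_vec_def)

lemma lists_Basis_vec: "vs \<in> lists (Basis :: (real^'n) set) \<Longrightarrow> \<exists>\<alpha>. vs = map (\<lambda>i. axis i 1) \<alpha>"
proof (induction vs)
  case (Cons v vs)
  then obtain \<alpha> where "vs = map (\<lambda>i. axis i 1) \<alpha>" by auto
  moreover obtain i where "v = axis i 1" using Cons.prems by (auto simp: Basis_vec)
  ultimately have "v # vs = map (\<lambda>i. axis i 1) (i # \<alpha>)" by simp
  then show ?case by (rule exI)
qed simp

lemma moderate_imp_schwartz:
  fixes f :: "real^'n \<Rightarrow> complex"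
  assumes "\<And>m. moderate m f"
  shows "f \<in> schwartz"
proof -
  have "bounded (range (\<lambda>x. japanese x ^ k * norm (multi_deriv \<alpha> f x)))" for k :: nat and \<alpha> :: "'n list"
  proof -
    have "symb jw (\<lambda>_. 1) (- real k - length \<alpha> + sum_list (map (\<lambda>_. 1) (map (\<lambda>i. axis i 1 :: real^'n) \<alpha>)))
      (iter_deriv (map (\<lambda>i. axis i 1) \<alpha>) f)"
      by (rule symb_iter_deriv[OF assms]) (auto simp: Basis_vec)
    then have "\<exists>C. \<forall>x. norm (multi_deriv \<alpha> f x) \<le> C * jw (- real k) x"
      using symb_bound by (force simp: multi_deriv_def comp_def sum_list_triv)
    then obtain C where C: "\<And>x. norm (multi_deriv \<alpha> f x) \<le> C * jw (- real k) x" by blast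
    have "norm (japanese x ^ k * norm (multi_deriv \<alpha> f x)) \<le> C" for x
    proof -
      have "japanese x ^ k * norm (multi_deriv \<alpha> f x) \<le> japanese x ^ k * (C * jw (- real k) x)"
        by (intro mult_left_mono C) auto
      also have "\<dots> = C" by (simp add: powr_minus powr_realpow)
      finally show ?thesis by simp
    qed
    then show ?thesis unfolding bounded_iff by blast
  qed
  then show ?thesis using symb_smooth[OF assms] by (auto simp: schwartz_def)
qed

text \<open>Every derivative decays to every order, so the conclusion holds for an arbitrary shift
  \<open>s\<close> of the index, be it a loss or a gain.\<close>

lemma schwartz_imp_moderate:
  fixes f :: "real^'n \<Rightarrow> complex"
  assumes "f \<in> schwartz"
  shows "symb jw s m f"
proof -
  let ?Q = "\<lambda>f :: real^'n \<Rightarrow> complex. smooth f \<and> (\<forall>vs\<in>lists Basis. \<forall>m. \<exists>C. \<forall>x. norm (iter_deriv vs f x) \<le> C * jw m x)"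
  \<comment> \<open>The recursion of \<open>symk\<close> peels off the innermost derivative, which
    is the last entry of the list.\<close>
  have snoc: "iter_deriv vs (dir_deriv v f) = iter_deriv (vs @ [v]) f" for vs v and f :: "real^'n \<Rightarrow> complex"
    by (simp add: iter_deriv_def)
  have "symk jw s k m f" if "?Q f" for k m f
    using that
  proof (induction k arbitrary: f m)
    case 0
    then have "\<exists>C. \<forall>x. norm (iter_deriv [] f x) \<le> C * jw m x" by blast
    then show ?case by (simp add: iter_deriv_def)
  next
    case (Suc k)
    have "\<exists>C. \<forall>x. norm (iter_deriv [] f x) \<le> C * jw m x" using Suc.prems by blast
    moreover have "\<forall>z. iter_deriv [] f differentiable (at z)" using Suc.prems unfolding smooth_def by blast
    moreover have "?Q (dir_deriv v f)" if "v \<in> Basis" for v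
    proof (intro conjI ballI)
      show "smooth (dir_deriv v f)"
        unfolding smooth_def snoc
      proof (intro ballI)
        fix vs :: "(real^'n) list" assume "vs \<in> lists Basis"
        then have "vs @ [v] \<in> lists Basis" using that by auto
        then show "\<forall>z. iter_deriv (vs @ [v]) f differentiable at z"
          using Suc.prems unfolding smooth_def by blast
      qed
      fix vs :: "(real^'n) list" assume "vs \<in> lists Basis"
      then have "vs @ [v] \<in> lists Basis" using that by auto
      then show "\<forall>m. \<exists>C. \<forall>x. norm (iter_deriv vs (dir_deriv v f) x) \<le> C * jw m x"
        using Suc.prems unfolding snoc by blast
    qed
    ultimately show ?case using Suc.IH by (simp add: iter_deriv_def)
  qed
  moreover have "?Q f"
  proof (intro conjI ballI allI)
    show "smooth f" using assms by (simp add: schwartz_def)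
    fix vs :: "(real^'n) list" and m assume "vs \<in> lists Basis"
    then obtain \<alpha> where vs: "vs = map (\<lambda>i. axis i 1) \<alpha>" using lists_Basis_vec by blast
    obtain k :: nat where k: "- m \<le> real k" using real_arch_simple by blast
    have "bounded (range (\<lambda>x. japanese x ^ k * norm (multi_deriv \<alpha> f x)))" using assms by (auto simp: schwartz_def)
    then obtain C where C: "\<And>x. norm (japanese x ^ k * norm (multi_deriv \<alpha> f x)) \<le> C" unfolding bounded_iff by auto
    have "norm (iter_deriv vs f x) \<le> C * jw m x" for x
    proof -
      have "norm (iter_deriv vs f x) = (japanese x ^ k * norm (multi_deriv \<alpha> f x)) * jw (- real k) x"
        by (simp add: vs multi_deriv_def powr_minus powr_realpow)
      also have "\<dots> \<le> C * jw (- real k) x" using C[of x] by (intro mult_right_mono) auto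
      also have "\<dots> \<le> C * jw m x"
        using k order_trans[OF norm_ge_zero C[of x]] by (intro mult_left_mono powr_mono_japanese) auto
      finally show ?thesis .
    qed
    then show "\<exists>C. \<forall>x. norm (iter_deriv vs f x) \<le> C * jw m x" by blast
  qed
  ultimately show ?thesis by (auto simp: symb_def)
qed

lemma schwartz_iff: "f \<in> schwartz \<longleftrightarrow> (\<forall>m. moderate m f)"
  using moderate_imp_schwartz schwartz_imp_moderate by blast

lemma schwartz_bound:
  assumes "f \<in> schwartz" obtains C where "C > 0" "\<And>x. norm (f x) \<le> C * jw m x"
  using symb_bound[OF schwartz_imp_moderate[OF assms]] jw.bound_pos by blast

lemma schwartz_has_derivative: "f \<in> schwartz \<Longrightarrow> (f has_derivative (\<lambda>v. dir_deriv v f x)) (at x)"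
  by (rule symb_has_derivative[OF schwartz_imp_moderate])

lemma schwartz_continuous: "f \<in> schwartz \<Longrightarrow> continuous_on A f"
  by (rule symb_continuous[OF schwartz_imp_moderate])

lemma schwartz_measurable [measurable_dest]: "f \<in> schwartz \<Longrightarrow> f \<in> borel_measurable borel"
  by (intro borel_measurable_continuous_onI schwartz_continuous)

lemma schwartz_integrable_weight:
  assumes "f \<in> schwartz" shows "integrable lborel (\<lambda>x. jw m x * norm (f x))"
proof -
  obtain C where C: "C > 0" "\<And>x. norm (f x) \<le> C * jw (- 2 * real DIM(real^'a) - m) x"
    using schwartz_bound[OF assms] by blast
  have [measurable]: "f \<in> borel_measurable borel" using assms by (rule schwartz_measurable)
  show ?thesis
  proof (rule Bochner_Integration.integrable_bound)
    show "integrable lborel (\<lambda>x::real^'a. C * jw (- 2 * real DIM(real^'a)) x)"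
      by (intro integrable_mult_right integrable_japanese) simp
    show "AE x in lborel. norm (jw m x * norm (f x)) \<le> norm (C * jw (- 2 * real DIM(real^'a)) x)"
    proof (rule AE_I2)
      fix x :: "real^'a"
      have "jw m x * norm (f x) \<le> jw m x * (C * jw (- 2 * real DIM(real^'a) - m) x)"
        by (intro mult_left_mono C) auto
      also have "\<dots> = C * jw (- 2 * real DIM(real^'a)) x" by (simp add: mult_ac flip: powr_add)
      finally show "norm (jw m x * norm (f x)) \<le> norm (C * jw (- 2 * real DIM(real^'a)) x)" using C by simp
    qed
  qed measurable
qed

lemma schwartz_integrable_norm: "f \<in> schwartz \<Longrightarrow> integrable lborel (\<lambda>x. norm (f x))"
  using schwartz_integrable_weight[of f 0] by (simp cong: if_cong)

lemma schwartz_integrable: "f \<in> schwartz \<Longrightarrow> integrable lborel f"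
  using integrable_norm_iff[of f lborel] schwartz_integrable_norm[of f] schwartz_measurable[of f] by simp

lemma schwartz_moderate_mult:
  assumes "moderate m h" "f \<in> schwartz" shows "(\<lambda>x. h x * f x) \<in> schwartz"
proof (rule moderate_imp_schwartz)
  fix m'
  have "moderate (m + (m' - m)) (\<lambda>x. h x * f x)"
    by (rule jw.symb_mult[OF assms(1) schwartz_imp_moderate[OF assms(2)]])
  then show "moderate m' (\<lambda>x. h x * f x)" by simp
qed

lemma schwartz_mult: "f \<in> schwartz \<Longrightarrow> g \<in> schwartz \<Longrightarrow> (\<lambda>x. f x * g x) \<in> schwartz"
  by (rule schwartz_moderate_mult[OF schwartz_imp_moderate[of _ _ 0]])

lemma schwartz_cmult: "f \<in> schwartz \<Longrightarrow> (\<lambda>x. c * f x) \<in> schwartz"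
  by (simp add: schwartz_iff jw.symb_cmult)

lemma schwartz_cnj: "f \<in> schwartz \<Longrightarrow> (\<lambda>x. cnj (f x)) \<in> schwartz"
  by (simp add: schwartz_iff jw.symb_cnj)

lemma schwartz_dir_deriv: "f \<in> schwartz \<Longrightarrow> v \<in> Basis \<Longrightarrow> dir_deriv v f \<in> schwartz"
  using symb_dir_deriv[of jw "\<lambda>_. 1" "_ - 1" f v] by (auto simp: schwartz_iff)

lemma schwartz_coord_mult: "f \<in> schwartz \<Longrightarrow> (\<lambda>t. of_real (v \<bullet> t) * f t) \<in> schwartz"
  by (rule schwartz_moderate_mult[where m=1])
     (auto intro!: symbI jw.symk_of_real symk_bounded_linear bounded_linear_inner_right)

text \<open>Scaling by 1 or -1 leaves the bracket unchanged, and Peetre's inequality moves the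
  weight past the translation. Translations and the reflection are the two instances that
  matter.\<close>

lemma schwartz_affine:
  fixes f :: "real^'n \<Rightarrow> complex"
  assumes "f \<in> schwartz" "\<bar>c\<bar> = 1"
  shows "(\<lambda>t. f (a + c *\<^sub>R t)) \<in> schwartz"
proof (rule moderate_imp_schwartz, rule symbI)
  fix m k
  show "symk jw (\<lambda>_. 1) k m (\<lambda>t. f (a + c *\<^sub>R t))" using assms(1)
  proof (induction k arbitrary: f m)
    have bd: "\<exists>C. \<forall>t. norm (f (a + c *\<^sub>R t)) \<le> C * jw m t" if f: "f \<in> schwartz" for f :: "real^'n \<Rightarrow> complex" and m
    proof -
      obtain C where C: "C > 0" "\<And>x. norm (f x) \<le> C * jw m x" using schwartz_bound[OF f] by blast
      have "norm (f (a + c *\<^sub>R t)) \<le> (C * (2 powr \<bar>m\<bar> * jw \<bar>m\<bar> a)) * jw m t" for t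
      proof -
        have "japanese (c *\<^sub>R t) = japanese t" using assms(2) by (simp add: japanese_def)
        then have "jw m (a + c *\<^sub>R t) \<le> 2 powr \<bar>m\<bar> * jw m t * jw \<bar>m\<bar> a"
          using japanese_powr_ge[of "c *\<^sub>R t" a m] by (simp add: add.commute)
        then have "C * jw m (a + c *\<^sub>R t) \<le> C * (2 powr \<bar>m\<bar> * jw m t * jw \<bar>m\<bar> a)"
          using C by (intro mult_left_mono) auto
        with C(2)[of "a + c *\<^sub>R t"] show ?thesis by (simp add: mult_ac)
      qed
      then show ?thesis by blast
    qed
    {
      case 0
      then show ?case using bd by simp
    next
      case (Suc k)
      show ?case
      proof (rule symk_SucI[where D="\<lambda>t v. c *\<^sub>R dir_deriv v f (a + c *\<^sub>R t)"])
        show "\<exists>C. \<forall>t. norm (f (a + c *\<^sub>R t)) \<le> C * jw m t" using bd Suc.prems by blast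
        fix z
        have "((\<lambda>t. f (a + c *\<^sub>R t)) has_derivative (\<lambda>v. dir_deriv (c *\<^sub>R v) f (a + c *\<^sub>R z))) (at z)"
          by (rule has_derivative_compose[OF _ schwartz_has_derivative[OF Suc.prems]])
             (auto intro!: derivative_eq_intros)
        moreover have "dir_deriv (c *\<^sub>R v) f x = c *\<^sub>R dir_deriv v f x" for x v
          using has_derivative_linear[OF schwartz_has_derivative[OF Suc.prems]] by (rule linear_cmul)
        ultimately show "((\<lambda>t. f (a + c *\<^sub>R t)) has_derivative (\<lambda>v. c *\<^sub>R dir_deriv v f (a + c *\<^sub>R z))) (at z)"
          by simp
      next
        fix v :: "real^'n" assume "v \<in> Basis"
        then show "symk jw (\<lambda>_. 1) k (m + 1) (\<lambda>t. c *\<^sub>R dir_deriv v f (a + c *\<^sub>R t))"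
          by (intro jw.symk_scale Suc.IH schwartz_dir_deriv Suc.prems)
      qed
    }
  qed
qed

lemma schwartz_shift: "f \<in> schwartz \<Longrightarrow> (\<lambda>t. f (t - a)) \<in> schwartz"
  and schwartz_reflect: "f \<in> schwartz \<Longrightarrow> (\<lambda>t. f (- t)) \<in> schwartz"
  using schwartz_affine[of f 1 "- a"] schwartz_affine[of f "- 1" 0] by (simp_all add: add.commute)

lemma moderate_cis: "moderate 0 (\<lambda>t. cis (a \<bullet> t))"
proof (rule symbI)
  fix k
  have "symk jw (\<lambda>_. 1) k 0 (\<lambda>t. exp (\<i> * of_real (a \<bullet> t)))"
  proof (rule symk_exp[where D="\<lambda>z v. \<i> * of_real (a \<bullet> v)"])
    show "\<exists>C. \<forall>z. norm (exp (\<i> * of_real (a \<bullet> z))) \<le> C * jw 0 z" by (auto intro: exI[of _ 1])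
    show "((\<lambda>t. \<i> * of_real (a \<bullet> t)) has_derivative (\<lambda>v. \<i> * complex_of_real (a \<bullet> v))) (at z)" for z
      by (auto intro!: derivative_eq_intros)
    show "symk jw (\<lambda>_. 1) k 1 (\<lambda>z. \<i> * complex_of_real (a \<bullet> v))" for v :: 'a and k
      by (rule symk_const) simp
  qed
  then show "symk jw (\<lambda>_. 1) k 0 (\<lambda>t. cis (a \<bullet> t))" by (simp add: cis_conv_exp)
qed

lemma schwartz_modulate:
  assumes "f \<in> schwartz" shows "(\<lambda>t. cis (c * (a \<bullet> t)) * f t) \<in> schwartz"
  using schwartz_moderate_mult[OF moderate_cis[of "c *\<^sub>R a"] assms] by simp

text \<open>With this normalisation \<open>cgauss 1\<close> is its own Fourier transform. The
  imaginary part of the parameter is the rate of a quadratic phase, so chirps are included.\<close>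

definition cgauss :: "complex \<Rightarrow> 'a::euclidean_space \<Rightarrow> complex" where
  "cgauss a x = exp (- (of_real pi * a * of_real (x \<bullet> x)))"

lemma exp_neg_bound:
  fixes r m :: real
  assumes "r > 0"
  shows "\<exists>C. \<forall>x::'a::euclidean_space. exp (- r * (x \<bullet> x)) \<le> C * jw m x"
proof -
  obtain N :: nat where N: "- m / 2 \<le> real N" "N > 0"
  proof -
    obtain n :: nat where "- m / 2 \<le> real n" using real_arch_simple by blast
    then show thesis using that[of "Suc n"] by simp
  qed
  \<comment> \<open>With this constant 1 + u \<le> c (1 + r u / N), and the N-th power of the
    bracket on the right is at most exp (r u).\<close>
  define c where "c = max 1 (real N / r)"
  have c: "c \<ge> 1" "c * r \<ge> real N" using assms by (auto simp: c_def field_simps max_def)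
  have "exp (- r * (x \<bullet> x)) \<le> c ^ N * jw m x" for x :: 'a
  proof -
    define u where "u = x \<bullet> x"
    have u: "u \<ge> 0" by (simp add: u_def)
    have "1 + u \<le> c * (1 + r * u / N)"
    proof -
      have "u * real N \<le> u * (c * r)" using u c by (intro mult_left_mono) auto
      then have "u \<le> c * (r * u / N)" using N by (simp add: field_simps)
      with c show ?thesis by (simp add: algebra_simps)
    qed
    then have "(1 + u) ^ N \<le> (c * (1 + r * u / N)) ^ N" using u by (intro power_mono) auto
    also have "\<dots> = c ^ N * (1 + r * u / N) ^ N" by (simp add: power_mult_distrib)
    also have "\<dots> \<le> c ^ N * exp (r * u)"
    proof (rule mult_left_mono)
      have "- real N \<le> r * u" using mult_nonneg_nonneg[of r u] u assms by linarith
      then show "(1 + r * u / N) ^ N \<le> exp (r * u)"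
        using exp_ge_one_plus_x_over_n_power_n[of N "r * u"] N by simp
    qed (use c in auto)
    finally have "(1 + u) ^ N * exp (- (r * u)) \<le> c ^ N * exp (r * u) * exp (- (r * u))"
      by (rule mult_right_mono) simp
    then have "exp (- (r * u)) * (1 + u) ^ N \<le> c ^ N"
      by (simp add: mult.assoc exp_minus_inverse mult.commute[of "exp (- (r * u))"])
    then have "exp (- (r * u)) \<le> c ^ N * (1 / (1 + u) ^ N)"
      using u by (simp add: pos_le_divide_eq)
    also have "\<dots> = c ^ N * (1 + u) powr (- real N)"
      using u by (simp add: powr_minus powr_realpow inverse_eq_divide)
    also have "\<dots> \<le> c ^ N * (1 + u) powr (m / 2)"
      using u c N by (intro mult_left_mono powr_mono) auto
    finally show ?thesis by (simp add: u_def japanese_powr_eq)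
  qed
  then show ?thesis by blast
qed

lemma norm_cgauss: "norm (cgauss a x) = exp (- (pi * Re a) * (x \<bullet> x))"
  by (simp add: cgauss_def)

lemma cgauss_has_derivative:
  "(cgauss a has_derivative (\<lambda>v. (- (2 * of_real pi * a) * of_real (x \<bullet> v)) * cgauss a x)) (at x)"
proof -
  have "((\<lambda>x. - (of_real pi * a * complex_of_real (x \<bullet> x))) has_derivative (\<lambda>v. - (2 * of_real pi * a) * of_real (x \<bullet> v))) (at x)"
    by (auto intro!: derivative_eq_intros simp: inner_commute)
  from has_derivative_compose[OF this DERIV_exp[unfolded has_field_derivative_def]]
  show ?thesis by (simp add: cgauss_def[abs_def] mult.commute)
qed

lemma cgauss_schwartz:
  assumes "Re a > 0" shows "(cgauss a :: real^'n \<Rightarrow> complex) \<in> schwartz"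
proof (rule moderate_imp_schwartz, rule symbI)
  fix m k
  show "symk jw (\<lambda>_. 1) k m (cgauss a :: real^'n \<Rightarrow> complex)"
    unfolding cgauss_def[abs_def]
  proof (rule symk_exp[where D="\<lambda>z v. - (2 * of_real pi * a) * of_real (z \<bullet> v)"])
    show "\<exists>C. \<forall>z::real^'n. norm (exp (- (of_real pi * a * of_real (z \<bullet> z)))) \<le> C * jw m z"
      using exp_neg_bound[of "pi * Re a" m, where 'a="real^'n"] assms by simp
    show "((\<lambda>x. - (of_real pi * a * complex_of_real (x \<bullet> x))) has_derivative (\<lambda>v. - (2 * of_real pi * a) * of_real (x \<bullet> v))) (at x)" for x :: "real^'n"
      by (auto intro!: derivative_eq_intros simp: inner_commute)
    show "symk jw (\<lambda>_. 1) k 1 (\<lambda>z::real^'n. - (2 * of_real pi * a) * complex_of_real (z \<bullet> v))" for v k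
      by (intro jw.symk_cmult jw.symk_of_real symk_bounded_linear bounded_linear_inner_left) simp
  qed
qed


section \<open>The Fourier transform\<close>

text \<open>Translation invariance makes the integral of every difference quotient vanish, and
  dominated convergence carries this over to the derivative.\<close>

lemma schwartz_integral_dir_deriv:
  fixes f :: "real^'n \<Rightarrow> complex"
  assumes f: "f \<in> schwartz" and v: "v \<in> Basis"
  shows "(LINT t|lborel. dir_deriv v f t) = 0"
proof -
  let ?d = "dir_deriv v f"
  have d: "?d \<in> schwartz" using f v by (rule schwartz_dir_deriv)
  let ?m = "- 2 * real DIM(real^'n)"
  have [measurable]: "f \<in> borel_measurable borel" "?d \<in> borel_measurable borel"
    using f d by (auto intro: schwartz_measurable)
  obtain C where C: "C > 0" "\<And>x. norm (?d x) \<le> C * jw ?m x" using schwartz_bound[OF d] by blast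
  \<comment> \<open>Peetre's inequality bounds the derivative on the whole segment from t to t + v
    by one multiple of an integrable weight at t. This is the majorant for the difference
    quotients.\<close>
  define K where "K = C * (2 powr \<bar>?m\<bar> * jw \<bar>?m\<bar> v)"
  have K: "norm (?d (t + s *\<^sub>R v)) \<le> K * jw ?m t" if "s \<in> {0..1}" for s t
  proof -
    have "japanese (s *\<^sub>R v) \<le> japanese v"
      using that unfolding japanese_def
      by (auto intro!: power_mono mult_left_le_one_le)
    then have "jw \<bar>?m\<bar> (s *\<^sub>R v) \<le> jw \<bar>?m\<bar> v" by (intro powr_mono2) auto
    then have "2 powr \<bar>?m\<bar> * jw ?m t * jw \<bar>?m\<bar> (s *\<^sub>R v) \<le> 2 powr \<bar>?m\<bar> * jw ?m t * jw \<bar>?m\<bar> v"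
      by (intro mult_left_mono) auto
    then have "jw ?m (t + s *\<^sub>R v) \<le> 2 powr \<bar>?m\<bar> * jw ?m t * jw \<bar>?m\<bar> v"
      using japanese_powr_ge[of t "s *\<^sub>R v" ?m] by linarith
    then have "C * jw ?m (t + s *\<^sub>R v) \<le> C * (2 powr \<bar>?m\<bar> * jw ?m t * jw \<bar>?m\<bar> v)"
      using C by (intro mult_left_mono) auto
    with C(2)[of "t + s *\<^sub>R v"] show ?thesis unfolding K_def by (simp only: mult_ac)
  qed
  define q where "q n t = real (Suc n) *\<^sub>R (f (t + inverse (real (Suc n)) *\<^sub>R v) - f t)" for n t
  have line: "((\<lambda>s. f (t + s *\<^sub>R v)) has_vector_derivative ?d (t + s *\<^sub>R v)) (at s within S)" for t s S
  proof -
    have "((\<lambda>s. f (t + s *\<^sub>R v)) has_derivative (\<lambda>r. dir_deriv (r *\<^sub>R v) f (t + s *\<^sub>R v))) (at s within S)"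
      by (rule has_derivative_compose[OF _ schwartz_has_derivative[OF f]])
         (auto intro!: derivative_eq_intros)
    moreover have "dir_deriv (r *\<^sub>R v) f x = r *\<^sub>R dir_deriv v f x" for r x
      by (rule linear_cmul[OF has_derivative_linear[OF schwartz_has_derivative[OF f]]])
    ultimately show ?thesis by (simp add: has_vector_derivative_def)
  qed
  have q_bound: "norm (q n t) \<le> K * jw ?m t" for n t
  proof -
    let ?h = "inverse (real (Suc n))"
    have h: "0 \<le> ?h" "?h \<le> 1" "?h > 0" by (auto simp: inverse_le_1_iff)
    have "norm (f (t + ?h *\<^sub>R v) - f (t + 0 *\<^sub>R v)) \<le> (K * jw ?m t) * norm (?h - 0)"
    proof (rule differentiable_bound)
      show "convex {0..?h}" by simp
      fix s assume s: "s \<in> {0..?h}"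
      show "((\<lambda>s. f (t + s *\<^sub>R v)) has_derivative (\<lambda>r. r *\<^sub>R ?d (t + s *\<^sub>R v))) (at s within {0..?h})"
        using line by (simp add: has_vector_derivative_def)
      show "onorm (\<lambda>r. r *\<^sub>R ?d (t + s *\<^sub>R v)) \<le> K * jw ?m t"
      proof (rule onorm_le)
        fix r :: real
        have "norm (?d (t + s *\<^sub>R v)) \<le> K * jw ?m t" using K s h by auto
        then show "norm (r *\<^sub>R ?d (t + s *\<^sub>R v)) \<le> K * jw ?m t * norm r"
          by (simp add: mult.commute mult_left_mono)
      qed
    qed (use h in auto)
    then have "real (Suc n) * norm (f (t + ?h *\<^sub>R v) - f t) \<le> real (Suc n) * ((K * jw ?m t) * ?h)"
      using h by (intro mult_left_mono) auto
    moreover have "norm (q n t) = real (Suc n) * norm (f (t + ?h *\<^sub>R v) - f t)"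
      by (simp only: q_def norm_scaleR abs_of_nat)
    moreover have "real (Suc n) * ((K * jw ?m t) * ?h) = K * jw ?m t" by simp
    ultimately show ?thesis by (simp only:)
  qed
  have "(\<lambda>n. LINT t|lborel. q n t) \<longlonglongrightarrow> (LINT t|lborel. ?d t)"
  proof (rule integral_dominated_convergence)
    show "integrable lborel (\<lambda>t::real^'n. K * jw ?m t)" by (intro integrable_mult_right integrable_japanese) simp
    show "AE t in lborel. (\<lambda>n. q n t) \<longlonglongrightarrow> ?d t"
    proof (rule AE_I2)
      fix t
      have "((\<lambda>s. f (t + s *\<^sub>R v)) has_vector_derivative ?d t) (at 0)" using line[of t 0] by simp
      then have A: "((\<lambda>h. norm (f (t + h *\<^sub>R v) - f t - h *\<^sub>R ?d t) / norm h) \<longlongrightarrow> 0) (at 0)"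
        using has_derivative_at[of "\<lambda>s. f (t + s *\<^sub>R v)" "\<lambda>h. h *\<^sub>R ?d t" 0] by (simp add: has_vector_derivative_def)
      have "((\<lambda>h. (f (t + h *\<^sub>R v) - f t) /\<^sub>R h - ?d t) \<longlongrightarrow> 0) (at 0)"
      proof (rule tendsto_norm_zero_cancel, rule Lim_transform_eventually[OF A])
        have "norm (X - h *\<^sub>R D) / norm h = norm (X /\<^sub>R h - D)" if "h \<noteq> 0" for h :: real and X D :: complex
        proof -
          have "X /\<^sub>R h - D = (X - h *\<^sub>R D) /\<^sub>R h" using that by (simp add: scaleR_diff_right)
          then show ?thesis by (simp add: divide_inverse mult.commute)
        qed
        then show "\<forall>\<^sub>F h in at 0. norm (f (t + h *\<^sub>R v) - f t - h *\<^sub>R ?d t) / norm h = norm ((f (t + h *\<^sub>R v) - f t) /\<^sub>R h - ?d t)"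
          by (auto simp: eventually_at_filter)
      qed
      then have "((\<lambda>h. (f (t + h *\<^sub>R v) - f t) /\<^sub>R h) \<longlongrightarrow> ?d t) (at 0)"
        by (rule LIM_zero_cancel)
      then have "(\<lambda>n. (f (t + inverse (real (Suc n)) *\<^sub>R v) - f t) /\<^sub>R inverse (real (Suc n))) \<longlonglongrightarrow> ?d t"
      proof (rule filterlim_compose)
        show "filterlim (\<lambda>n. inverse (real (Suc n))) (at 0) sequentially"
          using LIMSEQ_inverse_real_of_nat by (simp add: filterlim_at)
      qed
      then show "(\<lambda>n. q n t) \<longlonglongrightarrow> ?d t" by (simp add: q_def)
    qed
  qed (use q_bound in \<open>auto simp: q_def\<close>)
  moreover have "(LINT t|lborel. q n t) = 0" for n
    unfolding q_def using integral_shift[of f "inverse (real (Suc n)) *\<^sub>R v"] schwartz_integrable[OF f]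
    by (simp add: Bochner_Integration.integral_diff)
  ultimately show ?thesis by (simp add: LIMSEQ_const_iff)
qed

lemma fourier_kernel_integrable:
  fixes f :: "real^'n \<Rightarrow> complex"
  assumes "integrable lborel f"
  shows "integrable lborel (\<lambda>t. f t * cis (c * (t \<bullet> \<xi>)))"
proof (rule Bochner_Integration.integrable_bound[OF assms])
  have [measurable]: "f \<in> borel_measurable borel" using assms by auto
  show "(\<lambda>t. f t * cis (c * (t \<bullet> \<xi>))) \<in> borel_measurable lborel"
    unfolding cis_conv_exp by measurable
qed (simp add: norm_mult)

lemma cis_measurable [measurable]: "cis \<in> borel_measurable borel"
  unfolding cis_conv_exp[abs_def] by measurable

lemma cnj_measurable [measurable]: "cnj \<in> borel_measurable borel"
  by (intro borel_measurable_continuous_onI continuous_intros)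

lemma norm_fourier_le: "norm (fourier f \<xi>) \<le> (LINT t|lborel. norm (f t))"
  unfolding fourier_def using integral_norm_bound[of lborel "\<lambda>t. f t * cis (- 2 * pi * (t \<bullet> \<xi>))"]
  by (simp add: norm_mult)

lemma fourier_cmult: "fourier (\<lambda>t. c * f t) \<xi> = c * fourier f \<xi>"
  unfolding fourier_def by (simp add: mult.assoc)

text \<open>Differentiation under the integral for the total derivative at once: since |exp (i x) -
  1 - i x| \<le> x^2, the remainder is quadratic in the increment with the second moment of |f| as a
  factor.\<close>

lemma fourier_has_derivative:
  fixes f :: "real^'n \<Rightarrow> complex"
  assumes f: "f \<in> schwartz"
  shows "(fourier f has_derivative (\<lambda>v. fourier (\<lambda>t. - (2 * pi * \<i>) * (of_real (v \<bullet> t) * f t)) \<xi>)) (at \<xi>)"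
proof -
  let ?e = "\<lambda>t. cis (- 2 * pi * (t \<bullet> \<xi>))"
  let ?D = "\<lambda>v. fourier (\<lambda>t. - (2 * pi * \<i>) * (of_real (v \<bullet> t) * f t)) \<xi>"
  have int: "integrable lborel (\<lambda>t. (- (2 * pi * \<i>) * (of_real (v \<bullet> t) * f t)) * ?e t)" for v
    by (intro fourier_kernel_integrable schwartz_integrable schwartz_cmult schwartz_coord_mult f)
  have int0: "integrable lborel (\<lambda>t. f t * cis (- 2 * pi * (t \<bullet> \<zeta>)))" for \<zeta>
    by (intro fourier_kernel_integrable schwartz_integrable f)
  define K where "K = (LINT t|lborel. jw 2 t * norm (f t))"
  have bl: "bounded_linear ?D"
  proof (rule bounded_linear_intro)
    show "?D (x + y) = ?D x + ?D y" for x y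
      unfolding fourier_def using int[of x] int[of y]
      by (simp add: inner_add_left algebra_simps flip: Bochner_Integration.integral_add)
    show "?D (r *\<^sub>R x) = r *\<^sub>R ?D x" for r x
    proof -
      have "?D (r *\<^sub>R x) = fourier (\<lambda>t. of_real r * (- (2 * pi * \<i>) * (of_real (x \<bullet> t) * f t))) \<xi>"
        by (rule arg_cong[where f="\<lambda>h. fourier h \<xi>"]) (auto simp: mult_ac)
      then show ?thesis unfolding fourier_cmult scaleR_conv_of_real .
    qed
    fix v
    have "norm (?D v) \<le> (LINT t|lborel. norm (- (2 * pi * \<i>) * (of_real (v \<bullet> t) * f t)))" by (rule norm_fourier_le)
    also have "\<dots> \<le> (LINT t|lborel. (2 * pi * norm v) * (jw 1 t * norm (f t)))"
    proof (rule integral_mono)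
      show "integrable lborel (\<lambda>t. norm (- (2 * pi * \<i>) * (of_real (v \<bullet> t) * f t)))"
        by (intro schwartz_integrable_norm schwartz_cmult schwartz_coord_mult f)
      show "integrable lborel (\<lambda>t. (2 * pi * norm v) * (jw 1 t * norm (f t)))"
        by (intro integrable_mult_right schwartz_integrable_weight f)
      fix t :: "real^'n"
      have "\<bar>v \<bullet> t\<bar> \<le> norm v * jw 1 t"
        using Cauchy_Schwarz_ineq2[of v t] mult_left_mono[OF norm_le_japanese[of t], of "norm v"] by simp
      then have "\<bar>v \<bullet> t\<bar> * norm (f t) \<le> (norm v * jw 1 t) * norm (f t)" by (rule mult_right_mono) simp
      then show "norm (- (2 * pi * \<i>) * (of_real (v \<bullet> t) * f t)) \<le> (2 * pi * norm v) * (jw 1 t * norm (f t))"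
        by (simp add: norm_mult mult.assoc)
    qed
    finally show "norm (?D v) \<le> norm v * (2 * pi * (LINT t|lborel. jw 1 t * norm (f t)))"
      by (simp only: integral_mult_right_zero mult_ac)
  qed
  show ?thesis
  proof (rule has_derivativeI_sandwich[OF zero_less_one bl])
    fix y assume "y \<noteq> \<xi>"
    define h where "h = y - \<xi>"
    have h: "h \<noteq> 0" "y = \<xi> + h" using \<open>y \<noteq> \<xi>\<close> by (auto simp: h_def)
    have eq: "fourier f y - fourier f \<xi> - ?D h
      = (LINT t|lborel. f t * ?e t * (cis (- 2 * pi * (t \<bullet> h)) - 1 - \<i> * of_real (- 2 * pi * (t \<bullet> h))))"
    proof -
      have "fourier f y - fourier f \<xi> - ?D h = (LINT t|lborel. f t * cis (- 2 * pi * (t \<bullet> y)) - f t * ?e t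
        - (- (2 * pi * \<i>) * (of_real (h \<bullet> t) * f t)) * ?e t)"
        unfolding fourier_def using int0 int by (simp add: Bochner_Integration.integral_diff)
      also have "\<dots> = (LINT t|lborel. f t * ?e t * (cis (- 2 * pi * (t \<bullet> h)) - 1 - \<i> * of_real (- 2 * pi * (t \<bullet> h))))"
      proof (rule Bochner_Integration.integral_cong[OF refl])
        fix t
        have "cis (- 2 * pi * (t \<bullet> y)) = ?e t * cis (- 2 * pi * (t \<bullet> h))"
          unfolding h cis_mult by (simp add: inner_add_right algebra_simps)
        then show "f t * cis (- 2 * pi * (t \<bullet> y)) - f t * ?e t - (- (2 * pi * \<i>) * (of_real (h \<bullet> t) * f t)) * ?e t
          = f t * ?e t * (cis (- 2 * pi * (t \<bullet> h)) - 1 - \<i> * of_real (- 2 * pi * (t \<bullet> h)))"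
          by (simp only:) (simp add: inner_commute[of h] algebra_simps)
      qed
      finally show ?thesis .
    qed
    have "norm (fourier f y - fourier f \<xi> - ?D h) \<le> (LINT t|lborel. norm (f t * ?e t * (cis (- 2 * pi * (t \<bullet> h)) - 1 - \<i> * of_real (- 2 * pi * (t \<bullet> h)))))"
      unfolding eq by (rule integral_norm_bound)
    also have "\<dots> \<le> (LINT t|lborel. (4 * pi\<^sup>2 * (norm h)\<^sup>2) * (jw 2 t * norm (f t)))"
    proof (rule integral_mono')
      show "integrable lborel (\<lambda>t. (4 * pi\<^sup>2 * (norm h)\<^sup>2) * (jw 2 t * norm (f t)))"
        by (intro integrable_mult_right schwartz_integrable_weight f)
      fix t :: "real^'n"
      let ?x = "- 2 * pi * (t \<bullet> h)"
      have "norm (cis ?x - 1 - \<i> * of_real ?x) \<le> ?x\<^sup>2"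
      proof -
        have "norm (iexp ?x - (\<Sum>k\<le>1. (\<i> * ?x) ^ k / fact k)) \<le> \<bar>?x\<bar> ^ Suc 1 / fact (Suc 1)"
          by (rule iexp_approx1)
        moreover have "iexp ?x - (\<Sum>k\<le>1. (\<i> * ?x) ^ k / fact k) = cis ?x - 1 - \<i> * of_real ?x"
          by (simp add: cis_conv_exp)
        moreover have "\<bar>?x\<bar> ^ Suc 1 / fact (Suc 1) = ?x\<^sup>2 / 2" by (simp add: power2_eq_square)
        ultimately have "norm (cis ?x - 1 - \<i> * of_real ?x) \<le> ?x\<^sup>2 / 2" by (simp only:)
        then show ?thesis using zero_le_power2[of ?x] by linarith
      qed
      also have "\<dots> \<le> 4 * pi\<^sup>2 * (norm h)\<^sup>2 * jw 2 t"
      proof -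
        have "(t \<bullet> h)\<^sup>2 \<le> (norm t * norm h)\<^sup>2"
          using Cauchy_Schwarz_ineq2[of t h] by (metis abs_ge_zero power2_abs power_mono)
        also have "\<dots> \<le> (japanese t * norm h)\<^sup>2"
          by (intro power_mono mult_right_mono norm_le_japanese) auto
        finally show ?thesis by (simp add: power_mult_distrib mult_ac)
      qed
      finally have "norm (f t) * norm (cis ?x - 1 - \<i> * of_real ?x) \<le> norm (f t) * (4 * pi\<^sup>2 * (norm h)\<^sup>2 * jw 2 t)"
        by (rule mult_left_mono) simp
      then show "norm (f t * ?e t * (cis ?x - 1 - \<i> * of_real ?x)) \<le> (4 * pi\<^sup>2 * (norm h)\<^sup>2) * (jw 2 t * norm (f t))"
        by (simp add: norm_mult mult_ac)
    qed auto
    finally have "norm (fourier f y - fourier f \<xi> - ?D h) \<le> 4 * pi\<^sup>2 * (norm h)\<^sup>2 * K"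
      by (simp add: K_def)
    then show "norm (fourier f y - fourier f \<xi> - ?D (y - \<xi>)) / norm (y - \<xi>) \<le> 4 * pi\<^sup>2 * K * norm (y - \<xi>)"
      using h by (simp add: h_def[symmetric] divide_le_eq power2_eq_square mult_ac)
  next
    show "((\<lambda>y. 4 * pi\<^sup>2 * K * norm (y - \<xi>)) \<longlongrightarrow> 0) (at \<xi>)"
      by (auto intro!: tendsto_eq_intros)
  qed
qed

text \<open>Integration by parts: the derivative of f times the exponential has integral
  zero.\<close>

lemma fourier_dir_deriv:
  fixes f :: "real^'n \<Rightarrow> complex"
  assumes f: "f \<in> schwartz" and v: "v \<in> Basis"
  shows "fourier (dir_deriv v f) \<xi> = 2 * pi * \<i> * of_real (v \<bullet> \<xi>) * fourier f \<xi>"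
proof -
  let ?e = "\<lambda>t. cis (- 2 * pi * (t \<bullet> \<xi>))"
  have k: "(\<lambda>t. f t * ?e t) \<in> schwartz"
    using schwartz_modulate[OF f, of "- 2 * pi" \<xi>] by (simp add: inner_commute mult.commute)
  have e: "(?e has_derivative (\<lambda>v. - (2 * pi * \<i> * of_real (v \<bullet> \<xi>)) * ?e t)) (at t)" for t
  proof -
    have "((\<lambda>t. \<i> * complex_of_real (- 2 * pi * (t \<bullet> \<xi>))) has_derivative (\<lambda>v. \<i> * complex_of_real (- 2 * pi * (v \<bullet> \<xi>)))) (at t)"
      by (auto intro!: derivative_eq_intros)
    from has_derivative_compose[OF this DERIV_exp[unfolded has_field_derivative_def]]
    show ?thesis by (simp add: cis_conv_exp mult_ac)
  qed
  have "dir_deriv v (\<lambda>t. f t * ?e t) t = f t * (- (2 * pi * \<i> * of_real (v \<bullet> \<xi>)) * ?e t) + dir_deriv v f t * ?e t" for t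
    by (rule dir_deriv_eqI[OF has_derivative_mult[OF schwartz_has_derivative[OF f] e]])
  then have "0 = (LINT t|lborel. - (2 * pi * \<i> * of_real (v \<bullet> \<xi>)) * (f t * ?e t) + dir_deriv v f t * ?e t)"
    using schwartz_integral_dir_deriv[OF k v] by (simp add: mult_ac)
  also have "\<dots> = - (2 * pi * \<i> * of_real (v \<bullet> \<xi>)) * fourier f \<xi> + fourier (dir_deriv v f) \<xi>"
    unfolding fourier_def integral_mult_right_zero[symmetric]
    by (intro Bochner_Integration.integral_add integrable_mult_right fourier_kernel_integrable schwartz_integrable f schwartz_dir_deriv v)
  finally show ?thesis by (simp add: algebra_simps)
qed

text \<open>The bracket is at most one plus the sum of the absolute coordinates, and each coordinate
  factor is exchanged for a derivative of \<open>f\<close>. One power of decay is gained per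
  induction step, with \<open>f\<close> varying.\<close>

lemma fourier_decay:
  fixes f :: "real^'n \<Rightarrow> complex"
  shows "f \<in> schwartz \<Longrightarrow> \<exists>C. \<forall>\<xi>. japanese \<xi> ^ N * norm (fourier f \<xi>) \<le> C"
proof (induction N arbitrary: f)
  case 0
  then show ?case using norm_fourier_le by auto
next
  case (Suc N)
  obtain C where C: "\<And>\<xi>. japanese \<xi> ^ N * norm (fourier f \<xi>) \<le> C" using Suc by blast
  have "\<forall>v\<in>Basis. \<exists>C. \<forall>\<xi>. japanese \<xi> ^ N * norm (fourier (dir_deriv v f) \<xi>) \<le> C"
    using Suc schwartz_dir_deriv by blast
  then obtain D where D: "\<And>v \<xi>. v \<in> Basis \<Longrightarrow> japanese \<xi> ^ N * norm (fourier (dir_deriv v f) \<xi>) \<le> D v" by metis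
  have "japanese \<xi> ^ Suc N * norm (fourier f \<xi>) \<le> C + (\<Sum>v\<in>Basis. D v)" for \<xi> :: "real^'n"
  proof -
    have "japanese \<xi> \<le> 1 + (\<Sum>v\<in>Basis. \<bar>\<xi> \<bullet> v\<bar>)"
      using japanese_le[of \<xi>] norm_le_l1[of \<xi>] by linarith
    then have "japanese \<xi> ^ Suc N * norm (fourier f \<xi>) \<le> (1 + (\<Sum>v\<in>Basis. \<bar>\<xi> \<bullet> v\<bar>)) * (japanese \<xi> ^ N * norm (fourier f \<xi>))"
      unfolding power_Suc mult.assoc by (rule mult_right_mono) simp
    also have "\<dots> = japanese \<xi> ^ N * norm (fourier f \<xi>) + (\<Sum>v\<in>Basis. \<bar>\<xi> \<bullet> v\<bar> * (japanese \<xi> ^ N * norm (fourier f \<xi>)))"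
      by (simp only: distrib_right sum_distrib_right mult_1)
    also have "\<dots> \<le> C + (\<Sum>v\<in>Basis. D v)"
    proof (intro add_mono C sum_mono)
      fix v :: "real^'n" assume v: "v \<in> Basis"
      have "\<bar>\<xi> \<bullet> v\<bar> * norm (fourier f \<xi>) \<le> 2 * pi * (\<bar>\<xi> \<bullet> v\<bar> * norm (fourier f \<xi>))"
        using pi_gt3 by (intro mult_le_cancel_right1[THEN iffD2]) (auto simp: mult_less_0_iff)
      also have "\<dots> = norm (fourier (dir_deriv v f) \<xi>)"
        using v Suc.prems by (simp add: fourier_dir_deriv norm_mult inner_commute)
      finally have "japanese \<xi> ^ N * (\<bar>\<xi> \<bullet> v\<bar> * norm (fourier f \<xi>)) \<le> japanese \<xi> ^ N * norm (fourier (dir_deriv v f) \<xi>)"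
        by (rule mult_left_mono) simp
      from order_trans[OF this D[OF v, of \<xi>]] show "\<bar>\<xi> \<bullet> v\<bar> * (japanese \<xi> ^ N * norm (fourier f \<xi>)) \<le> D v" by (simp add: mult_ac)
    qed
    finally show ?thesis .
  qed
  then show ?case by blast
qed

lemma fourier_schwartz:
  fixes f :: "real^'n \<Rightarrow> complex"
  assumes "f \<in> schwartz" shows "fourier f \<in> schwartz"
proof (rule moderate_imp_schwartz, rule symbI)
  fix m k
  show "symk jw (\<lambda>_. 1) k m (fourier f)" using assms
  proof (induction k arbitrary: f m)
    have bd: "\<exists>C. \<forall>\<xi>. norm (fourier f \<xi>) \<le> C * jw m \<xi>" if f: "f \<in> schwartz" for f :: "real^'n \<Rightarrow> complex" and m
    proof -
      obtain N :: nat where N: "- m \<le> real N" using real_arch_simple by blast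
      obtain C where C: "\<And>\<xi>. japanese \<xi> ^ N * norm (fourier f \<xi>) \<le> C" using fourier_decay[OF f] by blast
      have "norm (fourier f \<xi>) \<le> C * jw m \<xi>" for \<xi>
      proof -
        have "norm (fourier f \<xi>) = (japanese \<xi> ^ N * norm (fourier f \<xi>)) * jw (- real N) \<xi>"
          by (simp add: powr_minus powr_realpow)
        also have "\<dots> \<le> C * jw (- real N) \<xi>" by (intro mult_right_mono C) simp
        also have "\<dots> \<le> C * jw m \<xi>"
          using N order_trans[OF _ C[of \<xi>], of 0] by (intro mult_left_mono powr_mono_japanese) auto
        finally show ?thesis .
      qed
      then show ?thesis by blast
    qed
    {
      case 0
      then show ?case using bd by simp
    next
      case (Suc k)
      show ?case
      proof (rule symk_SucI[OF _ fourier_has_derivative[OF Suc.prems]])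
        show "\<exists>C. \<forall>\<xi>. norm (fourier f \<xi>) \<le> C * jw m \<xi>" using Suc.prems by (rule bd)
        show "symk jw (\<lambda>_. 1) k (m + 1) (fourier (\<lambda>t. - (2 * pi * \<i>) * (of_real (v \<bullet> t) * f t)))" for v
          by (intro Suc.IH schwartz_cmult schwartz_coord_mult Suc.prems)
      qed
    }
  qed
qed

section \<open>Gaussians and Fourier inversion\<close>

lemma integral_cgauss:
  assumes "a > 0"
  shows "(LINT x|lborel. cgauss (of_real a) (x :: real^'n)) = of_real (a powr (- real CARD('n) / 2))"
proof -
  have 1: "(\<integral>\<^sup>+x. ennreal (exp (- (pi * a) * x\<^sup>2)) \<partial>lborel) = ennreal (a powr (- 1 / 2))"
  proof -
    define \<sigma> where "\<sigma> = 1 / sqrt (2 * pi * a)"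
    have s: "\<sigma> > 0" using assms by (simp add: \<sigma>_def)
    have sq: "2 * pi * \<sigma>\<^sup>2 = 1 / a" "2 * \<sigma>\<^sup>2 = 1 / (pi * a)"
      using assms by (simp_all add: \<sigma>_def power_divide)
    have eq: "exp (- (pi * a) * x\<^sup>2) = a powr (- 1 / 2) * normal_density 0 \<sigma> x" for x
    proof -
      have e1: "a powr (- 1 / 2) * (1 / sqrt (1 / a)) = 1"
        using assms by (simp add: powr_minus powr_half_sqrt real_sqrt_divide)
      have e2: "- (x - 0)\<^sup>2 / (1 / (pi * a)) = - (pi * a) * x\<^sup>2" by simp
      show ?thesis unfolding normal_density_def sq e2 mult.assoc[symmetric] e1 by simp
    qed
    have "(\<integral>\<^sup>+x. ennreal (normal_density 0 \<sigma> x) \<partial>lborel) = 1"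
      using s nn_integral_eq_integral[OF integrable_normal_density[OF s, of 0]] integral_normal_density[OF s, of 0] by simp
    then show ?thesis unfolding eq by (simp add: ennreal_mult nn_integral_cmult)
  qed
  let ?g = "\<lambda>x::real^'n. exp (- (pi * a) * (x \<bullet> x))"
  have "(\<integral>\<^sup>+x. ennreal (?g x) \<partial>lborel) = (\<integral>\<^sup>+x. (\<Prod>b\<in>Basis. ennreal (exp (- (pi * a) * (x \<bullet> b)\<^sup>2))) \<partial>(lborel :: (real^'n) measure))"
  proof (rule nn_integral_cong)
    fix x :: "real^'n"
    have "- (pi * a) * (x \<bullet> x) = (\<Sum>b\<in>Basis. - (pi * a) * (x \<bullet> b)\<^sup>2)"
      by (subst euclidean_inner) (simp add: sum_distrib_left power2_eq_square)
    then show "ennreal (?g x) = (\<Prod>b\<in>Basis. ennreal (exp (- (pi * a) * (x \<bullet> b)\<^sup>2)))"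
      by (simp add: prod_ennreal exp_sum)
  qed
  also have "\<dots> = (\<Prod>b\<in>(Basis :: (real^'n) set). (\<integral>\<^sup>+x. ennreal (exp (- (pi * a) * x\<^sup>2)) \<partial>lborel))"
    by (rule nn_integral_lborel_prod) auto
  also have "\<dots> = ennreal (a powr (- real CARD('n) / 2))"
    unfolding 1 using assms by (simp add: ennreal_power powr_realpow[symmetric] powr_powr)
  finally have "(LINT x|lborel. ?g x) = a powr (- real CARD('n) / 2)"
    by (subst integral_eq_nn_integral) auto
  moreover have "cgauss (of_real a) x = of_real (?g x)" for x :: "real^'n"
    by (simp add: cgauss_def exp_of_real[symmetric])
  ultimately show ?thesis by simp
qed

text \<open>To be read with p = 2 pi, F the transform of a Gaussian, X the transform of that
  Gaussian times a coordinate, and r the same coordinate of the frequency. The hypothesis is the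
  rule for transforms of derivatives, the conclusion the first-order differential equation satisfied
  by F.\<close>

lemma ode_algebra:
  fixes p a X r F :: complex
  assumes "p \<noteq> 0" "a \<noteq> 0" and eq: "- (p * a) * X = p * \<i> * r * F"
  shows "- (p * \<i>) * X = - (p / a) * r * F"
proof -
  have "p * (a * X + \<i> * r * F) = p * \<i> * r * F - (- (p * a) * X)" by (simp add: algebra_simps)
  also have "\<dots> = 0" unfolding eq by simp
  finally have "a * X + \<i> * r * F = 0" using assms by simp
  then have "a * X = - (\<i> * r * F)" by (simp add: eq_neg_iff_add_eq_0)
  then have "X = - (\<i> * r * F) / a" using assms(2) by (metis nonzero_mult_div_cancel_left)
  moreover have "p * \<i> * (\<i> * r * F) = \<i> * \<i> * (p * r * F)" by (simp only: mult_ac)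
  ultimately show ?thesis by simp
qed

text \<open>Multiplied by the inverse of the expected Gaussian, the transform has zero derivative by
  this differential equation, hence is constant. The argument is the same for real and complex
  parameters and leaves the value at the origin to be determined separately.\<close>

lemma fourier_cgauss:
  fixes \<xi> :: "real^'n"
  assumes a: "Re a > 0"
  shows "fourier (cgauss a) \<xi> = fourier (cgauss a) (0 :: real^'n) * cgauss (1 / a) \<xi>"
proof -
  let ?F = "fourier (cgauss a) :: real^'n \<Rightarrow> complex"
  have a0: "a \<noteq> 0" using a by auto
  have g: "(cgauss a :: real^'n \<Rightarrow> complex) \<in> schwartz" using a by (rule cgauss_schwartz)
  have dF: "fourier (\<lambda>t. - (complex_of_real (2 * pi) * \<i>) * (of_real (v \<bullet> t) * cgauss a t)) \<xi> = - (complex_of_real (2 * pi) / a) * of_real (v \<bullet> \<xi>) * ?F \<xi>"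
    if v: "v \<in> Basis" for v \<xi> :: "real^'n"
  proof -
    let ?p = "complex_of_real (2 * pi)"
    have "dir_deriv v (cgauss a) = (\<lambda>t. - (?p * a) * (of_real (v \<bullet> t) * cgauss a t))"
      using dir_deriv_eqI[OF cgauss_has_derivative, of v a] by (auto simp: inner_commute)
    then have "- (?p * a) * fourier (\<lambda>t. of_real (v \<bullet> t) * cgauss a t) \<xi> = ?p * \<i> * of_real (v \<bullet> \<xi>) * ?F \<xi>"
      using fourier_dir_deriv[OF g v, of \<xi>] by (simp only: fourier_cmult)
    from ode_algebra[OF _ a0 this]
    show ?thesis unfolding fourier_cmult by (simp only: of_real_eq_0_iff mult_eq_0_iff pi_neq_zero zero_neq_numeral not_False_eq_True simp_thms)
  qed
  define P where "P \<xi> = ?F \<xi> * cgauss (- 1 / a) \<xi>" for \<xi>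
  have "(P has_derivative (\<lambda>v. 0)) (at \<xi>)" for \<xi>
  proof -
    let ?D = "\<lambda>v. fourier (\<lambda>t. - (2 * pi * \<i>) * (of_real (v \<bullet> t) * cgauss a t)) \<xi>"
    have D: "(P has_derivative (\<lambda>v. ?F \<xi> * ((- (2 * of_real pi * (- 1 / a)) * of_real (\<xi> \<bullet> v)) * cgauss (- 1 / a) \<xi>) + ?D v * cgauss (- 1 / a) \<xi>)) (at \<xi>)"
      (is "(P has_derivative ?E) _")
      unfolding P_def by (rule has_derivative_mult[OF fourier_has_derivative[OF g] cgauss_has_derivative])
    have "?E v = 0" if "v \<in> Basis" for v
      unfolding dF[OF that] by (simp add: inner_commute algebra_simps)
    then have "?E = (\<lambda>v. 0)"
      by (intro linear_eq_stdbasis[OF has_derivative_linear[OF D]]) (auto simp: linear_zero)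
    with D show ?thesis by simp
  qed
  then have "P \<xi> = P 0"
    by (intro has_derivative_zero_unique[of UNIV P]) auto
  then have A: "?F \<xi> * cgauss (- 1 / a) \<xi> = ?F 0"
    by (simp add: P_def cgauss_def)
  have B: "cgauss (- 1 / a) \<xi> * cgauss (1 / a) \<xi> = 1"
    by (simp add: cgauss_def flip: exp_add)
  have "?F \<xi> = ?F \<xi> * (cgauss (- 1 / a) \<xi> * cgauss (1 / a) \<xi>)"
    unfolding B by simp
  then show ?thesis unfolding A[symmetric] by (simp only: mult.assoc)
qed

lemma fourier_gauss:
  fixes \<xi> :: "real^'n"
  assumes "a > 0"
  shows "fourier (cgauss (of_real a)) \<xi> = of_real (a powr (- real CARD('n) / 2)) * cgauss (of_real (1 / a)) \<xi>"
proof -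
  have "fourier (cgauss (of_real a)) (0 :: real^'n) = of_real (a powr (- real CARD('n) / 2))"
    using integral_cgauss[OF assms, where 'n='n] by (simp add: fourier_def)
  then show ?thesis using fourier_cgauss[of "of_real a" \<xi>] assms by simp
qed

text \<open>Gaussian summation: a factor \<open>cgauss\<close> of parameter \<epsilon>^2 legitimises
  Fubini, after which the transformed Gaussian acts on \<open>f\<close> as an approximate identity.
  Both sides pass to the limit by dominated convergence.\<close>

lemma fourier_inversion:
  fixes f :: "real^'n \<Rightarrow> complex"
  assumes f: "f \<in> schwartz"
  shows "(LINT \<xi>|lborel. fourier f \<xi> * cis (2 * pi * (\<xi> \<bullet> t))) = f t"
proof -
  define \<epsilon> where "\<epsilon> n = inverse (real (Suc n))" for n
  have \<epsilon>: "\<epsilon> n > 0" "\<epsilon> \<longlonglongrightarrow> 0" for n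
    unfolding \<epsilon>_def using LIMSEQ_inverse_real_of_nat by auto
  let ?g = "\<lambda>n. cgauss (of_real ((\<epsilon> n)\<^sup>2)) :: real^'n \<Rightarrow> complex"
  have g: "?g n \<in> schwartz" for n using \<epsilon>(1)[of n] by (intro cgauss_schwartz) simp
  have F: "fourier f \<in> schwartz" using f by (rule fourier_schwartz)
  note [measurable] = schwartz_measurable[OF f] schwartz_measurable[OF F] schwartz_measurable[OF g]
  have bd1: "norm (cgauss a x) \<le> 1" if "Re a \<ge> 0" for a and x :: "real^'n"
    using that by (simp add: norm_cgauss)
  define A where "A n = (LINT \<xi>|lborel. fourier f \<xi> * cis (2 * pi * (\<xi> \<bullet> t)) * ?g n \<xi>)" for n
  have LA: "A \<longlonglongrightarrow> (LINT \<xi>|lborel. fourier f \<xi> * cis (2 * pi * (\<xi> \<bullet> t)))"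
    unfolding A_def
  proof (rule integral_dominated_convergence)
    show "integrable lborel (\<lambda>\<xi>. norm (fourier f \<xi>))" by (rule schwartz_integrable_norm[OF F])
    show "AE \<xi> in lborel. (\<lambda>n. fourier f \<xi> * cis (2 * pi * (\<xi> \<bullet> t)) * ?g n \<xi>) \<longlonglongrightarrow> fourier f \<xi> * cis (2 * pi * (\<xi> \<bullet> t))"
    proof (rule AE_I2)
      fix \<xi>
      have "(\<lambda>n. ?g n \<xi>) \<longlonglongrightarrow> exp (- (of_real pi * of_real (0\<^sup>2) * of_real (\<xi> \<bullet> \<xi>)))"
        unfolding cgauss_def by (intro tendsto_intros \<epsilon>(2))
      then show "(\<lambda>n. fourier f \<xi> * cis (2 * pi * (\<xi> \<bullet> t)) * ?g n \<xi>) \<longlonglongrightarrow> fourier f \<xi> * cis (2 * pi * (\<xi> \<bullet> t))"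
        by (auto intro!: tendsto_eq_intros)
    qed
    show "AE \<xi> in lborel. norm (fourier f \<xi> * cis (2 * pi * (\<xi> \<bullet> t)) * ?g n \<xi>) \<le> norm (fourier f \<xi>)" for n
      using bd1[of "of_real ((\<epsilon> n)\<^sup>2)"] by (intro AE_I2) (simp add: norm_mult mult_left_le)
  qed measurable
  have eqA: "A n = (LINT u|lborel. f (t + \<epsilon> n *\<^sub>R u) * cgauss 1 u)" for n
  proof -
    have "A n = (LINT \<xi>|lborel. LINT s|lborel. f s * cis (- 2 * pi * (s \<bullet> \<xi>)) * (cis (2 * pi * (\<xi> \<bullet> t)) * ?g n \<xi>))"
      by (simp only: A_def fourier_def mult.assoc integral_mult_left_zero[symmetric])
    also have "\<dots> = (LINT s|lborel. LINT \<xi>|lborel. f s * cis (- 2 * pi * (s \<bullet> \<xi>)) * (cis (2 * pi * (\<xi> \<bullet> t)) * ?g n \<xi>))"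
    proof (rule fubini_bound)
      show "integrable lborel (\<lambda>\<xi>. norm (?g n \<xi>))" "integrable lborel (\<lambda>s. norm (f s))"
        using f g by (auto intro: schwartz_integrable_norm)
      show "norm (f s * cis (- 2 * pi * (s \<bullet> \<xi>)) * (cis (2 * pi * (\<xi> \<bullet> t)) * ?g n \<xi>)) \<le> norm (?g n \<xi>) * norm (f s)" for s \<xi>
        by (simp add: norm_mult)
    qed measurable
    also have "\<dots> = (LINT s|lborel. f s * fourier (?g n) (s - t))"
    proof (rule Bochner_Integration.integral_cong[OF refl])
      fix s
      have "f s * cis (- 2 * pi * (s \<bullet> \<xi>)) * (cis (2 * pi * (\<xi> \<bullet> t)) * ?g n \<xi>) = f s * (?g n \<xi> * cis (- 2 * pi * (\<xi> \<bullet> (s - t))))" for \<xi>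
      proof -
        have "cis (- 2 * pi * (\<xi> \<bullet> (s - t))) = cis (- 2 * pi * (s \<bullet> \<xi>)) * cis (2 * pi * (\<xi> \<bullet> t))"
          unfolding cis_mult by (simp add: inner_diff_right inner_commute[of s] algebra_simps)
        then show ?thesis by (simp only: mult_ac)
      qed
      then show "(LINT \<xi>|lborel. f s * cis (- 2 * pi * (s \<bullet> \<xi>)) * (cis (2 * pi * (\<xi> \<bullet> t)) * ?g n \<xi>)) = f s * fourier (?g n) (s - t)"
        unfolding fourier_def by (simp only: integral_mult_right_zero)
    qed
    \<comment> \<open>The transformed Gaussian has width \<epsilon>; the substitution s = t +
      \<epsilon> u brings it to unit width, and the Jacobian cancels its height.\<close>
    also have "\<dots> = \<bar>\<epsilon> n\<bar> ^ DIM(real^'n) *\<^sub>R (LINT u|lborel. f (t + \<epsilon> n *\<^sub>R u) * fourier (?g n) (t + \<epsilon> n *\<^sub>R u - t))"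
    proof (rule integral_affine)
      have [measurable]: "fourier (?g n) \<in> borel_measurable borel" by (intro schwartz_measurable fourier_schwartz g)
      show "(\<lambda>s. f s * fourier (?g n) (s - t)) \<in> borel_measurable borel" by measurable
    qed (use \<epsilon>(1)[of n] in simp)
    also have "\<dots> = (LINT u|lborel. f (t + \<epsilon> n *\<^sub>R u) * cgauss 1 u)"
    proof -
      have "fourier (?g n) (\<epsilon> n *\<^sub>R u) = of_real (1 / \<epsilon> n ^ CARD('n)) * cgauss 1 u" for u :: "real^'n"
      proof -
        have e: "((\<epsilon> n)\<^sup>2) powr (- real CARD('n) / 2) = 1 / \<epsilon> n ^ CARD('n)"
          using \<epsilon>(1)[of n] by (simp add: powr_powr powr_minus powr_realpow inverse_eq_divide flip: powr_numeral)
        have c: "cgauss (of_real (1 / (\<epsilon> n)\<^sup>2)) (\<epsilon> n *\<^sub>R u) = cgauss 1 u"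
          using \<epsilon>(1)[of n] by (simp add: cgauss_def power2_eq_square)
        show ?thesis
          using fourier_gauss[of "(\<epsilon> n)\<^sup>2" "\<epsilon> n *\<^sub>R u"] \<epsilon>(1)[of n] unfolding e c by simp
      qed
      moreover have "f x * (of_real (1 / \<epsilon> n ^ CARD('n)) * y) = of_real (1 / \<epsilon> n ^ CARD('n)) * (f x * y)" for x y
        by (simp only: mult_ac)
      ultimately show ?thesis
        using \<epsilon>(1)[of n] by (simp add: scaleR_conv_of_real)
    qed
    finally show ?thesis .
  qed
  have L2: "(\<lambda>n. LINT u|lborel. f (t + \<epsilon> n *\<^sub>R u) * cgauss 1 u) \<longlonglongrightarrow> (LINT u|lborel. f t * cgauss 1 (u :: real^'n))"
  proof -
    obtain C where C: "C > 0" "\<And>x. norm (f x) \<le> C * jw 0 x" using schwartz_bound[OF f] by blast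
    have g1: "(cgauss 1 :: real^'n \<Rightarrow> complex) \<in> schwartz" by (rule cgauss_schwartz) simp
    note [measurable] = schwartz_measurable[OF g1]
    show ?thesis
    proof (rule integral_dominated_convergence)
      show "integrable lborel (\<lambda>u::real^'n. C * norm (cgauss 1 u))"
        by (intro integrable_mult_right schwartz_integrable_norm g1)
      show "AE u in lborel. (\<lambda>n. f (t + \<epsilon> n *\<^sub>R u) * cgauss 1 u) \<longlonglongrightarrow> f t * cgauss 1 u"
      proof (intro AE_I2 tendsto_mult tendsto_const)
        fix u
        have "(\<lambda>n. t + \<epsilon> n *\<^sub>R u) \<longlonglongrightarrow> t + 0 *\<^sub>R u" by (intro tendsto_intros \<epsilon>(2))
        then have "(\<lambda>n. t + \<epsilon> n *\<^sub>R u) \<longlonglongrightarrow> t" by simp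
        then show "(\<lambda>n. f (t + \<epsilon> n *\<^sub>R u)) \<longlonglongrightarrow> f t"
          using schwartz_continuous[OF f, of UNIV] by (auto simp: continuous_on_def intro: tendsto_compose)
      qed
      show "AE u in lborel. norm (f (t + \<epsilon> n *\<^sub>R u) * cgauss 1 u) \<le> C * norm (cgauss 1 u)" for n
        using C by (intro AE_I2) (simp add: norm_mult mult_right_mono)
    qed measurable
  qed
  have L3: "(LINT u|lborel. f t * cgauss 1 (u :: real^'n)) = f t"
    using integral_cgauss[of 1, where 'n='n] by simp
  have "(\<lambda>n. A n) \<longlonglongrightarrow> f t" unfolding eqA using L2 unfolding L3 .
  with LA show ?thesis by (rule LIMSEQ_unique)
qed

lemma fourier_reflect: "fourier (\<lambda>t. f (- t)) \<xi> = fourier f (- \<xi>)"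
  if "f \<in> schwartz"
  unfolding fourier_def
  using integral_affine[of "\<lambda>t. f t * cis (- 2 * pi * (t \<bullet> - \<xi>))" "- 1" 0] schwartz_measurable[OF that]
  by simp

lemma fourier_fourier:
  assumes "f \<in> schwartz" shows "fourier (fourier f) t = f (- t)"
  using fourier_inversion[OF assms, of "- t"] by (simp add: fourier_def)

lemma fourier_surj:
  assumes "F \<in> schwartz"
  obtains f where "f \<in> schwartz" "fourier f = F" "\<And>t. f t = fourier F (- t)"
proof
  show "(\<lambda>t. fourier F (- t)) \<in> schwartz" by (intro schwartz_reflect fourier_schwartz assms)
  show "fourier (\<lambda>t. fourier F (- t)) = F"
    using assms by (auto simp: fourier_reflect fourier_fourier fourier_schwartz)
qed simp

text \<open>Inversion is applied to \<open>h\<close> alone, so \<open>f\<close> may be any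
  integrable function. This matters later for images under the operator, which are not known to be
  Schwartz functions.\<close>

lemma parseval:
  fixes f h :: "real^'n \<Rightarrow> complex"
  assumes f: "integrable lborel f" and h: "h \<in> schwartz"
  shows "(LINT t|lborel. f t * cnj (h t)) = (LINT \<xi>|lborel. fourier f \<xi> * cnj (fourier h \<xi>))"
proof -
  have H: "fourier h \<in> schwartz" using h by (rule fourier_schwartz)
  have [measurable]: "f \<in> borel_measurable borel" using f by auto
  note [measurable] = schwartz_measurable[OF h] schwartz_measurable[OF H]
  have "(LINT t|lborel. f t * cnj (h t)) = (LINT t|lborel. LINT \<xi>|lborel. f t * cnj (fourier h \<xi> * cis (2 * pi * (\<xi> \<bullet> t))))"
  proof (rule Bochner_Integration.integral_cong[OF refl])
    fix t
    have "cnj (h t) = (LINT \<xi>|lborel. cnj (fourier h \<xi> * cis (2 * pi * (\<xi> \<bullet> t))))"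
      by (simp only: Bochner_Integration.integral_cnj fourier_inversion[OF h])
    then show "f t * cnj (h t) = (LINT \<xi>|lborel. f t * cnj (fourier h \<xi> * cis (2 * pi * (\<xi> \<bullet> t))))"
      by (simp only: integral_mult_right_zero)
  qed
  also have "\<dots> = (LINT \<xi>|lborel. LINT t|lborel. f t * cnj (fourier h \<xi> * cis (2 * pi * (\<xi> \<bullet> t))))"
  proof (rule fubini_bound)
    show "integrable lborel (\<lambda>t. norm (f t))" "integrable lborel (\<lambda>\<xi>. norm (fourier h \<xi>))"
      using f schwartz_integrable_norm[OF H] by auto
    show "norm (f t * cnj (fourier h \<xi> * cis (2 * pi * (\<xi> \<bullet> t)))) \<le> norm (f t) * norm (fourier h \<xi>)" for t \<xi>
      by (simp add: norm_mult)
  qed measurable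
  also have "\<dots> = (LINT \<xi>|lborel. fourier f \<xi> * cnj (fourier h \<xi>))"
  proof (rule Bochner_Integration.integral_cong[OF refl])
    fix \<xi>
    have "f t * cnj (fourier h \<xi> * cis (2 * pi * (\<xi> \<bullet> t))) = (f t * cis (- 2 * pi * (t \<bullet> \<xi>))) * cnj (fourier h \<xi>)" for t
      by (simp add: cis_cnj inner_commute mult_ac)
    then show "(LINT t|lborel. f t * cnj (fourier h \<xi> * cis (2 * pi * (\<xi> \<bullet> t)))) = fourier f \<xi> * cnj (fourier h \<xi>)"
      unfolding fourier_def by (simp only: integral_mult_left_zero)
  qed
  finally show ?thesis .
qed

section \<open>Plancherel and the size of transformed Gaussians\<close>

lemma plancherel:
  fixes f :: "real^'n \<Rightarrow> complex"
  assumes f: "f \<in> schwartz"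
  shows "(LINT t|lborel. (norm (f t))\<^sup>2) = (LINT \<xi>|lborel. (norm (fourier f \<xi>))\<^sup>2)"
proof -
  have "complex_of_real (LINT t|lborel. (norm (f t))\<^sup>2) = complex_of_real (LINT \<xi>|lborel. (norm (fourier f \<xi>))\<^sup>2)"
    using parseval[OF schwartz_integrable[OF f] f]
    by (simp only: complex_norm_square[symmetric] integral_complex_of_real)
  then show ?thesis by (simp only: of_real_eq_iff)
qed

lemma schwartz_integrable_sq: "f \<in> schwartz \<Longrightarrow> integrable lborel (\<lambda>t. (norm (f t))\<^sup>2)"
  using schwartz_integrable_norm[OF schwartz_mult[of f f]] by (simp add: norm_mult power2_eq_square)

text \<open>The constant in front of the transform of a complex Gaussian follows, up to a phase, from
  Plancherel and the real Gaussian integrals.\<close>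

lemma norm_fourier_cgauss:
  fixes \<xi> :: "real^'n"
  assumes a: "Re a > 0"
  shows "norm (fourier (cgauss a) \<xi>) = norm a powr (- real CARD('n) / 2) * norm (cgauss (1 / a) \<xi>)"
proof -
  let ?c = "fourier (cgauss a) (0 :: real^'n)"
  have g: "(cgauss a :: real^'n \<Rightarrow> complex) \<in> schwartz" using a by (rule cgauss_schwartz)
  have a0: "a \<noteq> 0" using a by auto
  have re: "Re (1 / a) = Re a / (norm a)\<^sup>2" by (simp add: Re_divide_numeral cmod_power2 Re_divide)
  then have ra: "Re (1 / a) > 0" using a a0 by simp
  have sq: "(LINT x|lborel. (norm (cgauss b (x :: real^'n)))\<^sup>2) = (2 * Re b) powr (- real CARD('n) / 2)" if "Re b > 0" for b
  proof -
    have "complex_of_real ((norm (cgauss b x))\<^sup>2) = cgauss (of_real (2 * Re b)) x" for x :: "real^'n"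
      by (simp add: norm_cgauss cgauss_def power2_eq_square exp_of_real[symmetric] mult_ac flip: exp_add)
    then have "complex_of_real (LINT x|lborel. (norm (cgauss b (x :: real^'n)))\<^sup>2) = of_real ((2 * Re b) powr (- real CARD('n) / 2))"
      using that by (simp only: integral_complex_of_real[symmetric] integral_cgauss)
    then show ?thesis by (simp only: of_real_eq_iff)
  qed
  have "(2 * Re a) powr (- real CARD('n) / 2) = (LINT \<xi>|lborel. (norm (fourier (cgauss a) (\<xi> :: real^'n)))\<^sup>2)"
    using plancherel[OF g] sq[OF a] by simp
  also have "\<dots> = (norm ?c)\<^sup>2 * (2 * Re (1 / a)) powr (- real CARD('n) / 2)"
  proof -
    have "(norm (fourier (cgauss a) \<xi>))\<^sup>2 = (norm ?c)\<^sup>2 * (norm (cgauss (1 / a) \<xi>))\<^sup>2" for \<xi> :: "real^'n"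
      by (rule trans[OF arg_cong[OF fourier_cgauss[OF a, of \<xi>], of "\<lambda>z. (norm z)\<^sup>2"]]) (simp only: norm_mult power_mult_distrib)
    then have "(LINT \<xi>|lborel. (norm (fourier (cgauss a) (\<xi> :: real^'n)))\<^sup>2) = (LINT \<xi>|lborel. (norm ?c)\<^sup>2 * (norm (cgauss (1 / a) (\<xi> :: real^'n)))\<^sup>2)"
      by (intro Bochner_Integration.integral_cong refl)
    then show ?thesis unfolding integral_mult_right_zero sq[OF ra] .
  qed
  finally have eq: "(2 * Re a) powr (- real CARD('n) / 2) = (norm ?c)\<^sup>2 * (2 * Re (1 / a)) powr (- real CARD('n) / 2)" .
  have "2 * Re a = 2 * Re (1 / a) * (norm a)\<^sup>2" using a0 re by simp
  then have "(2 * Re a) powr (- real CARD('n) / 2) = (2 * Re (1 / a)) powr (- real CARD('n) / 2) * ((norm a)\<^sup>2) powr (- real CARD('n) / 2)"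
    using ra by (simp only: powr_mult)
  with eq have "(norm ?c)\<^sup>2 = ((norm a)\<^sup>2) powr (- real CARD('n) / 2)"
    using ra a by (simp add: mult.commute)
  also have "\<dots> = (norm a powr (- real CARD('n) / 2))\<^sup>2"
    using a0 by (simp add: powr_powr mult.commute flip: powr_numeral)
  finally have "norm ?c = norm a powr (- real CARD('n) / 2)"
    by (rule power2_eq_imp_eq) auto
  then show ?thesis
    by (intro trans[OF arg_cong[OF fourier_cgauss[OF a, of \<xi>], of norm]]) (simp only: norm_mult)
qed


section \<open>Lebesgue norms\<close>

lemma enn2real_one_divide: "0 < q \<Longrightarrow> enn2real (1 / ennreal q) = 1 / q"
  using divide_ennreal[of 1 q] by simp

lemma exponent_cases:
  assumes "1 \<le> p"
  obtains "p = \<infinity>" | q where "p = ennreal q" "1 \<le> q"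
proof (cases p)
  case (real q)
  then show ?thesis using assms that(2)[of q] by simp
next
  case top
  then show ?thesis using that(1) by simp
qed

text \<open>Pointwise |F|^q is at most S^{q - r} |F|^r, and integrating gives the bound. With
  1/\<infinity> = 0 the formula reduces to the supremum bound at the upper end. It is used with r =
  1 for functions of rapid decay and with r = 2 for chirps.\<close>

lemma Lp_norm_interpolate:
  fixes F :: "'a \<Rightarrow> complex"
  assumes p: "1 \<le> p" and r: "1 \<le> r" "ennreal r \<le> p"
    and [measurable]: "F \<in> borel_measurable M"
    and S: "S > 0" "\<And>z. norm (F z) \<le> S"
    and L: "L > 0" "(\<integral>\<^sup>+z. ennreal (norm (F z) powr r) \<partial>M) \<le> ennreal L"
  shows "Lp_norm p M F \<le> ennreal (S powr (1 - r * enn2real (1 / p)) * L powr enn2real (1 / p))"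
  using p
proof (cases rule: exponent_cases)
  case 1
  have "esssup M (\<lambda>z. ennreal (norm (F z))) \<le> ennreal S"
    using S by (intro esssup_I AE_I2 ennreal_leI) auto
  then show ?thesis using 1 S L by (simp add: Lp_norm_def)
next
  case (2 q)
  then have q: "q \<ge> r" "q > 0" "p \<noteq> \<infinity>" "enn2real p = q" using r by auto
  define I where "I = (\<integral>\<^sup>+z. ennreal (norm (F z) powr q) \<partial>M)"
  have "norm (F z) powr q \<le> S powr (q - r) * norm (F z) powr r" for z
  proof (cases "F z = 0")
    case False
    have "norm (F z) powr q = norm (F z) powr (q - r) * norm (F z) powr r"
      by (simp flip: powr_add)
    also have "\<dots> \<le> S powr (q - r) * norm (F z) powr r"
      using S q by (intro mult_right_mono powr_mono2) auto
    finally show ?thesis .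
  qed simp
  then have "I \<le> (\<integral>\<^sup>+z. ennreal (S powr (q - r)) * ennreal (norm (F z) powr r) \<partial>M)"
    unfolding I_def by (intro nn_integral_mono) (simp flip: ennreal_mult)
  also have "\<dots> = ennreal (S powr (q - r)) * (\<integral>\<^sup>+z. ennreal (norm (F z) powr r) \<partial>M)"
    by (rule nn_integral_cmult) measurable
  also have "\<dots> \<le> ennreal (S powr (q - r)) * ennreal L"
    by (intro mult_left_mono L) simp
  finally have I: "I \<le> ennreal (S powr (q - r) * L)" using L by (simp add: ennreal_mult)
  then have fin: "I \<noteq> \<infinity>" by (auto simp: top_unique)
  have "enn2real I \<le> S powr (q - r) * L" using enn2real_mono[OF I] S L by simp
  then have "enn2real I powr (1 / q) \<le> (S powr (q - r) * L) powr (1 / q)"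
    using q by (intro powr_mono2) auto
  also have "\<dots> = S powr (1 - r * (1 / q)) * L powr (1 / q)"
    using q S L by (simp add: powr_mult powr_powr diff_divide_distrib)
  finally show ?thesis
    using q fin 2 by (simp add: Lp_norm_def I_def[symmetric] Let_def enn2real_one_divide ennreal_leI)
qed

lemma Lp_norm_1:
  assumes "F \<in> borel_measurable M"
  shows "Lp_norm 1 M F = (\<integral>\<^sup>+z. ennreal (norm (F z)) \<partial>M)"
  by (auto simp: Lp_norm_def Let_def less_top)

text \<open>Young's inequality for F / a and G / b, where a and b are the two norms. A vanishing
  norm, which forbids the division, and the exponent pair 1 and \<infinity> are treated
  separately.\<close>

lemma Lp_norm_Hoelder:
  fixes F G :: "'a \<Rightarrow> complex"
  assumes p: "1 \<le> p" "1 \<le> p'" and pp: "enn2real (1 / p) + enn2real (1 / p') = 1"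
    and [measurable]: "F \<in> borel_measurable M" "G \<in> borel_measurable M"
    and fin: "Lp_norm p M F < \<infinity>" "Lp_norm p' M G < \<infinity>"
  shows "(\<integral>\<^sup>+z. ennreal (norm (F z) * norm (G z)) \<partial>M) \<le> Lp_norm p M F * Lp_norm p' M G"
proof -
  have sup: "(\<integral>\<^sup>+z. ennreal (norm (F z) * norm (G z)) \<partial>M) \<le> Lp_norm \<infinity> M F * Lp_norm 1 M G"
    if [measurable]: "F \<in> borel_measurable M" "G \<in> borel_measurable M" for F G :: "'a \<Rightarrow> complex"
  proof -
    let ?s = "esssup M (\<lambda>z. ennreal (norm (F z)))"
    have "(\<integral>\<^sup>+z. ennreal (norm (F z) * norm (G z)) \<partial>M) \<le> (\<integral>\<^sup>+z. ?s * ennreal (norm (G z)) \<partial>M)"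
    proof (rule nn_integral_mono_AE)
      show "AE z in M. ennreal (norm (F z) * norm (G z)) \<le> ?s * ennreal (norm (G z))"
        using esssup_AE[of "\<lambda>z. ennreal (norm (F z))" M]
        by eventually_elim (simp add: ennreal_mult mult_right_mono)
    qed
    also have "\<dots> = ?s * (\<integral>\<^sup>+z. ennreal (norm (G z)) \<partial>M)" by (rule nn_integral_cmult) measurable
    finally show ?thesis unfolding Lp_norm_1[OF that(2)] by (simp add: Lp_norm_def)
  qed
  show ?thesis
    using p(1)
  proof (cases rule: exponent_cases)
    case 1
    have "p' = 1" using p(2)
    proof (cases rule: exponent_cases)
      case (2 q)
      then show ?thesis using pp 1 by (simp add: enn2real_one_divide)
    qed (use pp 1 in simp)
    then show ?thesis using sup 1 by simp
  next
    case (2 q)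
    note q = this
    show ?thesis using p(2)
    proof (cases rule: exponent_cases)
      case 1
      have "p = 1" using pp q 1 by (simp add: enn2real_one_divide)
      then show ?thesis using sup[of G F] 1 by (simp add: mult.commute)
    next
      case (2 q')
      have qq: "1 / q + 1 / q' = 1" using pp q 2 by (simp add: enn2real_one_divide)
      have "q \<noteq> 1" "q' \<noteq> 1" using qq q 2 by auto
      then have q1: "q > 1" "q' > 1" using q 2 by auto
      define I where "I = (\<integral>\<^sup>+z. ennreal (norm (F z) powr q) \<partial>M)"
      define J where "J = (\<integral>\<^sup>+z. ennreal (norm (G z) powr q') \<partial>M)"
      have Ln: "Lp_norm p M F = (if I = \<infinity> then \<infinity> else ennreal (enn2real I powr (1 / q)))"
        "Lp_norm p' M G = (if J = \<infinity> then \<infinity> else ennreal (enn2real J powr (1 / q')))"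
        using q 2 by (simp_all add: Lp_norm_def I_def J_def Let_def)
      then have IJ: "I \<noteq> \<infinity>" "J \<noteq> \<infinity>" using fin by auto
      define a where "a = enn2real I powr (1 / q)"
      define b where "b = enn2real J powr (1 / q')"
      have I: "I = ennreal (a powr q)" and J: "J = ennreal (b powr q')"
        using IJ q1 by (simp_all add: a_def b_def powr_powr less_top)
      have ab: "a \<ge> 0" "b \<ge> 0" by (auto simp: a_def b_def)
      show ?thesis
      proof (cases "a = 0 \<or> b = 0")
        case True
        then have ae: "AE z in M. norm (F z) * norm (G z) = 0"
        proof
          assume "a = 0"
          then have "I = 0" using I by simp
          then have "AE z in M. ennreal (norm (F z) powr q) = 0"
            unfolding I_def by (subst (asm) nn_integral_0_iff_AE) auto
          then show ?thesis by eventually_elim (use q1 in \<open>auto simp: ennreal_eq_0_iff\<close>)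
        next
          assume "b = 0"
          then have "J = 0" using J by simp
          then have "AE z in M. ennreal (norm (G z) powr q') = 0"
            unfolding J_def by (subst (asm) nn_integral_0_iff_AE) auto
          then show ?thesis by eventually_elim (use q1 in \<open>auto simp: ennreal_eq_0_iff\<close>)
        qed
        have "(\<integral>\<^sup>+z. ennreal (norm (F z) * norm (G z)) \<partial>M) = (\<integral>\<^sup>+z. 0 \<partial>M)"
          by (rule nn_integral_cong_AE) (use ae in eventually_elim, simp)
        then show ?thesis by simp
      next
        case False
        then have ab: "a > 0" "b > 0" using ab by auto
        have "norm (F z) * norm (G z) \<le> (a * b) * ((1 / q / a powr q) * norm (F z) powr q + (1 / q' / b powr q') * norm (G z) powr q')" for z
        proof -
          have "(norm (F z) / a) * (norm (G z) / b) \<le> (norm (F z) / a) powr q / q + (norm (G z) / b) powr q' / q'"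
            by (rule Youngs_inequality) (use q1 qq ab in auto)
          then have "(a * b) * ((norm (F z) / a) * (norm (G z) / b)) \<le> (a * b) * ((norm (F z) / a) powr q / q + (norm (G z) / b) powr q' / q')"
            using ab by (intro mult_left_mono) auto
          moreover have "(a * b) * ((norm (F z) / a) * (norm (G z) / b)) = norm (F z) * norm (G z)"
            using ab by simp
          ultimately show ?thesis using ab by (simp add: powr_divide mult.commute)
        qed
        then have "(\<integral>\<^sup>+z. ennreal (norm (F z) * norm (G z)) \<partial>M)
          \<le> (\<integral>\<^sup>+z. ennreal (a * b) * (ennreal (1 / q / a powr q) * ennreal (norm (F z) powr q) + ennreal (1 / q' / b powr q') * ennreal (norm (G z) powr q')) \<partial>M)"
          using ab q1 by (intro nn_integral_mono) (simp flip: ennreal_mult ennreal_plus)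
        also have "\<dots> = ennreal (a * b) * (ennreal (1 / q / a powr q) * I + ennreal (1 / q' / b powr q') * J)"
          unfolding I_def J_def by (simp add: nn_integral_cmult nn_integral_add)
        also have "\<dots> = ennreal (a * b) * ennreal (1 / q + 1 / q')"
          unfolding I J using ab q1 by (simp flip: ennreal_mult ennreal_plus)
        also have "\<dots> = Lp_norm p M F * Lp_norm p' M G"
          unfolding qq Ln using IJ ab by (simp add: a_def[symmetric] b_def[symmetric] ennreal_mult)
        finally show ?thesis .
      qed
    qed
  qed
qed

section \<open>The short-time Fourier transform\<close>

text \<open>The short-time Fourier transform of a function rather than of a functional. Agreement
  with \<open>stft\<close> puts no condition on \<open>f\<close>, so the image under the operator
  can be inserted directly.\<close>

definition V :: "(real^'n \<Rightarrow> complex) \<Rightarrow> (real^'n \<Rightarrow> complex) \<Rightarrow> (real^'n) \<times> (real^'n) \<Rightarrow> complex" where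
  "V g f z = (LINT t|lborel. f t * (cnj (g (t - fst z)) * cis (- 2 * pi * (snd z \<bullet> t))))"

lemma stft_distr_of:
  assumes "g \<in> schwartz"
  shows "stft g (distr_of f) = V g f"
proof
  fix z :: "(real^'a) \<times> (real^'a)"
  have "(\<lambda>t. cis (- 2 * pi * (snd z \<bullet> t)) * cnj (g (t - fst z))) \<in> schwartz"
    by (intro schwartz_modulate schwartz_cnj schwartz_shift assms)
  then have "(\<lambda>t. cnj (g (t - fst z)) * cis (- 2 * pi * (snd z \<bullet> t))) \<in> schwartz"
    by (simp add: mult.commute)
  then show "stft g (distr_of f) z = V g f z"
    by (simp add: stft_def distr_of_def V_def case_prod_unfold)
qed

lemma V_eq_fourier: "V g f (x, \<xi>) = fourier (\<lambda>t. f t * cnj (g (t - x))) \<xi>"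
  by (simp add: V_def fourier_def inner_commute mult.assoc)

lemma fourier_shift_modulate:
  fixes g :: "real^'n \<Rightarrow> complex"
  assumes "g \<in> schwartz"
  shows "fourier (\<lambda>t. cis (2 * pi * (\<xi> \<bullet> t)) * g (t - x)) \<omega> = cis (- 2 * pi * (x \<bullet> (\<omega> - \<xi>))) * fourier g (\<omega> - \<xi>)"
proof -
  note [measurable] = schwartz_measurable[OF assms]
  have "fourier (\<lambda>t. cis (2 * pi * (\<xi> \<bullet> t)) * g (t - x)) \<omega>
     = (LINT t|lborel. cis (2 * pi * (\<xi> \<bullet> (t + x))) * g (t + x - x) * cis (- 2 * pi * ((t + x) \<bullet> \<omega>)))"
    unfolding fourier_def by (rule integral_shift(1)[symmetric]) measurable
  also have "\<dots> = (LINT t|lborel. cis (- 2 * pi * (x \<bullet> (\<omega> - \<xi>))) * (g t * cis (- 2 * pi * (t \<bullet> (\<omega> - \<xi>)))))"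
  proof (rule Bochner_Integration.integral_cong[OF refl])
    fix t
    have "cis (2 * pi * (\<xi> \<bullet> (t + x))) * cis (- 2 * pi * ((t + x) \<bullet> \<omega>)) = cis (- 2 * pi * (x \<bullet> (\<omega> - \<xi>))) * cis (- 2 * pi * (t \<bullet> (\<omega> - \<xi>)))"
      unfolding cis_mult by (rule arg_cong[where f=cis]) (simp add: inner_simps inner_commute[of \<xi>] algebra_simps)
    then show "cis (2 * pi * (\<xi> \<bullet> (t + x))) * g (t + x - x) * cis (- 2 * pi * ((t + x) \<bullet> \<omega>)) = cis (- 2 * pi * (x \<bullet> (\<omega> - \<xi>))) * (g t * cis (- 2 * pi * (t \<bullet> (\<omega> - \<xi>))))"
      by (simp only: add_diff_cancel_right' mult.left_commute[of _ "g t"] mult.assoc mult.commute[of _ "g t"])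
  qed
  finally show ?thesis by (simp only: integral_mult_right_zero fourier_def)
qed

text \<open>The fundamental identity of time-frequency analysis: up to a unimodular factor, the
  Fourier transform acts on phase space as a rotation by a right angle. It follows from Parseval,
  applied to the time-frequency shift of the window.\<close>

lemma norm_V_fourier:
  fixes f g :: "real^'n \<Rightarrow> complex"
  assumes f: "f \<in> schwartz" and g: "g \<in> schwartz"
  shows "norm (V g f (x, \<xi>)) = norm (V (fourier g) (fourier f) (\<xi>, - x))"
proof -
  let ?h = "\<lambda>t. cis (2 * pi * (\<xi> \<bullet> t)) * g (t - x)"
  have h: "?h \<in> schwartz" by (intro schwartz_modulate schwartz_shift g)
  have "V g f (x, \<xi>) = (LINT t|lborel. f t * cnj (?h t))"
    by (simp add: V_def cis_cnj mult.commute)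
  also have "\<dots> = (LINT \<omega>|lborel. fourier f \<omega> * cnj (fourier ?h \<omega>))"
    by (rule parseval[OF schwartz_integrable[OF f] h])
  also have "\<dots> = (LINT \<omega>|lborel. cis (- 2 * pi * (x \<bullet> \<xi>)) * (fourier f \<omega> * (cnj (fourier g (\<omega> - \<xi>)) * cis (- 2 * pi * (- x \<bullet> \<omega>)))))"
  proof (rule Bochner_Integration.integral_cong[OF refl])
    fix \<omega>
    have "cnj (cis (- 2 * pi * (x \<bullet> (\<omega> - \<xi>)))) = cis (- 2 * pi * (x \<bullet> \<xi>)) * cis (- 2 * pi * (- x \<bullet> \<omega>))"
      unfolding cis_mult cis_cnj by (rule arg_cong[where f=cis]) (simp add: inner_simps algebra_simps)
    then show "fourier f \<omega> * cnj (fourier ?h \<omega>) = cis (- 2 * pi * (x \<bullet> \<xi>)) * (fourier f \<omega> * (cnj (fourier g (\<omega> - \<xi>)) * cis (- 2 * pi * (- x \<bullet> \<omega>))))"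
      unfolding fourier_shift_modulate[OF g] complex_cnj_mult by (simp only: mult_ac)
  qed
  also have "\<dots> = cis (- 2 * pi * (x \<bullet> \<xi>)) * V (fourier g) (fourier f) (\<xi>, - x)"
    by (simp only: integral_mult_right_zero V_def fst_conv snd_conv)
  finally show ?thesis by (simp add: norm_mult)
qed

section \<open>Size, decay and integrability of the short-time Fourier transform\<close>

lemma V_sup:
  fixes f g :: "real^'n \<Rightarrow> complex"
  assumes g: "g \<in> schwartz" and B: "\<And>t. norm (f t) \<le> B"
  shows "norm (V g f z) \<le> B * (LINT t|lborel. norm (g t))"
proof -
  note [measurable] = schwartz_measurable[OF g]
  have "norm (V g f z) \<le> (LINT t|lborel. norm (f t * (cnj (g (t - fst z)) * cis (- 2 * pi * (snd z \<bullet> t)))))"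
    unfolding V_def by (rule integral_norm_bound)
  also have "\<dots> \<le> (LINT t|lborel. B * norm (g (t - fst z)))"
    by (rule integral_mono')
       (auto simp: norm_mult intro!: mult_right_mono B integrable_mult_right schwartz_integrable_norm[OF schwartz_shift[OF g]]
         mult_nonneg_nonneg order_trans[OF norm_ge_zero B])
  also have "\<dots> = B * (LINT t|lborel. norm (g t))"
    using integral_shift(1)[of "\<lambda>t. norm (g t)" "- fst z"] by simp
  finally show ?thesis .
qed

text \<open>A chirp is of size one while its transform is small. Rotating phase space lets the
  transform control the supremum.\<close>

lemma V_sup_fourier:
  fixes f g :: "real^'n \<Rightarrow> complex"
  assumes f: "f \<in> schwartz" and g: "g \<in> schwartz" and B: "\<And>t. norm (fourier f t) \<le> B"
  shows "norm (V g f z) \<le> B * (LINT t|lborel. norm (fourier g t))"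
  using V_sup[OF fourier_schwartz[OF g] B] norm_V_fourier[OF f g, of "fst z" "snd z"] by simp

lemma window_bound:
  fixes g :: "real^'n \<Rightarrow> complex"
  assumes g: "g \<in> schwartz" and N: "N \<ge> 0"
  obtains C where "C > 0" "\<And>t x. norm (g (t - x)) \<le> C * jw (- N) x * jw N t"
proof -
  obtain C where C: "C > 0" "\<And>x. norm (g x) \<le> C * jw (- N) x" using schwartz_bound[OF g] by blast
  have "norm (g (t - x)) \<le> (C * 2 powr N) * jw (- N) x * jw N t" for t x
  proof -
    have "norm (g (t - x)) \<le> C * jw (- N) (- x + t)" using C(2)[of "t - x"] by simp
    also have "\<dots> \<le> C * (2 powr \<bar>- N\<bar> * jw (- N) (- x) * jw \<bar>- N\<bar> t)"
      using C by (intro mult_left_mono japanese_powr_ge) auto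
    finally show ?thesis using N by (simp add: mult_ac)
  qed
  then show ?thesis using that[of "C * 2 powr N"] C by auto
qed

lemma V_decay_x:
  fixes f g :: "real^'n \<Rightarrow> complex"
  assumes f: "f \<in> schwartz" and g: "g \<in> schwartz" and N: "N \<ge> 0"
  shows "\<exists>C>0. \<forall>x \<xi>. norm (V g f (x, \<xi>)) \<le> C * jw (- N) x"
proof -
  obtain C where C: "C > 0" "\<And>t x. norm (g (t - x)) \<le> C * jw (- N) x * jw N t" using window_bound[OF g N] by blast
  define K where "K = (LINT t|lborel. jw N t * norm (f t))"
  have K: "K \<ge> 0" unfolding K_def by (rule integral_nonneg_AE) simp
  have "norm (V g f (x, \<xi>)) \<le> (C * (K + 1)) * jw (- N) x" for x \<xi>
  proof -
    have "norm (V g f (x, \<xi>)) \<le> (LINT t|lborel. norm (f t * (cnj (g (t - x)) * cis (- 2 * pi * (\<xi> \<bullet> t)))))"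
      using integral_norm_bound unfolding V_def fst_conv snd_conv .
    also have "\<dots> \<le> (LINT t|lborel. (C * jw (- N) x) * (jw N t * norm (f t)))"
    proof (rule integral_mono')
      show "integrable lborel (\<lambda>t. (C * jw (- N) x) * (jw N t * norm (f t)))"
        by (intro integrable_mult_right schwartz_integrable_weight f)
      fix t
      have "norm (f t) * norm (g (t - x)) \<le> norm (f t) * (C * jw (- N) x * jw N t)" by (intro mult_left_mono C) simp
      then show "norm (f t * (cnj (g (t - x)) * cis (- 2 * pi * (\<xi> \<bullet> t)))) \<le> (C * jw (- N) x) * (jw N t * norm (f t))"
        by (simp add: norm_mult mult_ac)
    qed (use C in auto)
    also have "\<dots> = (C * jw (- N) x) * K" by (simp add: K_def)
    also have "\<dots> \<le> (C * jw (- N) x) * (K + 1)" using C by (intro mult_left_mono) auto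
    finally show ?thesis by (simp add: mult_ac)
  qed
  then show ?thesis using C K by (intro exI[of _ "C * (K + 1)"]) auto
qed

text \<open>Decay in x comes from the window, decay in \<xi> from the rotated transform. The
  geometric mean combines the two bounds, which is why each of them starts from twice the
  exponent.\<close>

lemma V_decay:
  fixes f g :: "real^'n \<Rightarrow> complex"
  assumes f: "f \<in> schwartz" and g: "g \<in> schwartz" and N: "N \<ge> 0"
  shows "\<exists>C>0. \<forall>x \<xi>. norm (V g f (x, \<xi>)) \<le> C * (jw (- N) x * jw (- N) \<xi>)"
proof -
  obtain C where C: "C > 0" "\<And>x \<xi>. norm (V g f (x, \<xi>)) \<le> C * jw (- (2 * N)) x"
    using V_decay_x[OF f g, of "2 * N"] N by auto
  obtain D where D: "D > 0" "\<And>x \<xi>. norm (V (fourier g) (fourier f) (\<xi>, - x)) \<le> D * jw (- (2 * N)) \<xi>"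
    using V_decay_x[OF fourier_schwartz[OF f] fourier_schwartz[OF g], of "2 * N"] N by auto
  have "norm (V g f (x, \<xi>)) \<le> sqrt (C * D) * (jw (- N) x * jw (- N) \<xi>)" for x \<xi>
  proof (rule power2_le_imp_le)
    have sq: "(jw (- N) y)\<^sup>2 = jw (- (2 * N)) y" for y :: "real^'n" by (simp add: power2_eq_square flip: powr_add)
    have "(norm (V g f (x, \<xi>)))\<^sup>2 \<le> (C * jw (- (2 * N)) x) * (D * jw (- (2 * N)) \<xi>)"
      unfolding power2_eq_square
      using C(1) mult_mono[OF C(2)[of x \<xi>] ord_eq_le_trans[OF norm_V_fourier[OF f g] D(2)[of \<xi> x]]] by simp
    also have "\<dots> = (sqrt (C * D) * (jw (- N) x * jw (- N) \<xi>))\<^sup>2"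
      using C D by (simp add: power_mult_distrib sq mult_ac)
    finally show "(norm (V g f (x, \<xi>)))\<^sup>2 \<le> (sqrt (C * D) * (jw (- N) x * jw (- N) \<xi>))\<^sup>2" .
  qed (use C D in auto)
  then show ?thesis using C D by (intro exI[of _ "sqrt (C * D)"]) auto
qed

lemma fst_snd_borel [measurable]:
  "fst \<in> borel_measurable (borel :: ('a::second_countable_topology \<times> 'b::second_countable_topology) measure)"
  "snd \<in> borel_measurable (borel :: ('a::second_countable_topology \<times> 'b::second_countable_topology) measure)"
  by (auto intro!: borel_measurable_continuous_onI continuous_intros)

lemma V_measurable:
  fixes f g :: "real^'n \<Rightarrow> complex"
  assumes [measurable]: "f \<in> borel_measurable borel" and g: "g \<in> schwartz"
  shows "V g f \<in> borel_measurable borel"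
proof -
  note [measurable] = schwartz_measurable[OF g]
  show ?thesis unfolding V_def[abs_def] by measurable
qed

lemma nn_integral_pair:
  fixes F :: "'a::euclidean_space \<times> 'b::euclidean_space \<Rightarrow> ennreal"
  assumes "F \<in> borel_measurable borel"
  shows "(\<integral>\<^sup>+z. F z \<partial>lborel) = (\<integral>\<^sup>+x. \<integral>\<^sup>+y. F (x, y) \<partial>lborel \<partial>lborel)"
  using lborel.nn_integral_fst[of F lborel] assms by (simp add: lborel_prod)

lemma V_L1:
  fixes f g :: "real^'n \<Rightarrow> complex"
  assumes f: "f \<in> schwartz" and g: "g \<in> schwartz"
  shows "(\<integral>\<^sup>+z. ennreal (norm (V g f z)) \<partial>lborel) < \<infinity>"
proof -
  let ?N = "2 * real DIM(real^'n)"
  obtain C where C: "C > 0" "\<And>x \<xi>. norm (V g f (x, \<xi>)) \<le> C * (jw (- ?N) x * jw (- ?N) \<xi>)"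
    using V_decay[OF f g, of ?N] by auto
  have "integrable (lborel \<Otimes>\<^sub>M lborel) (V g f)"
    by (rule integrable_pair_bound[OF V_measurable[OF schwartz_measurable[OF f] g], of "\<lambda>x. C * jw (- ?N) x" "jw (- ?N)"])
       (use C in \<open>auto intro!: integrable_mult_right integrable_japanese simp: mult_ac\<close>)
  then show ?thesis by (simp add: integrable_iff_bounded lborel_prod)
qed

text \<open>Plancherel in the frequency variable for fixed x, followed by Tonelli; the integral over
  the position of the window splits off its norm.\<close>

lemma V_L2:
  fixes f g :: "real^'n \<Rightarrow> complex"
  assumes f: "f \<in> schwartz" and g: "g \<in> schwartz"
  shows "(\<integral>\<^sup>+z. ennreal ((norm (V g f z))\<^sup>2) \<partial>lborel) = ennreal ((LINT t|lborel. (norm (f t))\<^sup>2) * (LINT t|lborel. (norm (g t))\<^sup>2))"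
proof -
  note [measurable] = schwartz_measurable[OF f] schwartz_measurable[OF g] V_measurable[OF schwartz_measurable[OF f] g]
  have k: "(\<lambda>t. f t * cnj (g (t - x))) \<in> schwartz" for x
    by (intro schwartz_mult schwartz_cnj schwartz_shift f g)
  have sq: "(\<integral>\<^sup>+t. ennreal ((norm (k t))\<^sup>2) \<partial>lborel) = ennreal (LINT t|lborel. (norm (k t))\<^sup>2)"
    if "k \<in> schwartz" for k :: "real^'n \<Rightarrow> complex"
    using that by (intro nn_integral_eq_integral schwartz_integrable_sq) auto
  have "(\<integral>\<^sup>+z. ennreal ((norm (V g f z))\<^sup>2) \<partial>lborel) = (\<integral>\<^sup>+x. \<integral>\<^sup>+\<xi>. ennreal ((norm (V g f (x, \<xi>)))\<^sup>2) \<partial>lborel \<partial>lborel)"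
    by (rule nn_integral_pair) measurable
  also have "\<dots> = (\<integral>\<^sup>+x. \<integral>\<^sup>+t. ennreal ((norm (f t * cnj (g (t - x))))\<^sup>2) \<partial>lborel \<partial>lborel)"
    unfolding V_eq_fourier sq[OF fourier_schwartz[OF k]] sq[OF k] plancherel[OF k] ..
  also have "\<dots> = (\<integral>\<^sup>+t. \<integral>\<^sup>+x. ennreal ((norm (f t * cnj (g (t - x))))\<^sup>2) \<partial>lborel \<partial>lborel)"
    by (rule lborel_pair.Fubini') (simp add: lborel_prod case_prod_beta', measurable)
  also have "\<dots> = (\<integral>\<^sup>+t. ennreal ((norm (f t))\<^sup>2) * ennreal (LINT t|lborel. (norm (g t))\<^sup>2) \<partial>lborel)"
  proof (rule nn_integral_cong)
    fix t
    have "(\<integral>\<^sup>+x. ennreal ((norm (g (t - x)))\<^sup>2) \<partial>lborel) = (\<integral>\<^sup>+x. ennreal ((norm (g x))\<^sup>2) \<partial>lborel)"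
      using nn_integral_affine[of "\<lambda>x. ennreal ((norm (g x))\<^sup>2)" "- 1" t] by simp
    then show "(\<integral>\<^sup>+x. ennreal ((norm (f t * cnj (g (t - x))))\<^sup>2) \<partial>lborel) = ennreal ((norm (f t))\<^sup>2) * ennreal (LINT t|lborel. (norm (g t))\<^sup>2)"
      by (simp add: norm_mult power_mult_distrib ennreal_mult nn_integral_cmult sq[OF g])
  qed
  also have "\<dots> = ennreal ((LINT t|lborel. (norm (f t))\<^sup>2) * (LINT t|lborel. (norm (g t))\<^sup>2))"
    by (simp add: nn_integral_multc sq[OF f] ennreal_mult)
  finally show ?thesis .
qed

text \<open>Parseval in the frequency variable, followed by integration in \<open>x\<close>, gives the inversion
  formula for the short-time Fourier transform in weak form.\<close>

lemma V_duality:
  fixes F H g :: "real^'n \<Rightarrow> complex"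
  assumes [measurable]: "F \<in> borel_measurable borel" and F: "\<And>t. norm (F t) \<le> B * jw M t"
    and H: "H \<in> schwartz" and g: "g \<in> schwartz"
  shows "ennreal ((LINT t|lborel. (norm (g t))\<^sup>2) * norm (LINT t|lborel. F t * cnj (H t)))
    \<le> (\<integral>\<^sup>+z. ennreal (norm (V g F z) * norm (V g H z)) \<partial>lborel)"
proof -
  note [measurable] = schwartz_measurable[OF H] schwartz_measurable[OF g]
    V_measurable[OF _ g, of F] V_measurable[OF schwartz_measurable[OF H] g]
  let ?N = "2 * real DIM(real^'n)"
  obtain C where C: "C > 0" "\<And>t x. norm (g (t - x)) \<le> C * jw (- ?N) x * jw ?N t"
    using window_bound[OF g, of ?N] by auto
  obtain C0 where C0: "C0 > 0" "\<And>t. norm (g t) \<le> C0 * jw 0 t" using schwartz_bound[OF g] by blast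
  have B: "B \<ge> 0" using order_trans[OF norm_ge_zero F[of 0]] by (simp add: zero_le_mult_iff)
  let ?k = "\<lambda>x t. F t * cnj (H t) * of_real ((norm (g (t - x)))\<^sup>2)"
  let ?b = "\<lambda>t. (B * C * C0) * (jw (M + ?N) t * norm (H t))"
  \<comment> \<open>One of the two window factors pays for integrability in x, the other is merely
    bounded; the powers of the bracket in t are absorbed by \<open>H\<close>.\<close>
  have kb: "norm (?k x t) \<le> jw (- ?N) x * ?b t" for x t
  proof -
    have "norm (?k x t) = (norm (F t) * norm (H t)) * (norm (g (t - x)) * norm (g (t - x)))"
      by (simp add: norm_mult power2_eq_square)
    also have "\<dots> \<le> ((B * jw M t) * norm (H t)) * ((C * jw (- ?N) x * jw ?N t) * C0)"
      using C C0(2)[of "t - x"] F[of t] B by (intro mult_mono mult_right_mono) auto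
    also have "\<dots> = jw (- ?N) x * ?b t" by (simp add: powr_add mult_ac)
    finally show ?thesis .
  qed
  have ib: "integrable lborel ?b" by (intro integrable_mult_right schwartz_integrable_weight H)
  have ia: "integrable lborel (jw (- ?N) :: real^'n \<Rightarrow> real)" by (rule integrable_japanese) simp
  have swap: "(LINT x|lborel. LINT t|lborel. ?k x t) = (LINT t|lborel. LINT x|lborel. ?k x t)"
    by (rule fubini_bound[OF _ ia ib kb]) measurable
  have "(LINT x|lborel. ?k x t) = F t * cnj (H t) * of_real (LINT t|lborel. (norm (g t))\<^sup>2)" for t
  proof -
    have "(LINT x|lborel. (norm (g (t - x)))\<^sup>2) = (LINT x|lborel. (norm (g x))\<^sup>2)"
      using integral_affine[of "\<lambda>x. (norm (g x))\<^sup>2" "- 1" t] by simp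
    then show ?thesis by (simp only: integral_mult_right_zero integral_complex_of_real)
  qed
  then have eq: "(LINT x|lborel. LINT t|lborel. ?k x t) = (LINT t|lborel. F t * cnj (H t)) * of_real (LINT t|lborel. (norm (g t))\<^sup>2)"
    unfolding swap by (simp only: integral_mult_left_zero)
  \<comment> \<open>A non-integrable function has integral 0 by convention, so the inequality holds
    in that case as well.\<close>
  have norm_le: "ennreal (norm (LINT x|lborel. f x)) \<le> (\<integral>\<^sup>+x. ennreal (norm (f x)) \<partial>lborel)" for f :: "real^'n \<Rightarrow> complex"
    by (cases "integrable lborel f") (auto intro: integral_norm_bound_ennreal simp: not_integrable_integral_eq)
  have "ennreal ((LINT t|lborel. (norm (g t))\<^sup>2) * norm (LINT t|lborel. F t * cnj (H t))) = ennreal (norm (LINT x|lborel. LINT t|lborel. ?k x t))"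
    unfolding eq by (simp add: norm_mult mult.commute integral_nonneg_AE)
  also have "\<dots> \<le> (\<integral>\<^sup>+x. ennreal (norm (LINT t|lborel. ?k x t)) \<partial>lborel)" by (rule norm_le)
  also have "\<dots> \<le> (\<integral>\<^sup>+x. \<integral>\<^sup>+\<xi>. ennreal (norm (V g F (x, \<xi>)) * norm (V g H (x, \<xi>))) \<partial>lborel \<partial>lborel)"
  proof (rule nn_integral_mono)
    fix x :: "real^'n"
    have h: "(\<lambda>t. H t * cnj (g (t - x))) \<in> schwartz"
      by (intro schwartz_mult schwartz_cnj schwartz_shift H g)
    have f: "integrable lborel (\<lambda>t. F t * cnj (g (t - x)))"
    proof (rule Bochner_Integration.integrable_bound)
      show "integrable lborel (\<lambda>t. B * (jw M t * norm (g (t - x))))"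
        using schwartz_integrable_weight[OF schwartz_shift[OF g]] by (intro integrable_mult_right)
      show "AE t in lborel. norm (F t * cnj (g (t - x))) \<le> norm (B * (jw M t * norm (g (t - x))))"
        using F B by (intro AE_I2) (simp add: norm_mult mult_right_mono flip: mult.assoc)
    qed measurable
    have "(LINT t|lborel. ?k x t) = (LINT t|lborel. (F t * cnj (g (t - x))) * cnj (H t * cnj (g (t - x))))"
      by (rule Bochner_Integration.integral_cong[OF refl]) (simp add: complex_norm_square mult_ac del: of_real_power)
    also have "\<dots> = (LINT \<xi>|lborel. V g F (x, \<xi>) * cnj (V g H (x, \<xi>)))"
      unfolding V_eq_fourier by (rule parseval[OF f h])
    finally have "ennreal (norm (LINT t|lborel. ?k x t)) = ennreal (norm (LINT \<xi>|lborel. V g F (x, \<xi>) * cnj (V g H (x, \<xi>))))"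
      by (simp only:)
    also have "\<dots> \<le> (\<integral>\<^sup>+\<xi>. ennreal (norm (V g F (x, \<xi>) * cnj (V g H (x, \<xi>)))) \<partial>lborel)" by (rule norm_le)
    finally show "ennreal (norm (LINT t|lborel. ?k x t)) \<le> (\<integral>\<^sup>+\<xi>. ennreal (norm (V g F (x, \<xi>)) * norm (V g H (x, \<xi>))) \<partial>lborel)"
      by (simp add: norm_mult)
  qed
  also have "\<dots> = (\<integral>\<^sup>+z. ennreal (norm (V g F z) * norm (V g H z)) \<partial>lborel)"
    by (rule nn_integral_pair[symmetric]) measurable
  finally show ?thesis .
qed


section \<open>Boundedness on modulation spaces\<close>

lemma distr_of_tempered:
  assumes f: "f \<in> schwartz" shows "distr_of f \<in> tempered"
proof -
  have int: "integrable lborel (\<lambda>t. f t * \<phi> t)" if "\<phi> \<in> schwartz" for \<phi>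
    by (intro schwartz_integrable schwartz_mult f that)
  have add: "(\<lambda>t. \<phi> t + \<psi> t) \<in> schwartz" if "\<phi> \<in> schwartz" "\<psi> \<in> schwartz" for \<phi> \<psi> :: "real^'a \<Rightarrow> complex"
    using that by (simp add: schwartz_iff jw.symb_add)
  have "norm (distr_of f \<phi>) \<le> (LINT t|lborel. norm (f t)) * schwartz_seminorm 0 \<phi>" if \<phi>: "\<phi> \<in> schwartz" for \<phi>
  proof -
    have "schwartz_seminorm 0 \<phi> = (SUP x. norm (\<phi> x))"
      by (simp add: schwartz_seminorm_def multi_deriv_def iter_deriv_def)
    moreover have "bdd_above (range (\<lambda>x. norm (\<phi> x)))"
    proof -
      obtain C where "\<And>x. norm (\<phi> x) \<le> C * jw 0 x" using schwartz_bound[OF \<phi>] by blast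
      then show ?thesis by (intro bdd_aboveI[of _ C]) auto
    qed
    ultimately have sup: "norm (\<phi> x) \<le> schwartz_seminorm 0 \<phi>" for x
      by (auto intro: cSUP_upper)
    have "norm (LINT t|lborel. f t * \<phi> t) \<le> (LINT t|lborel. norm (f t * \<phi> t))" by (rule integral_norm_bound)
    also have "\<dots> \<le> (LINT t|lborel. norm (f t) * schwartz_seminorm 0 \<phi>)"
      by (rule integral_mono)
         (auto simp: norm_mult intro!: mult_left_mono sup integrable_mult_left schwartz_integrable_norm f schwartz_mult \<phi>
           integrable_norm[OF int, simplified norm_mult])
    finally show ?thesis using \<phi> by (simp add: distr_of_def)
  qed
  then have "\<exists>C k. \<forall>\<phi>\<in>schwartz. norm (distr_of f \<phi>) \<le> C * schwartz_seminorm k \<phi>" by blast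
  then show ?thesis
    unfolding tempered_def by (auto simp: distr_of_def add schwartz_cmult distrib_left int mult.left_commute)
qed

lemma V_Lp_finite:
  fixes f g :: "real^'n \<Rightarrow> complex"
  assumes f: "f \<in> schwartz" and g: "g \<in> schwartz" and p: "1 \<le> p"
  shows "Lp_norm p lborel (V g f) < \<infinity>"
proof -
  obtain C where C: "C > 0" "\<And>x. norm (f x) \<le> C * jw 0 x" using schwartz_bound[OF f] by blast
  define S where "S = C * (LINT t|lborel. norm (g t)) + 1"
  have S: "S > 0" "norm (V g f z) \<le> S" for z
  proof -
    have "0 \<le> (LINT t|lborel. norm (g t))" by (rule integral_nonneg_AE) simp
    then show "S > 0" "norm (V g f z) \<le> S"
      using V_sup[OF g, of f C z] C by (auto simp: S_def add_nonneg_pos)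
  qed
  define L where "L = enn2real (\<integral>\<^sup>+z. ennreal (norm (V g f z)) \<partial>lborel) + 1"
  have L: "L > 0" by (simp add: L_def add_nonneg_pos)
  have "(\<integral>\<^sup>+z. ennreal (norm (V g f z)) \<partial>lborel) = ennreal (L - 1)"
    using V_L1[OF f g] by (simp add: L_def)
  also have "\<dots> \<le> ennreal L" by (rule ennreal_leI) simp
  finally have "(\<integral>\<^sup>+z. ennreal (norm (V g f z) powr 1) \<partial>lborel) \<le> ennreal L" by simp
  from Lp_norm_interpolate[OF p _ _ _ S L this]
  show ?thesis using p V_measurable[OF schwartz_measurable[OF f] g] by (auto simp: le_less_trans[OF _ ennreal_less_top])
qed

text \<open>Schwartz functions lie in every space in question; in the closure they approximate
  themselves with error zero. An extension therefore restricts to an a priori estimate for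
  \<open>A\<close> on them.\<close>

lemma bounded_operator_imp_bound:
  fixes g :: "real^'n \<Rightarrow> complex"
  assumes g: "g \<in> schwartz" and p: "1 \<le> p"
    and ext: "extends_to_bounded_operator A X (mod_norm g p)"
    and X: "X = mod_space g p \<or> X = mod_space_tilde_inf g \<and> p = \<infinity>"
  shows "\<exists>C\<ge>0. \<forall>f\<in>schwartz. Lp_norm p lborel (V g (A f)) \<le> ennreal C * Lp_norm p lborel (V g f)"
proof -
  obtain T C where C: "\<And>u. u \<in> X \<Longrightarrow> mod_norm g p (T u) \<le> ennreal C * mod_norm g p u"
    and T: "\<And>f. f \<in> schwartz \<Longrightarrow> T (distr_of f) = distr_of (A f)"
    using ext unfolding extends_to_bounded_operator_def by blast
  have "Lp_norm p lborel (V g (A f)) \<le> ennreal C * Lp_norm p lborel (V g f)" if f: "f \<in> schwartz" for f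
  proof -
    have 1: "distr_of f \<in> mod_space g q" if "1 \<le> q" for q
      using distr_of_tempered[OF f] V_Lp_finite[OF f g that]
      by (simp add: mod_space_def mod_norm_def stft_distr_of[OF g])
    have 2: "distr_of f \<in> mod_space_tilde_inf g"
    proof -
      have "mod_norm g \<infinity> (\<lambda>\<phi>. distr_of f \<phi> - distr_of f \<phi>) = 0"
        by (simp add: mod_norm_def Lp_norm_def stft_def case_prod_unfold esssup_const)
      then show ?thesis using 1[of \<infinity>] f unfolding mod_space_tilde_inf_def
        by (auto intro!: bexI[of _ f])
    qed
    have "distr_of f \<in> X" using X 1[OF p] 2 by auto
    from C[OF this] show ?thesis
      unfolding T[OF f] mod_norm_def stft_distr_of[OF g] .
  qed
  \<comment> \<open>The constant of a bounded operator is an arbitrary real number, and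
    \<open>ennreal\<close> sends negative ones to 0.\<close>
  moreover have "ennreal C \<le> ennreal (max C 0)" by (rule ennreal_leI) simp
  ultimately have "\<forall>f\<in>schwartz. Lp_norm p lborel (V g (A f)) \<le> ennreal (max C 0) * Lp_norm p lborel (V g f)"
    by (meson mult_right_mono order_trans zero_le)
  then show ?thesis by (intro exI[of _ "max C 0"]) auto
qed

text \<open>A vanishing integral would make the set where \<open>h\<close> is non-zero an open null
  set, hence empty.\<close>

lemma integral_pos_continuous:
  fixes h :: "'a::euclidean_space \<Rightarrow> real"
  assumes "integrable lborel h" "continuous_on UNIV h" "\<And>x. 0 \<le> h x" "h x0 \<noteq> 0"
  shows "(LINT x|lborel. h x) > 0"
proof -
  have "(LINT x|lborel. h x) \<noteq> 0"
  proof
    assume "(LINT x|lborel. h x) = 0"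
    then have "AE x in lborel. \<not> h x \<noteq> 0"
      using assms by (subst (asm) integral_nonneg_eq_0_iff_AE) auto
    moreover have op: "open {x. h x \<noteq> 0}"
      using assms(2) by (intro open_Collect_neq) auto
    ultimately have "{x. h x \<noteq> 0} \<in> null_sets lborel"
      using AE_iff_null_sets[of "{x. h x \<noteq> 0}" lborel] by auto
    then have "negligible {x. h x \<noteq> 0}"
      by (auto simp: negligible_iff_null_sets intro: null_sets_completionI)
    then have "{x. h x \<noteq> 0} = {}" using op open_not_negligible by blast
    then show False using assms(4) by auto
  qed
  moreover have "(LINT x|lborel. h x) \<ge> 0" using assms(3) by (intro integral_nonneg_AE) simp
  ultimately show ?thesis by simp
qed

text \<open>The estimate is tested against \<open>h\<close>: \<open>V_duality\<close> bounds the
  pairing by an integral over phase space, at the cost of the squared norm \<open>G\<close> of the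
  window, and Hoelder's inequality separates the two factors. Polynomial growth of
  \<open>A f\<close> is all that is assumed of the image besides measurability.\<close>

lemma bounded_operator_imp_pairing_bound:
  fixes g :: "real^'n \<Rightarrow> complex"
  assumes g: "g \<in> schwartz" "g \<noteq> (\<lambda>t. 0)"
    and p: "1 \<le> p" "1 \<le> p'" "enn2real (1 / p) + enn2real (1 / p') = 1"
    and ext: "extends_to_bounded_operator A X (mod_norm g p)"
    and X: "X = mod_space g p \<or> X = mod_space_tilde_inf g \<and> p = \<infinity>"
  obtains K where "K \<ge> 0" "\<And>f h a b. f \<in> schwartz \<Longrightarrow> h \<in> schwartz \<Longrightarrow> 0 \<le> a \<Longrightarrow> 0 \<le> b \<Longrightarrow>
    A f \<in> borel_measurable borel \<Longrightarrow> \<exists>B M. \<forall>x. norm (A f x) \<le> B * jw M x \<Longrightarrow>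
    Lp_norm p lborel (V g f) \<le> ennreal a \<Longrightarrow> Lp_norm p' lborel (V g h) \<le> ennreal b \<Longrightarrow>
    norm (LINT t|lborel. A f t * cnj (h t)) \<le> K * a * b"
proof -
  obtain C where C: "C \<ge> 0" "\<And>f. f \<in> schwartz \<Longrightarrow> Lp_norm p lborel (V g (A f)) \<le> ennreal C * Lp_norm p lborel (V g f)"
    using bounded_operator_imp_bound[OF g(1) p(1) ext X] by auto
  define G where "G = (LINT t|lborel. (norm (g t))\<^sup>2)"
  obtain t0 where "g t0 \<noteq> 0" using g(2) by auto
  then have G: "G > 0"
    unfolding G_def
    by (intro integral_pos_continuous[of _ t0] schwartz_integrable_sq g continuous_intros schwartz_continuous) auto
  show thesis
  proof (rule that[of "C / G"])
    fix f h a b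
    assume f: "f \<in> schwartz" and h: "h \<in> schwartz" and ab: "(0::real) \<le> a" "(0::real) \<le> b"
      and meas: "A f \<in> borel_measurable borel" and "\<exists>B M. \<forall>x. norm (A f x) \<le> B * jw M x"
      and a: "Lp_norm p lborel (V g f) \<le> ennreal a" and b: "Lp_norm p' lborel (V g h) \<le> ennreal b"
    then obtain B M where B: "\<And>x. norm (A f x) \<le> B * jw M x" by blast
    have Af: "Lp_norm p lborel (V g (A f)) \<le> ennreal (C * a)"
      using order_trans[OF C(2)[OF f] mult_left_mono[OF a, of "ennreal C"]] C(1) ab by (simp add: ennreal_mult)
    have "ennreal (G * norm (LINT t|lborel. A f t * cnj (h t))) \<le> (\<integral>\<^sup>+z. ennreal (norm (V g (A f) z) * norm (V g h z)) \<partial>lborel)"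
      unfolding G_def by (rule V_duality[OF meas B h g(1)])
    also have "\<dots> \<le> Lp_norm p lborel (V g (A f)) * Lp_norm p' lborel (V g h)"
      by (rule Lp_norm_Hoelder[OF p])
         (use Af b V_measurable[OF meas g(1)] V_measurable[OF schwartz_measurable[OF h] g(1)] in
           \<open>auto intro: le_less_trans[OF _ ennreal_less_top]\<close>)
    also have "\<dots> \<le> ennreal (C * a) * ennreal b" by (intro mult_mono Af b) auto
    also have "\<dots> = ennreal (C * a * b)" using ab C(1) by (simp add: ennreal_mult)
    finally have "G * norm (LINT t|lborel. A f t * cnj (h t)) \<le> C * a * b"
      using ab C(1) by (subst (asm) ennreal_le_iff) auto
    then show "norm (LINT t|lborel. A f t * cnj (h t)) \<le> C / G * a * b"
      using G by (simp add: field_simps)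
  qed (use C G in auto)
qed

section \<open>Modulation norms of test functions\<close>

text \<open>A Schwartz function \<open>K\<close> is used either conjugated, as the function paired with \<open>A f\<close>,
  or as the Fourier transform of \<open>f\<close>; \<open>norms_le\<close> covers both uses.\<close>

definition norms_le :: "(real^'n \<Rightarrow> complex) \<Rightarrow> ennreal \<Rightarrow> (real^'n \<Rightarrow> complex) \<Rightarrow> real \<Rightarrow> bool" where
  "norms_le g q K b \<longleftrightarrow> Lp_norm q lborel (V g (\<lambda>t. cnj (K t))) \<le> ennreal b \<and>
     (\<forall>f\<in>schwartz. fourier f = K \<longrightarrow> Lp_norm q lborel (V g f) \<le> ennreal b)"

text \<open>The point is that the constant is independent of the centre (a, b), which later moves
  with n. It comes from interpolating between the supremum \<open>C\<close> and the
  translation-invariant integral of the majorant.\<close>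

lemma Lp_norm_decay:
  assumes q: "1 \<le> q" and C: "C > 0"
  shows "\<exists>K>0. \<forall>(F :: (real^'n) \<times> (real^'n) \<Rightarrow> complex) a b. F \<in> borel_measurable borel \<longrightarrow>
    (\<forall>x \<xi>. norm (F (x, \<xi>)) \<le> C * (jw (- (2 * real CARD('n))) (x - a) * jw (- (2 * real CARD('n))) (\<xi> - b))) \<longrightarrow>
    Lp_norm q lborel F \<le> ennreal K"
proof -
  define j where "j = (jw (- (2 * real CARD('n))) :: real^'n \<Rightarrow> real)"
  have [measurable]: "j \<in> borel_measurable borel" unfolding j_def by measurable
  have j: "integrable lborel j" unfolding j_def by (rule integrable_japanese) simp
  have j0: "0 \<le> j x" and j1: "j x \<le> 1" for x
    using powr_mono_japanese[of "- (2 * real CARD('n))" 0 x] by (simp_all add: j_def)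
  define I where "I = (LINT x|lborel. j x)"
  have I: "I \<ge> 0" unfolding I_def by (rule integral_nonneg_AE) (simp add: j0)
  have jI: "(\<integral>\<^sup>+x. ennreal (j (x - a)) \<partial>lborel) = ennreal I" for a
    using nn_integral_shift[of "\<lambda>x. ennreal (j x)" "- a"] nn_integral_eq_integral[OF j]
    by (simp add: I_def j0)
  have "Lp_norm q lborel F \<le> ennreal (C powr (1 - 1 * enn2real (1 / q)) * (C * I * I + 1) powr enn2real (1 / q))"
    if [measurable]: "F \<in> borel_measurable borel" and F: "\<And>x \<xi>. norm (F (x, \<xi>)) \<le> C * (j (x - a) * j (\<xi> - b))"
    for F :: "(real^'n) \<times> (real^'n) \<Rightarrow> complex" and a b
  proof (rule Lp_norm_interpolate[OF q])
    show "norm (F z) \<le> C" for z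
    proof -
      have "j (fst z - a) * j (snd z - b) \<le> 1 * 1" by (intro mult_mono j1) (auto simp: j0)
      then have "C * (j (fst z - a) * j (snd z - b)) \<le> C * 1" using C by (intro mult_left_mono) auto
      with F[of "fst z" "snd z"] show ?thesis by simp
    qed
    have "(\<integral>\<^sup>+z. ennreal (norm (F z) powr 1) \<partial>lborel) = (\<integral>\<^sup>+x. \<integral>\<^sup>+\<xi>. ennreal (norm (F (x, \<xi>))) \<partial>lborel \<partial>lborel)"
      by (subst nn_integral_pair) auto
    also have "\<dots> \<le> (\<integral>\<^sup>+x. \<integral>\<^sup>+\<xi>. ennreal C * (ennreal (j (x - a)) * ennreal (j (\<xi> - b))) \<partial>lborel \<partial>lborel)"
      using F C by (intro nn_integral_mono) (simp add: ennreal_leI j0 flip: ennreal_mult)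
    also have "\<dots> = ennreal (C * I * I)"
      using C I by (simp add: nn_integral_cmult nn_integral_multc jI ennreal_mult mult_ac)
    also have "\<dots> \<le> ennreal (C * I * I + 1)" by (rule ennreal_leI) simp
    finally show "(\<integral>\<^sup>+z. ennreal (norm (F z) powr 1) \<partial>lborel) \<le> ennreal (C * I * I + 1)" .
    show "0 < C * I * I + 1" using C I by (intro add_nonneg_pos) auto
  qed (use q C in auto)
  moreover have "C powr (1 - 1 * enn2real (1 / q)) * (C * I * I + 1) powr enn2real (1 / q) > 0"
    using C I by (intro mult_pos_pos) (auto simp: add_nonneg_pos less_imp_neq[symmetric] powr_gt_zero)
  ultimately show ?thesis unfolding j_def by blast
qed

text \<open>Covariance: substituting t + b for t moves translation and modulation into the arguments
  of \<open>V\<close>, leaving a phase that depends on b but not on t.\<close>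

lemma norm_V_shift_modulate:
  fixes k g :: "real^'n \<Rightarrow> complex"
  assumes k: "k \<in> schwartz" and g: "g \<in> schwartz"
  shows "norm (V g (\<lambda>t. cis (2 * pi * (a \<bullet> t)) * k (t - b)) (x, \<xi>)) = norm (V g k (x - b, \<xi> - a))"
proof -
  note [measurable] = schwartz_measurable[OF k] schwartz_measurable[OF g]
  have "V g (\<lambda>t. cis (2 * pi * (a \<bullet> t)) * k (t - b)) (x, \<xi>)
    = (LINT t|lborel. cis (2 * pi * (a \<bullet> (t + b))) * k (t + b - b) * (cnj (g (t + b - x)) * cis (- 2 * pi * (\<xi> \<bullet> (t + b)))))"
    unfolding V_def fst_conv snd_conv by (rule integral_shift(1)[symmetric]) measurable
  also have "\<dots> = (LINT t|lborel. cis (2 * pi * ((a - \<xi>) \<bullet> b)) * (k t * (cnj (g (t - (x - b))) * cis (- 2 * pi * ((\<xi> - a) \<bullet> t)))))"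
  proof (rule Bochner_Integration.integral_cong[OF refl])
    fix t
    have c: "cis (2 * pi * (a \<bullet> (t + b))) * cis (- 2 * pi * (\<xi> \<bullet> (t + b))) = cis (2 * pi * ((a - \<xi>) \<bullet> b)) * cis (- 2 * pi * ((\<xi> - a) \<bullet> t))"
      unfolding cis_mult by (rule arg_cong[where f=cis]) (simp add: inner_simps algebra_simps)
    have "cis (2 * pi * (a \<bullet> (t + b))) * k (t + b - b) * (cnj (g (t + b - x)) * cis (- 2 * pi * (\<xi> \<bullet> (t + b))))
      = (cis (2 * pi * (a \<bullet> (t + b))) * cis (- 2 * pi * (\<xi> \<bullet> (t + b)))) * (k t * cnj (g (t - (x - b))))"
      by (simp add: algebra_simps)
    then show "cis (2 * pi * (a \<bullet> (t + b))) * k (t + b - b) * (cnj (g (t + b - x)) * cis (- 2 * pi * (\<xi> \<bullet> (t + b))))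
      = cis (2 * pi * ((a - \<xi>) \<bullet> b)) * (k t * (cnj (g (t - (x - b))) * cis (- 2 * pi * ((\<xi> - a) \<bullet> t))))"
      unfolding c by (simp only: mult_ac)
  qed
  also have "\<dots> = cis (2 * pi * ((a - \<xi>) \<bullet> b)) * V g k (x - b, \<xi> - a)"
    by (simp only: integral_mult_right_zero V_def fst_conv snd_conv)
  finally show ?thesis by (simp add: norm_mult)
qed

text \<open>Uniformity in a and b is the reason why the Gaussians moved by n contribute no power of
  n. The two summands of the constant belong to the two uses combined in
  \<open>norms_le\<close>.\<close>

lemma norms_le_const:
  fixes k g :: "real^'n \<Rightarrow> complex"
  assumes k: "k \<in> schwartz" and g: "g \<in> schwartz" and q: "1 \<le> q"
  shows "\<exists>K>0. \<forall>a b. norms_le g q (\<lambda>t. cis (2 * pi * (a \<bullet> t)) * k (t - b)) K"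
proof -
  let ?d = "2 * real CARD('n)"
  let ?k = "\<lambda>a b t. cis (2 * pi * (a \<bullet> t)) * k (t - b)"
  have ksch: "?k a b \<in> schwartz" for a b by (intro schwartz_modulate schwartz_shift k)
  obtain C where C: "C > 0" "\<And>x \<xi>. norm (V g (\<lambda>t. cnj (k t)) (x, \<xi>)) \<le> C * (jw (- ?d) x * jw (- ?d) \<xi>)"
    using V_decay[OF schwartz_cnj[OF k] g, of ?d] by auto
  obtain D where D: "D > 0" "\<And>x \<xi>. norm (V (fourier g) k (x, \<xi>)) \<le> D * (jw (- ?d) x * jw (- ?d) \<xi>)"
    using V_decay[OF k fourier_schwartz[OF g], of ?d] by auto
  obtain K1 where K1: "K1 > 0" "\<And>(F :: (real^'n) \<times> (real^'n) \<Rightarrow> complex) a b. F \<in> borel_measurable borel \<Longrightarrow>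
    (\<And>x \<xi>. norm (F (x, \<xi>)) \<le> C * (jw (- ?d) (x - a) * jw (- ?d) (\<xi> - b))) \<Longrightarrow> Lp_norm q lborel F \<le> ennreal K1"
    using Lp_norm_decay[OF q C(1), where 'n='n] by blast
  obtain K2 where K2: "K2 > 0" "\<And>(F :: (real^'n) \<times> (real^'n) \<Rightarrow> complex) a b. F \<in> borel_measurable borel \<Longrightarrow>
    (\<And>x \<xi>. norm (F (x, \<xi>)) \<le> D * (jw (- ?d) (x - a) * jw (- ?d) (\<xi> - b))) \<Longrightarrow> Lp_norm q lborel F \<le> ennreal K2"
    using Lp_norm_decay[OF q D(1), where 'n='n] by blast
  have "norms_le g q (?k a b) (K1 + K2)" for a b
    unfolding norms_le_def
  proof (intro conjI ballI impI)
    have eq: "(\<lambda>t. cnj (?k a b t)) = (\<lambda>t. cis (2 * pi * (- a \<bullet> t)) * cnj (k (t - b)))" by (auto simp: cis_cnj)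
    have "Lp_norm q lborel (V g (\<lambda>t. cnj (?k a b t))) \<le> ennreal K1"
    proof (rule K1(2))
      show "V g (\<lambda>t. cnj (?k a b t)) \<in> borel_measurable borel"
        by (intro V_measurable g schwartz_measurable schwartz_cnj ksch)
      show "norm (V g (\<lambda>t. cnj (?k a b t)) (x, \<xi>)) \<le> C * (jw (- ?d) (x - b) * jw (- ?d) (\<xi> - - a))" for x \<xi>
        unfolding eq norm_V_shift_modulate[OF schwartz_cnj[OF k] g] by (rule C)
    qed
    also have "\<dots> \<le> ennreal (K1 + K2)" using K2 by (intro ennreal_leI) simp
    finally show "Lp_norm q lborel (V g (\<lambda>t. cnj (?k a b t))) \<le> ennreal (K1 + K2)" .
  next
    fix f assume f: "f \<in> schwartz" "fourier f = ?k a b"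
    have "Lp_norm q lborel (V g f) \<le> ennreal K2"
    proof (rule K2(2))
      show "V g f \<in> borel_measurable borel"
        by (intro V_measurable g schwartz_measurable f)
      show "norm (V g f (x, \<xi>)) \<le> D * (jw (- ?d) (x - - a) * jw (- ?d) (\<xi> - b))" for x \<xi>
      proof -
        have "norm (V g f (x, \<xi>)) = norm (V (fourier g) k (\<xi> - b, - x - a))"
          unfolding norm_V_fourier[OF f(1) g] f(2) norm_V_shift_modulate[OF k fourier_schwartz[OF g]] ..
        also have "\<dots> \<le> D * (jw (- ?d) (\<xi> - b) * jw (- ?d) (- x - a))" by (rule D)
        also have "japanese (- x - a) = japanese (x - - a)" using japanese_minus[of "x + a"] by simp
        finally show ?thesis by (simp only: mult_ac)
      qed
    qed
    also have "\<dots> \<le> ennreal (K1 + K2)" using K1 by (intro ennreal_leI) simp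
    finally show "Lp_norm q lborel (V g f) \<le> ennreal (K1 + K2)" .
  qed
  then show ?thesis using K1 K2 by (intro exI[of _ "K1 + K2"]) auto
qed

lemma fourier_cnj: "fourier (\<lambda>t. cnj (k t)) \<xi> = cnj (fourier k (- \<xi>))"
  unfolding fourier_def by (simp add: cis_cnj flip: Bochner_Integration.integral_cnj)

text \<open>With the square integral bounded by \<open>L\<close>, interpolation starts from exponent
  2, so 1/q \<le> 1/2 is required and the supremum enters with power 1 - 2/q. Conjugation and
  inversion preserve the hypothesis that the function or its transform is small, so both uses in
  \<open>norms_le\<close> follow from one estimate.\<close>

lemma norms_le_small:
  fixes g :: "real^'n \<Rightarrow> complex"
  assumes g: "g \<in> schwartz" and q: "1 \<le> q" "enn2real (1 / q) \<le> 1 / 2" and L: "L \<ge> 0"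
  shows "\<exists>C>0. \<forall>K\<in>schwartz. \<forall>S>0. (LINT t|lborel. (norm (K t))\<^sup>2) \<le> L \<longrightarrow>
    (\<forall>t. norm (K t) \<le> S) \<or> (\<forall>t. norm (fourier K t) \<le> S) \<longrightarrow>
    norms_le g q K (C * S powr (1 - 2 * enn2real (1 / q)))"
proof -
  let ?t = "enn2real (1 / q)"
  \<comment> \<open>Both window norms enter because either the function or its transform may be the
    small one; the summand 1 keeps the constant positive.\<close>
  define G where "G = (LINT t|lborel. norm (g t)) + (LINT t|lborel. norm (fourier g t)) + 1"
  have nn: "0 \<le> (LINT t|lborel. norm (g t))" "0 \<le> (LINT t|lborel. norm (fourier g t))"
    by (rule integral_nonneg_AE, simp)+
  then have G: "G > 0" unfolding G_def by linarith
  define L' where "L' = L * (LINT t|lborel. (norm (g t))\<^sup>2) + 1"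
  have L': "L' > 0" unfolding L'_def using L by (intro add_nonneg_pos mult_nonneg_nonneg integral_nonneg_AE) auto
  have q2: "ennreal 2 \<le> q" using q(1)
  proof (cases rule: exponent_cases)
    case (2 r)
    then have "r \<ge> 2" using q by (simp add: enn2real_one_divide field_simps)
    then show ?thesis using 2 by (simp del: ennreal_numeral)
  qed simp
  define C where "C = G powr (1 - 2 * ?t) * L' powr ?t"
  have C: "C > 0" using G L' by (simp add: C_def)
  have key: "Lp_norm q lborel (V g f) \<le> ennreal (C * S powr (1 - 2 * ?t))"
    if f: "f \<in> schwartz" and S: "S > 0" and L2: "(LINT t|lborel. (norm (f t))\<^sup>2) \<le> L"
      and sup: "(\<forall>t. norm (f t) \<le> S) \<or> (\<forall>t. norm (fourier f t) \<le> S)" for f S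
  proof -
    have "Lp_norm q lborel (V g f) \<le> ennreal ((S * G) powr (1 - 2 * ?t) * L' powr ?t)"
    proof (rule Lp_norm_interpolate[OF q(1)])
      show "V g f \<in> borel_measurable lborel" using V_measurable[OF schwartz_measurable[OF f] g] by simp
      show "norm (V g f z) \<le> S * G" for z
      proof -
        have "norm (V g f z) \<le> S * (LINT t|lborel. norm (g t)) \<or> norm (V g f z) \<le> S * (LINT t|lborel. norm (fourier g t))"
          using sup V_sup[OF g, of f S z] V_sup_fourier[OF f g, of S z] by auto
        moreover have "S * (LINT t|lborel. norm (g t)) \<le> S * G" "S * (LINT t|lborel. norm (fourier g t)) \<le> S * G"
          using S nn by (auto simp: G_def intro!: mult_left_mono)
        ultimately show ?thesis by linarith
      qed
      have "(\<integral>\<^sup>+z. ennreal (norm (V g f z) powr 2) \<partial>lborel) = ennreal ((LINT t|lborel. (norm (f t))\<^sup>2) * (LINT t|lborel. (norm (g t))\<^sup>2))"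
        using V_L2[OF f g] by (simp add: powr_numeral)
      also have "\<dots> \<le> ennreal L'"
        unfolding L'_def using L2 by (intro ennreal_leI add_increasing2 mult_right_mono integral_nonneg_AE) auto
      finally show "(\<integral>\<^sup>+z. ennreal (norm (V g f z) powr 2) \<partial>lborel) \<le> ennreal L'" .
    qed (use S G L' q2 in auto)
    also have "(S * G) powr (1 - 2 * ?t) * L' powr ?t = C * S powr (1 - 2 * ?t)"
      using S G by (simp add: C_def powr_mult mult_ac)
    finally show ?thesis .
  qed
  have "norms_le g q K (C * S powr (1 - 2 * ?t))"
    if K: "K \<in> schwartz" and S: "S > 0" and L2: "(LINT t|lborel. (norm (K t))\<^sup>2) \<le> L"
      and sup: "(\<forall>t. norm (K t) \<le> S) \<or> (\<forall>t. norm (fourier K t) \<le> S)" for K S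
    unfolding norms_le_def
  proof (intro conjI ballI impI)
    show "Lp_norm q lborel (V g (\<lambda>t. cnj (K t))) \<le> ennreal (C * S powr (1 - 2 * ?t))"
      by (rule key[OF schwartz_cnj[OF K] S]) (use L2 sup in \<open>auto simp: fourier_cnj\<close>)
    fix f assume f: "f \<in> schwartz" "fourier f = K"
    have "norm (f t) \<le> S" if "\<forall>t. norm (fourier K t) \<le> S" for t
      using that[rule_format, of "- t"] fourier_fourier[OF f(1), of "- t"] f(2) by simp
    then show "Lp_norm q lborel (V g f) \<le> ennreal (C * S powr (1 - 2 * ?t))"
      by (intro key[OF f(1) S]) (use L2 sup f plancherel[OF f(1)] in auto)
  qed
  with C show ?thesis by blast
qed

section \<open>Chirps\<close>

text \<open>Written as a modulated complex Gaussian, so that the modulus of its Fourier transform is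
  explicit; \<open>chirp_eq\<close> displays the phase that the operator creates or removes.\<close>

definition chirp :: "real^'n \<Rightarrow> real \<Rightarrow> real \<Rightarrow> real^'n \<Rightarrow> complex" where
  "chirp e l n y = cis (2 * pi * ((n *\<^sub>R e) \<bullet> y)) * cgauss (Complex 1 (- (l * n))) y"

lemma chirp_schwartz: "chirp e l n \<in> schwartz"
  unfolding chirp_def[abs_def] by (intro schwartz_modulate cgauss_schwartz) simp

lemma norm_chirp: "norm (chirp e l n y) = norm (cgauss 1 y)"
  by (simp add: chirp_def norm_mult norm_cgauss)

lemma chirp_eq: "chirp e l n y = cis (2 * pi * n * (e \<bullet> y + l / 2 * (y \<bullet> y))) * cgauss 1 y"
proof -
  have "cgauss (Complex 1 (- (l * n))) y = cis (pi * l * n * (y \<bullet> y)) * cgauss 1 y"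
    unfolding cgauss_def cis_conv_exp exp_add[symmetric]
    by (rule arg_cong[where f=exp]) (simp add: complex_eq_iff)
  then have "chirp e l n y = (cis (2 * pi * ((n *\<^sub>R e) \<bullet> y)) * cis (pi * l * n * (y \<bullet> y))) * cgauss 1 y"
    unfolding chirp_def by (simp only: mult.assoc)
  also have "cis (2 * pi * ((n *\<^sub>R e) \<bullet> y)) * cis (pi * l * n * (y \<bullet> y)) = cis (2 * pi * n * (e \<bullet> y + l / 2 * (y \<bullet> y)))"
    unfolding cis_mult by (rule arg_cong[where f=cis]) (simp add: field_simps)
  finally show ?thesis .
qed

text \<open>For a = 1 - i l n one has |a|^2 = 1 + (l n)^2 and Re (1/a) = 1/(1 + (l n)^2). The
  transform thus spreads over a ball of radius about l n around n e, with a correspondingly low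
  peak.\<close>

lemma norm_fourier_chirp:
  fixes e :: "real^'n"
  shows "norm (fourier (chirp e l n) \<eta>) = (1 + (l * n)\<^sup>2) powr (- real CARD('n) / 4)
     * exp (- (pi / (1 + (l * n)\<^sup>2)) * ((\<eta> - n *\<^sub>R e) \<bullet> (\<eta> - n *\<^sub>R e)))"
proof -
  let ?a = "Complex 1 (- (l * n))"
  have sch: "(cgauss ?a :: real^'n \<Rightarrow> complex) \<in> schwartz" by (rule cgauss_schwartz) simp
  have "fourier (chirp e l n) \<eta> = fourier (cgauss ?a) (\<eta> - n *\<^sub>R e)"
    using fourier_shift_modulate[OF sch, of "n *\<^sub>R e" 0 \<eta>] by (simp add: chirp_def[abs_def])
  then have "norm (fourier (chirp e l n) \<eta>) = norm ?a powr (- real CARD('n) / 2) * norm (cgauss (1 / ?a) (\<eta> - n *\<^sub>R e))"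
    using norm_fourier_cgauss[of ?a "\<eta> - n *\<^sub>R e"] by simp
  moreover have "norm ?a = (1 + (l * n)\<^sup>2) powr (1 / 2)"
    by (simp add: cmod_def powr_half_sqrt add_nonneg_nonneg)
  moreover have "Re (1 / ?a) = 1 / (1 + (l * n)\<^sup>2)" by (simp add: Re_divide)
  ultimately show ?thesis by (simp add: norm_cgauss powr_powr)
qed

lemma one_plus_sq_powr_le:
  fixes d :: real
  assumes "l > 0" "n > 0" "d \<ge> 0"
  shows "(1 + (l * n)\<^sup>2) powr (- d / 4) \<le> (l powr (- d / 2)) * n powr (- d / 2)"
proof -
  have "(1 + (l * n)\<^sup>2) powr (- d / 4) \<le> ((l * n)\<^sup>2) powr (- d / 4)"
    using assms by (intro powr_mono2') auto
  also have "\<dots> = (l * n) powr (- d / 2)"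
    using assms by (simp add: powr_powr flip: powr_numeral)
  finally show ?thesis using assms by (simp add: powr_mult)
qed

text \<open>The peak of the transform is at most a constant times n^{-d/2} while the square integral
  is that of a fixed Gaussian; raising the peak to the power 1 - 2/q yields the exponent -d (1/2 -
  1/q).\<close>

lemma norms_le_chirp:
  fixes e :: "real^'n" and g :: "real^'n \<Rightarrow> complex"
  assumes g: "g \<in> schwartz" and q: "1 \<le> q" "enn2real (1 / q) \<le> 1 / 2" and l: "l > 0"
  shows "\<exists>C>0. \<forall>n\<ge>1. norms_le g q (\<lambda>t. cnj (chirp e l n t)) (C * n powr (- real CARD('n) * (1 / 2 - enn2real (1 / q))))"
proof -
  let ?d = "real CARD('n)"
  let ?t = "enn2real (1 / q)"
  define L where "L = (LINT t|lborel. (norm (cgauss 1 (t :: real^'n)))\<^sup>2)"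
  have "L \<ge> 0" unfolding L_def by (rule integral_nonneg_AE) simp
  from norms_le_small[OF g q this]
  obtain C where C: "C > 0" "\<And>K S. K \<in> schwartz \<Longrightarrow> S > 0 \<Longrightarrow> (LINT t|lborel. (norm (K t))\<^sup>2) \<le> L \<Longrightarrow>
    \<forall>t. norm (fourier K t) \<le> S \<Longrightarrow> norms_le g q K (C * S powr (1 - 2 * ?t))" by blast
  have "norms_le g q (\<lambda>t. cnj (chirp e l n t)) ((C * (l powr (- ?d / 2)) powr (1 - 2 * ?t)) * n powr (- ?d * (1 / 2 - ?t)))"
    if n: "n \<ge> 1" for n
  proof -
    let ?S = "l powr (- ?d / 2) * n powr (- ?d / 2)"
    have "norms_le g q (\<lambda>t. cnj (chirp e l n t)) (C * ?S powr (1 - 2 * ?t))"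
    proof (rule C(2))
      show "(\<lambda>t. cnj (chirp e l n t)) \<in> schwartz" by (intro schwartz_cnj chirp_schwartz)
      show "?S > 0" using n l by simp
      show "(LINT t|lborel. (norm (cnj (chirp e l n t)))\<^sup>2) \<le> L" by (simp add: L_def norm_chirp)
      show "\<forall>t. norm (fourier (\<lambda>t. cnj (chirp e l n t)) t) \<le> ?S"
      proof
        fix t :: "real^'n"
        have "norm (fourier (chirp e l n) (- t)) \<le> (1 + (l * n)\<^sup>2) powr (- ?d / 4) * 1"
          unfolding norm_fourier_chirp by (intro mult_left_mono) (auto simp: add_nonneg_nonneg)
        then show "norm (fourier (\<lambda>t. cnj (chirp e l n t)) t) \<le> ?S"
          using one_plus_sq_powr_le[OF l, of n ?d] n by (simp add: fourier_cnj)
      qed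
    qed
    moreover have "?S powr (1 - 2 * ?t) = (l powr (- ?d / 2)) powr (1 - 2 * ?t) * n powr (- ?d * (1 / 2 - ?t))"
    proof -
      have "- ?d / 2 * (1 - 2 * ?t) = - ?d * (1 / 2 - ?t)" by (simp add: field_simps)
      then show ?thesis using n l by (simp only: powr_mult powr_ge_zero powr_powr)
    qed
    ultimately show ?thesis by (simp only: mult.assoc)
  qed
  then show ?thesis using C l by (intro exI[of _ "C * (l powr (- ?d / 2)) powr (1 - 2 * ?t)"]) auto
qed

text \<open>This is the Fourier transform of the input function. The bracket to the power -m cancels
  the weight of the amplitude exactly, and n^m restores the size of the chirp, whose frequencies are
  of order n.\<close>

definition wchirp :: "real \<Rightarrow> real^'n \<Rightarrow> real \<Rightarrow> real \<Rightarrow> real^'n \<Rightarrow> complex" where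
  "wchirp m e l n \<eta> = of_real (n powr m * jw (- m) \<eta>) * fourier (chirp e l n) \<eta>"

lemma moderate_jw: "moderate m (\<lambda>x::'a::euclidean_space. complex_of_real (jw m x))"
  by (rule symbI, rule jw.symk_of_real, rule symk_jw_mono[OF order_refl _ symk_jw]) simp

lemma wchirp_schwartz: "wchirp m e l n \<in> schwartz"
proof -
  have "(\<lambda>\<eta>. of_real (n powr m) * (of_real (jw (- m) \<eta>) * fourier (chirp e l n) \<eta>)) \<in> schwartz"
    by (intro schwartz_cmult schwartz_moderate_mult[OF moderate_jw] fourier_schwartz chirp_schwartz)
  then show ?thesis unfolding wchirp_def[abs_def] by (simp add: mult.assoc)
qed

text \<open>In the variable u = (\<eta> - n e) / n the normalised weight is at most a power of the
  bracket of u, which part of the Gaussian absorbs. Here m \<le> 0 matters: for m > 0 the normalised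
  weight would have size n^m near \<eta> = 0, where |u| is about 1 and the Gaussian is not
  small.\<close>

lemma wchirp_bound:
  fixes e :: "real^'n"
  assumes m: "m \<le> 0" and l: "l > 0" and e: "norm e = 1"
  shows "\<exists>C>0. \<exists>r>0. \<forall>n\<ge>1. \<forall>\<eta>. norm (wchirp m e l n \<eta>) \<le>
     C * n powr (- real CARD('n) / 2) * exp (- r * (((\<eta> - n *\<^sub>R e) /\<^sub>R n) \<bullet> ((\<eta> - n *\<^sub>R e) /\<^sub>R n)))"
proof -
  let ?d = "real CARD('n)"
  \<comment> \<open>Half of the Gaussian rate available for all n \<ge> 1: one half absorbs the
    weight, the other remains in the bound.\<close>
  define r where "r = pi / (1 + l\<^sup>2) / 2"
  have r: "r > 0" by (simp add: r_def add_pos_nonneg)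
  obtain D where D: "\<And>x::real^'n. exp (- r * (x \<bullet> x)) \<le> D * jw m x" using exp_neg_bound[OF r] by blast
  have D0: "D > 0" using D[of 0] by (simp add: japanese_def)
  have "norm (wchirp m e l n \<eta>) \<le> (l powr (- ?d / 2) * 3 powr (- m) * D) * n powr (- ?d / 2)
     * exp (- r * (((\<eta> - n *\<^sub>R e) /\<^sub>R n) \<bullet> ((\<eta> - n *\<^sub>R e) /\<^sub>R n)))" if n: "n \<ge> 1" for n \<eta>
  proof -
    define u where "u = (\<eta> - n *\<^sub>R e) /\<^sub>R n"
    have \<eta>: "\<eta> = n *\<^sub>R (u + e)" "\<eta> - n *\<^sub>R e = n *\<^sub>R u" using n by (auto simp: u_def scaleR_add_right)
    have "japanese \<eta> \<le> 1 + n * norm (u + e)" using japanese_le[of \<eta>] n by (simp add: \<eta>)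
    also have "\<dots> \<le> n + n * (norm u + 1)"
      using n norm_triangle_ineq[of u e] e by (intro add_mono mult_left_mono) auto
    also have "\<dots> \<le> n * (3 * japanese u)"
    proof -
      have "norm u + 2 \<le> 3 * japanese u" using norm_le_japanese[of u] japanese_ge_1[of u] by linarith
      then have "n * (norm u + 2) \<le> n * (3 * japanese u)" using n by (intro mult_left_mono) auto
      then show ?thesis by (simp add: algebra_simps)
    qed
    finally have "jw (- m) \<eta> \<le> (n * (3 * japanese u)) powr (- m)" using m by (intro powr_mono2) auto
    also have "\<dots> = n powr (- m) * (3 powr (- m) * jw (- m) u)" using n by (simp add: powr_mult)
    finally have w: "n powr m * jw (- m) \<eta> \<le> 3 powr (- m) * jw (- m) u"
      using n by (simp add: powr_minus field_simps)
    have ex: "exp (- (pi / (1 + (l * n)\<^sup>2)) * ((\<eta> - n *\<^sub>R e) \<bullet> (\<eta> - n *\<^sub>R e))) \<le> exp (- r * (u \<bullet> u)) * exp (- r * (u \<bullet> u))"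
    proof -
      have "1 + (l * n)\<^sup>2 \<le> (1 + l\<^sup>2) * n\<^sup>2"
        using n by (simp add: power_mult_distrib algebra_simps)
      then have "pi / ((1 + l\<^sup>2) * n\<^sup>2) \<le> pi / (1 + (l * n)\<^sup>2)"
        using n by (intro divide_left_mono mult_pos_pos) (auto simp: add_pos_nonneg)
      then have "pi / ((1 + l\<^sup>2) * n\<^sup>2) * (n\<^sup>2 * (u \<bullet> u)) \<le> pi / (1 + (l * n)\<^sup>2) * (n\<^sup>2 * (u \<bullet> u))"
        by (intro mult_right_mono) auto
      moreover have "pi / ((1 + l\<^sup>2) * n\<^sup>2) * (n\<^sup>2 * (u \<bullet> u)) = 2 * (r * (u \<bullet> u))"
      proof -
        have "2 * (a / 2) = a" for a :: real by simp
        then have "2 * r = pi / (1 + l\<^sup>2)" unfolding r_def .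
        moreover have "pi / ((1 + l\<^sup>2) * n\<^sup>2) * (n\<^sup>2 * (u \<bullet> u)) = pi / (1 + l\<^sup>2) * (u \<bullet> u)"
          using n by simp
        ultimately show ?thesis by (metis mult.assoc)
      qed
      ultimately have "2 * (r * (u \<bullet> u)) \<le> pi / (1 + (l * n)\<^sup>2) * (n\<^sup>2 * (u \<bullet> u))" by simp
      then show ?thesis
        unfolding exp_add[symmetric] \<eta>(2) by (simp add: power2_eq_square mult_ac)
    qed
    have "norm (wchirp m e l n \<eta>) = (n powr m * jw (- m) \<eta>) * ((1 + (l * n)\<^sup>2) powr (- ?d / 4)
       * exp (- (pi / (1 + (l * n)\<^sup>2)) * ((\<eta> - n *\<^sub>R e) \<bullet> (\<eta> - n *\<^sub>R e))))"
      unfolding wchirp_def norm_mult norm_fourier_chirp norm_of_real by (simp add: abs_mult)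
    also have "\<dots> \<le> (3 powr (- m) * jw (- m) u) * ((l powr (- ?d / 2) * n powr (- ?d / 2)) * (exp (- r * (u \<bullet> u)) * exp (- r * (u \<bullet> u))))"
      by (rule mult_mono[OF w mult_mono[OF one_plus_sq_powr_le[OF l] ex]]) (use n in auto)
    also have "\<dots> \<le> (3 powr (- m) * jw (- m) u) * ((l powr (- ?d / 2) * n powr (- ?d / 2)) * ((D * jw m u) * exp (- r * (u \<bullet> u))))"
      using D[of u] by (intro mult_left_mono mult_right_mono) auto
    also have "\<dots> = (l powr (- ?d / 2) * 3 powr (- m) * D) * n powr (- ?d / 2) * exp (- r * (u \<bullet> u)) * (jw (- m) u * jw m u)"
      by (simp only: mult_ac)
    also have "jw (- m) u * jw m u = 1" by (simp flip: powr_add)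
    finally show ?thesis by (simp add: u_def)
  qed
  then show ?thesis
    using r D0 l by (intro exI[of _ "l powr (- ?d / 2) * 3 powr (- m) * D"] conjI exI[of _ r]) auto
qed

text \<open>Now the function itself is the small one, with supremum of order n^{-d/2}. Its square
  integral stays bounded, since rescaling by n produces a factor n^d that cancels the square of that
  supremum.\<close>

lemma norms_le_wchirp:
  fixes e :: "real^'n" and g :: "real^'n \<Rightarrow> complex"
  assumes g: "g \<in> schwartz" and q: "1 \<le> q" "enn2real (1 / q) \<le> 1 / 2"
    and m: "m \<le> 0" and l: "l > 0" and e: "norm e = 1"
  shows "\<exists>C>0. \<forall>n\<ge>1. norms_le g q (wchirp m e l n) (C * n powr (- real CARD('n) * (1 / 2 - enn2real (1 / q))))"
proof -
  let ?d = "real CARD('n)"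
  let ?t = "enn2real (1 / q)"
  obtain B r where B: "B > 0" "r > 0" "\<And>n \<eta>. n \<ge> 1 \<Longrightarrow> norm (wchirp m e l n \<eta>) \<le>
     B * n powr (- ?d / 2) * exp (- r * (((\<eta> - n *\<^sub>R e) /\<^sub>R n) \<bullet> ((\<eta> - n *\<^sub>R e) /\<^sub>R n)))"
    using wchirp_bound[OF m l e] by blast
  have ge: "complex_of_real (exp (- r * (x \<bullet> x)) * exp (- r * (x \<bullet> x))) = cgauss (of_real (2 * r / pi)) x" for x :: "real^'n"
    by (simp add: cgauss_def exp_of_real[symmetric] mult.assoc flip: exp_add)
  have "integrable lborel (\<lambda>x::real^'n. Re (cgauss (of_real (2 * r / pi)) x))"
    using B by (intro integrable_Re schwartz_integrable cgauss_schwartz) simp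
  then have int: "integrable lborel (\<lambda>x::real^'n. exp (- r * (x \<bullet> x)) * exp (- r * (x \<bullet> x)))"
    unfolding ge[symmetric] by simp
  define L where "L = B\<^sup>2 * (LINT x|lborel. exp (- r * (x \<bullet> x)) * exp (- r * (x \<bullet> (x :: real^'n))))"
  have L: "L \<ge> 0" unfolding L_def by (intro mult_nonneg_nonneg integral_nonneg_AE) auto
  from norms_le_small[OF g q L]
  obtain C where C: "C > 0" "\<And>K S. K \<in> schwartz \<Longrightarrow> S > 0 \<Longrightarrow> (LINT t|lborel. (norm (K t))\<^sup>2) \<le> L \<Longrightarrow>
    \<forall>t. norm (K t) \<le> S \<Longrightarrow> norms_le g q K (C * S powr (1 - 2 * ?t))" by blast
  have "norms_le g q (wchirp m e l n) ((C * B powr (1 - 2 * ?t)) * n powr (- ?d * (1 / 2 - ?t)))"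
    if n: "n \<ge> 1" for n
  proof -
    let ?S = "B * n powr (- ?d / 2)"
    have "norms_le g q (wchirp m e l n) (C * ?S powr (1 - 2 * ?t))"
    proof (rule C(2)[OF wchirp_schwartz])
      show "?S > 0" using n B by simp
      show "\<forall>t. norm (wchirp m e l n t) \<le> ?S"
      proof
        fix \<eta>
        have "?S * exp (- r * (((\<eta> - n *\<^sub>R e) /\<^sub>R n) \<bullet> ((\<eta> - n *\<^sub>R e) /\<^sub>R n))) \<le> ?S * 1"
          using B n by (intro mult_left_mono) auto
        with B(3)[OF n, of \<eta>] show "norm (wchirp m e l n \<eta>) \<le> ?S" by simp
      qed
      let ?E = "\<lambda>x::real^'n. exp (- r * (x \<bullet> x)) * exp (- r * (x \<bullet> x))"
      have aff: "integrable lborel (\<lambda>\<eta>. ?E (- e + (1 / n) *\<^sub>R \<eta>))"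
        using integrable_affine[OF int, of "1 / n" "- e"] n by simp
      have "(LINT \<eta>|lborel. (norm (wchirp m e l n \<eta>))\<^sup>2) \<le> (LINT \<eta>|lborel. (B\<^sup>2 * n powr (- ?d)) * ?E (- e + (1 / n) *\<^sub>R \<eta>))"
      proof (rule integral_mono)
        show "integrable lborel (\<lambda>\<eta>. (norm (wchirp m e l n \<eta>))\<^sup>2)" by (rule schwartz_integrable_sq[OF wchirp_schwartz])
        show "integrable lborel (\<lambda>\<eta>. (B\<^sup>2 * n powr (- ?d)) * ?E (- e + (1 / n) *\<^sub>R \<eta>))"
          using aff by (rule integrable_mult_right)
        fix \<eta>
        have u: "(\<eta> - n *\<^sub>R e) /\<^sub>R n = - e + (1 / n) *\<^sub>R \<eta>" using n by (simp add: scaleR_diff_right divide_inverse)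
        have "(norm (wchirp m e l n \<eta>))\<^sup>2 \<le> (?S * exp (- r * (((\<eta> - n *\<^sub>R e) /\<^sub>R n) \<bullet> ((\<eta> - n *\<^sub>R e) /\<^sub>R n))))\<^sup>2"
          by (intro power_mono B n) auto
        also have "\<dots> = (B\<^sup>2 * n powr (- ?d)) * ?E (- e + (1 / n) *\<^sub>R \<eta>)"
        proof -
          have "n powr (- ?d / 2) * n powr (- ?d / 2) = n powr (- ?d)" by (simp flip: powr_add)
          moreover have "(b * x * z)\<^sup>2 = (b\<^sup>2 * (x * x)) * (z * z)" for b x z :: real
            by (simp add: power2_eq_square mult_ac)
          ultimately show ?thesis unfolding u by (simp only:)
        qed
        finally show "(norm (wchirp m e l n \<eta>))\<^sup>2 \<le> (B\<^sup>2 * n powr (- ?d)) * ?E (- e + (1 / n) *\<^sub>R \<eta>)" .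
      qed
      also have "\<dots> = L"
      proof -
        have "(LINT x|lborel. ?E x) = (1 / n) ^ CARD('n) * (LINT \<eta>|lborel. ?E (- e + (1 / n) *\<^sub>R \<eta>))"
          using integral_affine[of ?E "1 / n" "- e"] n int by auto
        moreover have "(1 / n) ^ CARD('n) = n powr (- ?d)"
          using n by (simp add: powr_minus powr_realpow power_one_over inverse_eq_divide)
        ultimately show ?thesis unfolding L_def by simp
      qed
      finally show "(LINT t|lborel. (norm (wchirp m e l n t))\<^sup>2) \<le> L" .
    qed
    moreover have "?S powr (1 - 2 * ?t) = B powr (1 - 2 * ?t) * n powr (- ?d * (1 / 2 - ?t))"
    proof -
      have "- ?d / 2 * (1 - 2 * ?t) = - ?d * (1 / 2 - ?t)" by (simp add: field_simps)
      then show ?thesis using n B(1) by (simp only: powr_mult powr_ge_zero powr_powr less_imp_le)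
    qed
    ultimately show ?thesis by (simp only: mult.assoc)
  qed
  then show ?thesis using C B by (intro exI[of _ "C * B powr (1 - 2 * ?t)"]) auto
qed


section \<open>Unboundedness from test functions\<close>

text \<open>Here \<open>P n\<close> is prescribed as the Fourier transform of the input, which
  inversion supplies. A bounded extension would give c n^m \<le> K a b n^{k1 + k2} for all large n,
  and this fails when k1 + k2 < m.\<close>

lemma not_bounded_operator:
  fixes g :: "real^'n \<Rightarrow> complex"
  assumes g: "g \<in> schwartz" "g \<noteq> (\<lambda>t. 0)"
    and p: "1 \<le> p" "1 \<le> p'" "enn2real (1 / p) + enn2real (1 / p') = 1"
    and X: "X = mod_space g p \<or> X = mod_space_tilde_inf g \<and> p = \<infinity>"
    and PQ: "\<And>n::nat. n \<ge> 1 \<Longrightarrow> P n \<in> schwartz" "\<And>n::nat. n \<ge> 1 \<Longrightarrow> Q n \<in> schwartz"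
    and norms: "\<And>n::nat. n \<ge> 1 \<Longrightarrow> norms_le g p (P n) (a * real n powr k1)"
      "\<And>n::nat. n \<ge> 1 \<Longrightarrow> norms_le g p' (Q n) (b * real n powr k2)"
    and ab: "0 \<le> a" "0 \<le> b" and k: "k1 + k2 < m" and c: "c > 0" and n0: "n0 \<ge> 1"
    and A: "\<And>f (n::nat). n \<ge> n0 \<Longrightarrow> f \<in> schwartz \<Longrightarrow> fourier f = P n \<Longrightarrow>
      A f \<in> borel_measurable borel \<and> (\<exists>B M. \<forall>x. norm (A f x) \<le> B * jw M x) \<and>
      c * real n powr m \<le> norm (LINT t|lborel. A f t * Q n t)"
  shows "\<not> extends_to_bounded_operator A X (mod_norm g p)"
proof
  assume ext: "extends_to_bounded_operator A X (mod_norm g p)"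
  obtain K where K: "K \<ge> 0" "\<And>f h a b. f \<in> schwartz \<Longrightarrow> h \<in> schwartz \<Longrightarrow> 0 \<le> a \<Longrightarrow> 0 \<le> b \<Longrightarrow>
    A f \<in> borel_measurable borel \<Longrightarrow> \<exists>B M. \<forall>x. norm (A f x) \<le> B * jw M x \<Longrightarrow>
    Lp_norm p lborel (V g f) \<le> ennreal a \<Longrightarrow> Lp_norm p' lborel (V g h) \<le> ennreal b \<Longrightarrow>
    norm (LINT t|lborel. A f t * cnj (h t)) \<le> K * a * b"
  proof (rule bounded_operator_imp_pairing_bound[OF g p ext X], goal_cases)
    case (1 K)
    show ?case by (rule 1(1)[OF 1(2,3)])
  qed
  have bound: "real n powr (m - (k1 + k2)) \<le> K * a * b / c" if n: "n \<ge> n0" for n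
  proof -
    have n1: "n \<ge> 1" using n n0 by simp
    obtain f where f: "f \<in> schwartz" "fourier f = P n" using fourier_surj[OF PQ(1)[OF n1]] by blast
    \<comment> \<open>The duality estimate is sesquilinear and the form to be bounded is bilinear,
      so the conjugate of \<open>Q n\<close> is inserted; this is why \<open>norms_le\<close> speaks
      of conjugates.\<close>
    have "norm (LINT t|lborel. A f t * cnj (cnj (Q n t))) \<le> K * (a * real n powr k1) * (b * real n powr k2)"
      using A[OF n f] norms[OF n1] ab f unfolding norms_le_def
      by (intro K(2) f schwartz_cnj PQ n1) auto
    with A[OF n f] have "c * real n powr m \<le> K * (a * real n powr k1) * (b * real n powr k2)" by simp
    also have "\<dots> = (K * a * b) * real n powr (k1 + k2)" by (simp add: powr_add mult_ac)
    finally have "(c * real n powr m) * real n powr (- (k1 + k2)) \<le> (K * a * b) * real n powr (k1 + k2) * real n powr (- (k1 + k2))"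
      by (rule mult_right_mono) simp
    moreover have "real n powr m * real n powr (- (k1 + k2)) = real n powr (m - (k1 + k2))"
      using powr_add[of "real n" m "- (k1 + k2)"] by (simp only: diff_conv_add_uminus)
    moreover have "real n powr (k1 + k2) * real n powr (- (k1 + k2)) = 1"
      using n1 by (simp flip: powr_add)
    ultimately have "c * real n powr (m - (k1 + k2)) \<le> K * a * b"
      by (simp only: mult.assoc mult_1_right)
    then show ?thesis using c by (simp add: field_simps)
  qed
  have "filterlim (\<lambda>n::nat. real n powr (m - (k1 + k2))) at_top sequentially"
    using k by (intro filterlim_compose[OF real_powr_at_top filterlim_real_sequentially]) simp
  then have "eventually (\<lambda>n::nat. real n powr (m - (k1 + k2)) > K * a * b / c) sequentially"
    by (simp add: filterlim_at_top_dense)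
  moreover have "eventually (\<lambda>n. n \<ge> n0) sequentially" by (rule eventually_ge_at_top)
  ultimately have "eventually (\<lambda>n::nat. False) sequentially"
    by eventually_elim (use bound in \<open>auto simp: not_less[symmetric]\<close>)
  then show False by simp
qed

section \<open>The oscillatory bilinear form\<close>

definition phase :: "real^'n \<Rightarrow> (real^'n \<Rightarrow> real) \<Rightarrow> (real^'n) \<times> (real^'n) \<Rightarrow> real" where
  "phase e s z = fst z \<bullet> snd z + s (fst z) * (e \<bullet> snd z)"

definition amp :: "real \<Rightarrow> (real^'n \<Rightarrow> real) \<Rightarrow> (real^'n) \<times> (real^'n) \<Rightarrow> complex" where
  "amp m G z = complex_of_real (G (fst z) * jw m (snd z))"

definition osc ::
  "real^'n \<Rightarrow> (real^'n \<Rightarrow> real) \<Rightarrow> real \<Rightarrow> (real^'n \<Rightarrow> real) \<Rightarrow> real^'n \<Rightarrow> real^'n \<Rightarrow> complex" where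
  "osc e s m G x \<eta> = cis (2 * pi * phase e s (x, \<eta>)) * amp m G (x, \<eta>)"

text \<open>This is the pairing of \<open>A f\<close> with \<open>U\<close>, expressed through the
  transform \<open>F\<close> of \<open>f\<close>. In this form \<open>F\<close> and \<open>U\<close>
  differ only by the variable they depend on, so exchanging the variables transposes the
  operator.\<close>

definition bil ::
  "real^'n \<Rightarrow> (real^'n \<Rightarrow> real) \<Rightarrow> real \<Rightarrow> (real^'n \<Rightarrow> real) \<Rightarrow>
    (real^'n \<Rightarrow> complex) \<Rightarrow> (real^'n \<Rightarrow> complex) \<Rightarrow> complex" where
  "bil e s m G F U = (LINT x|lborel. (LINT \<eta>|lborel. osc e s m G x \<eta> * F \<eta>) * U x)"

lemma phase_eq: "phase e s (x, \<eta>) = (x + s x *\<^sub>R e) \<bullet> \<eta>"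
  by (simp add: phase_def inner_add_left)

lemma osc_measurable:
  fixes e :: "real^'n"
  assumes "continuous_on UNIV s" "continuous_on UNIV G"
  shows "(\<lambda>z. osc e s m G (fst z) (snd z)) \<in> borel_measurable (borel \<Otimes>\<^sub>M borel)"
    and "(\<lambda>z. osc e s m G (snd z) (fst z)) \<in> borel_measurable (borel \<Otimes>\<^sub>M borel)"
proof -
  have [measurable]: "s \<in> borel_measurable borel" "G \<in> borel_measurable borel"
    using assms by (auto intro: borel_measurable_continuous_onI)
  show "(\<lambda>z. osc e s m G (fst z) (snd z)) \<in> borel_measurable (borel \<Otimes>\<^sub>M borel)"
    "(\<lambda>z. osc e s m G (snd z) (fst z)) \<in> borel_measurable (borel \<Otimes>\<^sub>M borel)"
    unfolding osc_def phase_def amp_def by measurable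
qed

lemma norm_osc: "(\<And>x. 0 \<le> G x \<and> G x \<le> 1) \<Longrightarrow> norm (osc e s m G x \<eta>) \<le> jw m \<eta>"
  by (simp add: osc_def amp_def norm_mult abs_mult mult_left_le_one_le)

context
  fixes e :: "real^'n" and s G :: "real^'n \<Rightarrow> real" and m :: real
  assumes cont: "continuous_on UNIV s" "continuous_on UNIV G"
    and G01: "\<And>x. 0 \<le> G x \<and> G x \<le> 1"
begin

lemma FIO_pairing:
  fixes F U :: "real^'n \<Rightarrow> complex"
  assumes F: "F \<in> schwartz" and f: "fourier f = F"
  shows "FIO (phase e s) (amp m G) f \<in> borel_measurable borel \<and>
    (\<exists>B M. \<forall>x. norm (FIO (phase e s) (amp m G) f x) \<le> B * jw M x) \<and>
    (LINT x|lborel. FIO (phase e s) (amp m G) f x * U x) = bil e s m G F U"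
proof -
  note [measurable] = schwartz_measurable[OF F] osc_measurable[OF cont]
  have eq: "FIO (phase e s) (amp m G) f = (\<lambda>x. LINT \<eta>|lborel. osc e s m G x \<eta> * F \<eta>)"
    by (simp add: FIO_def[abs_def] osc_def f)
  have "FIO (phase e s) (amp m G) f \<in> borel_measurable borel"
    unfolding eq by measurable
  moreover have "norm (FIO (phase e s) (amp m G) f x) \<le> (LINT \<eta>|lborel. jw m \<eta> * norm (F \<eta>)) * jw 0 x" for x
  proof -
    have "norm (FIO (phase e s) (amp m G) f x) \<le> (LINT \<eta>|lborel. norm (osc e s m G x \<eta> * F \<eta>))"
      unfolding eq by (rule integral_norm_bound)
    also have "\<dots> \<le> (LINT \<eta>|lborel. jw m \<eta> * norm (F \<eta>))"
      by (rule integral_mono') (auto simp: norm_mult intro!: schwartz_integrable_weight F mult_right_mono norm_osc G01)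
    finally show ?thesis by simp
  qed
  moreover have "(LINT x|lborel. FIO (phase e s) (amp m G) f x * U x) = bil e s m G F U"
    by (simp only: bil_def eq)
  ultimately show ?thesis by blast
qed

text \<open>Fubini identifies the pairing of the swapped operator with the same bilinear form. The
  weight now sits on the output variable, so the image is bounded only by a power of the
  bracket.\<close>

lemma FIO_swap_pairing:
  fixes F U :: "real^'n \<Rightarrow> complex"
  assumes F: "F \<in> schwartz" and U: "U \<in> schwartz" and f: "fourier f = U"
  defines "A \<equiv> FIO (\<lambda>z. phase e s (snd z, fst z)) (\<lambda>z. amp m G (snd z, fst z)) f"
  shows "A \<in> borel_measurable borel \<and> (\<exists>B M. \<forall>x. norm (A x) \<le> B * jw M x) \<and>
    (LINT x|lborel. A x * F x) = bil e s m G F U"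
proof -
  note [measurable] = schwartz_measurable[OF F] schwartz_measurable[OF U] osc_measurable[OF cont]
  have eq: "A = (\<lambda>x. LINT \<eta>|lborel. osc e s m G \<eta> x * U \<eta>)"
    by (simp add: A_def FIO_def[abs_def] osc_def f)
  have "A \<in> borel_measurable borel"
    unfolding eq by measurable
  moreover have "norm (A x) \<le> (LINT \<eta>|lborel. norm (U \<eta>)) * jw m x" for x
  proof -
    have "norm (A x) \<le> (LINT \<eta>|lborel. norm (osc e s m G \<eta> x * U \<eta>))"
      unfolding eq by (rule integral_norm_bound)
    also have "\<dots> \<le> (LINT \<eta>|lborel. jw m x * norm (U \<eta>))"
      by (rule integral_mono') (auto simp: norm_mult intro!: integrable_mult_right schwartz_integrable_norm U mult_right_mono norm_osc G01)
    finally show ?thesis by (simp add: mult.commute)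
  qed
  moreover have "(LINT x|lborel. A x * F x) = bil e s m G F U"
  proof -
    have "(LINT x|lborel. A x * F x) = (LINT x|lborel. LINT \<eta>|lborel. osc e s m G \<eta> x * U \<eta> * F x)"
      unfolding eq by (simp only: integral_mult_left_zero)
    also have "\<dots> = (LINT \<eta>|lborel. LINT x|lborel. osc e s m G \<eta> x * U \<eta> * F x)"
    proof (rule fubini_bound)
      show "integrable lborel (\<lambda>x. jw m x * norm (F x))" by (rule schwartz_integrable_weight[OF F])
      show "integrable lborel (\<lambda>\<eta>. norm (U \<eta>))" by (rule schwartz_integrable_norm[OF U])
      show "norm (osc e s m G \<eta> x * U \<eta> * F x) \<le> jw m x * norm (F x) * norm (U \<eta>)" for x \<eta>
        using norm_osc[where x=\<eta> and \<eta>=x, OF G01] by (simp add: norm_mult mult_ac mult_left_mono)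
    qed measurable
    also have "\<dots> = bil e s m G F U"
      unfolding bil_def integral_mult_left_zero[symmetric]
      by (intro Bochner_Integration.integral_cong refl) (simp only: mult_ac)
    finally show ?thesis .
  qed
  ultimately show ?thesis by blast
qed

text \<open>This integral is the leading constant of both lower bounds. Positivity at the origin,
  where \<open>G\<close> equals 1, suffices by continuity.\<close>

lemma gauss_weight_pos:
  assumes "G 0 = 1"
  shows "integrable lborel (\<lambda>x. G x * exp (- pi * ((x + s x *\<^sub>R e) \<bullet> (x + s x *\<^sub>R e))) * exp (- pi * (x \<bullet> x)))"
    and "(LINT x|lborel. G x * exp (- pi * ((x + s x *\<^sub>R e) \<bullet> (x + s x *\<^sub>R e))) * exp (- pi * (x \<bullet> x))) > 0"
proof -
  have [measurable]: "s \<in> borel_measurable borel" "G \<in> borel_measurable borel"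
    using cont by (auto intro: borel_measurable_continuous_onI)
  show int: "integrable lborel (\<lambda>x. G x * exp (- pi * ((x + s x *\<^sub>R e) \<bullet> (x + s x *\<^sub>R e))) * exp (- pi * (x \<bullet> x)))"
  proof (rule Bochner_Integration.integrable_bound)
    show "integrable lborel (\<lambda>x::real^'n. norm (cgauss 1 x))"
      by (intro schwartz_integrable_norm cgauss_schwartz) simp
    show "AE x in lborel. norm (G x * exp (- pi * ((x + s x *\<^sub>R e) \<bullet> (x + s x *\<^sub>R e))) * exp (- pi * (x \<bullet> x))) \<le> norm (norm (cgauss 1 x))"
      using G01 by (intro AE_I2) (auto simp: norm_cgauss abs_mult intro!: mult_le_one)
  qed measurable
  show "(LINT x|lborel. G x * exp (- pi * ((x + s x *\<^sub>R e) \<bullet> (x + s x *\<^sub>R e))) * exp (- pi * (x \<bullet> x))) > 0"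
    by (rule integral_pos_continuous[OF int, of 0])
       (use G01 cont assms in \<open>auto intro!: continuous_intros\<close>)
qed

lemma cgauss_1: "cgauss 1 x = complex_of_real (exp (- pi * (x \<bullet> x)))"
  by (simp add: cgauss_def exp_of_real[symmetric])

text \<open>On the support of \<open>G\<close> the substitution \<open>x + s x e\<close> straightens the chirp, so that the
  phases cancel exactly.\<close>

lemma bil_wchirp:
  assumes G0: "G 0 = 1"
    and s: "\<And>x. G x \<noteq> 0 \<Longrightarrow> e \<bullet> (x + s x *\<^sub>R e) + l / 2 * ((x + s x *\<^sub>R e) \<bullet> (x + s x *\<^sub>R e)) = e \<bullet> x"
  shows "\<exists>c>0. \<forall>n\<ge>1. c * n powr m \<le> norm (bil e s m G (wchirp m e l n) (\<lambda>x. cis (2 * pi * ((- n *\<^sub>R e) \<bullet> x)) * cgauss 1 (x - 0)))"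
proof -
  let ?\<phi> = "\<lambda>x. x + s x *\<^sub>R e"
  let ?w = "\<lambda>x. G x * exp (- pi * (?\<phi> x \<bullet> ?\<phi> x)) * exp (- pi * (x \<bullet> x))"
  have "bil e s m G (wchirp m e l n) (\<lambda>x. cis (2 * pi * ((- n *\<^sub>R e) \<bullet> x)) * cgauss 1 (x - 0)) = of_real (n powr m * (LINT x|lborel. ?w x))"
    if n: "n \<ge> 1" for n
  proof -
    \<comment> \<open>The weights \<open>jw m\<close> and \<open>jw (- m)\<close> cancel, and what
      is left is Fourier inversion at the displaced point.\<close>
    have "(LINT \<eta>|lborel. osc e s m G x \<eta> * wchirp m e l n \<eta>) = of_real (n powr m * G x) * chirp e l n (?\<phi> x)" for x
    proof -
      have "osc e s m G x \<eta> * wchirp m e l n \<eta> = of_real (n powr m * G x) * (fourier (chirp e l n) \<eta> * cis (2 * pi * (\<eta> \<bullet> ?\<phi> x)))" for \<eta>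
      proof -
        have "jw m \<eta> * jw (- m) \<eta> = 1" by (simp flip: powr_add)
        then have "complex_of_real (jw m \<eta>) * complex_of_real (jw (- m) \<eta>) = 1" by (metis of_real_mult of_real_1)
        moreover have "osc e s m G x \<eta> * wchirp m e l n \<eta> = (complex_of_real (jw m \<eta>) * complex_of_real (jw (- m) \<eta>)) *
          (of_real (n powr m * G x) * (fourier (chirp e l n) \<eta> * cis (2 * pi * (\<eta> \<bullet> ?\<phi> x))))"
          unfolding osc_def amp_def wchirp_def phase_eq fst_conv snd_conv of_real_mult inner_commute[of \<eta>] by (simp only: mult_ac)
        ultimately show ?thesis by simp
      qed
      then show ?thesis by (simp only: integral_mult_right_zero fourier_inversion[OF chirp_schwartz])
    qed
    moreover have "of_real (n powr m * G x) * chirp e l n (?\<phi> x) * (cis (2 * pi * ((- n *\<^sub>R e) \<bullet> x)) * cgauss 1 (x - 0)) = of_real (n powr m * ?w x)" for x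
    proof (cases "G x = 0")
      case False
      have "chirp e l n (?\<phi> x) = cis (2 * pi * n * (e \<bullet> x)) * cgauss 1 (?\<phi> x)"
        unfolding chirp_eq s[OF False] ..
      moreover have "cis (2 * pi * n * (e \<bullet> x)) * cis (2 * pi * ((- n *\<^sub>R e) \<bullet> x)) = 1"
        by (simp add: cis_mult)
      ultimately have "chirp e l n (?\<phi> x) * (cis (2 * pi * ((- n *\<^sub>R e) \<bullet> x)) * cgauss 1 (x - 0)) = cgauss 1 (?\<phi> x) * cgauss 1 x"
        by (simp add: mult_ac)
      then show ?thesis by (simp only: mult.assoc) (simp add: cgauss_1)
    qed simp
    ultimately show ?thesis
      unfolding bil_def by (simp only: integral_complex_of_real integral_mult_right_zero)
  qed
  then have "norm (bil e s m G (wchirp m e l n) (\<lambda>x. cis (2 * pi * ((- n *\<^sub>R e) \<bullet> x)) * cgauss 1 (x - 0))) = (LINT x|lborel. ?w x) * n powr m"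
    if "n \<ge> 1" for n
    using that gauss_weight_pos(2)[OF G0] by (simp only: norm_of_real) (simp add: abs_mult)
  then show ?thesis using gauss_weight_pos(2)[OF G0] by (intro exI[of _ "LINT x|lborel. ?w x"]) auto
qed

text \<open>The weight at distance \<open>n\<close> is \<open>n\<close> to the power \<open>m\<close> up to dominated errors, so that
  the bilinear form is asymptotic to a positive Gaussian integral.\<close>

lemma bil_chirp:
  assumes G0: "G 0 = 1" and e: "norm e = 1"
    and s: "\<And>x. G x \<noteq> 0 \<Longrightarrow> s x = l / 2 * (x \<bullet> x)"
  shows "\<exists>c>0. \<exists>n0\<ge>1. \<forall>n::nat\<ge>n0. c * real n powr m \<le>
    norm (bil e s m G (\<lambda>\<eta>. cis (2 * pi * (0 \<bullet> \<eta>)) * cgauss 1 (\<eta> - real n *\<^sub>R e)) (\<lambda>x. cnj (chirp e l (real n) x)))"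
proof -
  let ?\<phi> = "\<lambda>x. x + s x *\<^sub>R e"
  let ?w = "\<lambda>x. G x * exp (- pi * (?\<phi> x \<bullet> ?\<phi> x)) * exp (- pi * (x \<bullet> x))"
  let ?B = "\<lambda>n::nat. bil e s m G (\<lambda>\<eta>. cis (2 * pi * (0 \<bullet> \<eta>)) * cgauss 1 (\<eta> - real n *\<^sub>R e)) (\<lambda>x. cnj (chirp e l (real n) x))"
  define c where "c = (LINT x|lborel. ?w x)"
  have c: "c > 0" unfolding c_def by (rule gauss_weight_pos(2)[OF G0])
  have g1: "(cgauss 1 :: real^'n \<Rightarrow> complex) \<in> schwartz" by (rule cgauss_schwartz) simp
  have [measurable]: "s \<in> borel_measurable borel" "G \<in> borel_measurable borel"
    using cont by (auto intro: borel_measurable_continuous_onI)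
  note [measurable] = schwartz_measurable[OF g1]
  \<comment> \<open>The frequency is written as \<zeta> + n e. This is the normalised weight,
    tending to 1 for fixed \<zeta>.\<close>
  define W where "W n \<zeta> = jw m (\<zeta> + real n *\<^sub>R e) / real n powr m" for n :: nat and \<zeta>
  define k where "k x \<zeta> = cis (2 * pi * (?\<phi> x \<bullet> \<zeta>)) * (of_real (G x) * cgauss 1 x)" for x \<zeta>
  have [measurable]: "(\<lambda>z. k (fst z) (snd z)) \<in> borel_measurable (borel \<Otimes>\<^sub>M borel)" "W n \<in> borel_measurable borel" for n
    unfolding k_def W_def[abs_def] by measurable
  have k: "norm (k x \<zeta>) \<le> norm (cgauss 1 x)" for x \<zeta>
    using G01[of x] by (simp add: k_def norm_mult mult_left_le_one_le)
  define h where "h \<zeta> = (LINT x|lborel. k x \<zeta>)" for \<zeta>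
  have [measurable]: "(\<lambda>z. k (snd z) (fst z)) \<in> borel_measurable (borel \<Otimes>\<^sub>M borel)"
    unfolding k_def by measurable
  have [measurable]: "h \<in> borel_measurable borel" unfolding h_def[abs_def] by measurable
  define H where "H = (LINT x|lborel. norm (cgauss 1 (x :: real^'n)))"
  have h: "norm (h \<zeta>) \<le> H" for \<zeta>
  proof -
    have "norm (h \<zeta>) \<le> (LINT x|lborel. norm (k x \<zeta>))" unfolding h_def by (rule integral_norm_bound)
    also have "\<dots> \<le> H"
      unfolding H_def by (rule integral_mono') (auto intro!: schwartz_integrable_norm g1 k)
    finally show ?thesis .
  qed
  \<comment> \<open>Needed for the weights \<open>W n\<close> and again for the limiting weight
    1.\<close>
  have swap: "(LINT x|lborel. LINT \<zeta>|lborel. k x \<zeta> * (cgauss 1 \<zeta> * of_real (w \<zeta>))) = (LINT \<zeta>|lborel. h \<zeta> * (cgauss 1 \<zeta> * of_real (w \<zeta>)))"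
    if [measurable]: "w \<in> borel_measurable borel" and w: "\<And>\<zeta>. 0 \<le> w \<zeta> \<and> w \<zeta> \<le> D * jw M \<zeta>" for w D M
  proof -
    have "(LINT x|lborel. LINT \<zeta>|lborel. k x \<zeta> * (cgauss 1 \<zeta> * of_real (w \<zeta>))) = (LINT \<zeta>|lborel. LINT x|lborel. k x \<zeta> * (cgauss 1 \<zeta> * of_real (w \<zeta>)))"
    proof (rule fubini_bound)
      show "integrable lborel (\<lambda>x::real^'n. norm (cgauss 1 x))" by (rule schwartz_integrable_norm[OF g1])
      show "integrable lborel (\<lambda>\<zeta>::real^'n. D * (jw M \<zeta> * norm (cgauss 1 \<zeta>)))"
        by (intro integrable_mult_right schwartz_integrable_weight g1)
      show "norm (k x \<zeta> * (cgauss 1 \<zeta> * of_real (w \<zeta>))) \<le> norm (cgauss 1 x) * (D * (jw M \<zeta> * norm (cgauss 1 \<zeta>)))" for x \<zeta>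
      proof -
        have "norm (k x \<zeta>) * (norm (cgauss 1 \<zeta>) * w \<zeta>) \<le> norm (cgauss 1 x) * (norm (cgauss 1 \<zeta>) * (D * jw M \<zeta>))"
          using w[of \<zeta>] by (intro mult_mono mult_left_mono k) auto
        then show ?thesis using w[of \<zeta>] by (simp add: norm_mult mult_ac)
      qed
    qed measurable
    then show ?thesis unfolding h_def by (simp only: integral_mult_left_zero)
  qed
  \<comment> \<open>Peetre's inequality costs one factor 2 to the power |m|, and comparing the
    bracket of n e with n costs another. The bound holds for either sign of m.\<close>
  have W: "0 \<le> W n \<zeta> \<and> W n \<zeta> \<le> 4 powr \<bar>m\<bar> * jw \<bar>m\<bar> \<zeta>" if n: "n \<ge> 1" for n \<zeta>
  proof -
    have j: "japanese (real n *\<^sub>R e) \<le> 2 * real n" "real n \<le> japanese (real n *\<^sub>R e)"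
      using japanese_le[of "real n *\<^sub>R e"] norm_le_japanese[of "real n *\<^sub>R e"] n e by auto
    have "jw m (real n *\<^sub>R e) \<le> 2 powr \<bar>m\<bar> * real n powr m"
    proof (cases "m \<ge> 0")
      case True
      then have "jw m (real n *\<^sub>R e) \<le> (2 * real n) powr m" using j by (intro powr_mono2) auto
      then show ?thesis using True by (simp add: powr_mult)
    next
      case False
      then have "jw m (real n *\<^sub>R e) \<le> real n powr m" using j n by (intro powr_mono2') auto
      also have "\<dots> \<le> 2 powr \<bar>m\<bar> * real n powr m"
        using ge_one_powr_ge_zero[of 2 "\<bar>m\<bar>"] by (simp add: mult_le_cancel_right1)
      finally show ?thesis .
    qed
    then have "2 powr \<bar>m\<bar> * jw m (real n *\<^sub>R e) * jw \<bar>m\<bar> \<zeta> \<le> 2 powr \<bar>m\<bar> * (2 powr \<bar>m\<bar> * real n powr m) * jw \<bar>m\<bar> \<zeta>"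
      by (intro mult_left_mono mult_right_mono) auto
    also have "\<dots> = (4 powr \<bar>m\<bar> * jw \<bar>m\<bar> \<zeta>) * real n powr m"
    proof -
      have "2 powr \<bar>m\<bar> * 2 powr \<bar>m\<bar> = (4::real) powr \<bar>m\<bar>" by (simp flip: powr_mult)
      then show ?thesis by (simp add: mult_ac)
    qed
    finally have "jw m (\<zeta> + real n *\<^sub>R e) \<le> (4 powr \<bar>m\<bar> * jw \<bar>m\<bar> \<zeta>) * real n powr m"
      using japanese_powr_ge[of "real n *\<^sub>R e" \<zeta> m] by (simp only: add.commute[of \<zeta>])
    then show ?thesis using n by (simp add: W_def divide_le_eq)
  qed
  have lim: "(\<lambda>n. W (Suc n) \<zeta>) \<longlonglongrightarrow> 1" for \<zeta>
  proof -
    have eq: "W (Suc n) \<zeta> = (inverse (real (Suc n)) * inverse (real (Suc n)) * (1 + \<zeta> \<bullet> \<zeta>) + 2 * inverse (real (Suc n)) * (\<zeta> \<bullet> e) + 1) powr (m / 2)" for n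
    proof -
      have ee: "e \<bullet> e = 1" using e by (simp add: dot_square_norm)
      have "W (Suc n) \<zeta> = (1 + (\<zeta> + real (Suc n) *\<^sub>R e) \<bullet> (\<zeta> + real (Suc n) *\<^sub>R e)) powr (m / 2) / (real (Suc n) * real (Suc n)) powr (m / 2)"
        unfolding W_def japanese_powr_eq by (subst powr_mult) (simp_all flip: powr_add)
      also have "\<dots> = ((1 + (\<zeta> + real (Suc n) *\<^sub>R e) \<bullet> (\<zeta> + real (Suc n) *\<^sub>R e)) / (real (Suc n) * real (Suc n))) powr (m / 2)"
        by (rule powr_divide[symmetric])
      also have "(1 + (\<zeta> + real (Suc n) *\<^sub>R e) \<bullet> (\<zeta> + real (Suc n) *\<^sub>R e)) = (1 + \<zeta> \<bullet> \<zeta>) + 2 * real (Suc n) * (\<zeta> \<bullet> e) + real (Suc n) * real (Suc n)"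
        using ee by (simp only: inner_add_left inner_add_right inner_scaleR_left inner_scaleR_right inner_commute[of e \<zeta>]) (simp add: algebra_simps)
      also have "\<dots> / (real (Suc n) * real (Suc n)) = inverse (real (Suc n)) * inverse (real (Suc n)) * (1 + \<zeta> \<bullet> \<zeta>) + 2 * inverse (real (Suc n)) * (\<zeta> \<bullet> e) + 1"
        by (simp add: field_simps del: of_nat_Suc)
      finally show ?thesis .
    qed
    have "(\<lambda>n. (inverse (real (Suc n)) * inverse (real (Suc n)) * (1 + \<zeta> \<bullet> \<zeta>) + 2 * inverse (real (Suc n)) * (\<zeta> \<bullet> e) + 1) powr (m / 2))
       \<longlonglongrightarrow> (0 * 0 * (1 + \<zeta> \<bullet> \<zeta>) + 2 * 0 * (\<zeta> \<bullet> e) + 1) powr (m / 2)"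
      by (intro tendsto_intros LIMSEQ_inverse_real_of_nat) simp
    then show ?thesis unfolding eq by simp
  qed
  have B: "?B n = of_real (real n powr m) * (LINT \<zeta>|lborel. h \<zeta> * (cgauss 1 \<zeta> * of_real (W n \<zeta>)))" if n: "n \<ge> 1" for n
  proof -
    have "(LINT \<eta>|lborel. osc e s m G x \<eta> * (cis (2 * pi * (0 \<bullet> \<eta>)) * cgauss 1 (\<eta> - real n *\<^sub>R e))) * cnj (chirp e l (real n) x)
      = of_real (real n powr m) * (LINT \<zeta>|lborel. k x \<zeta> * (cgauss 1 \<zeta> * of_real (W n \<zeta>)))" for x
    proof (cases "G x = 0")
      case True
      then show ?thesis by (simp add: osc_def amp_def k_def)
    next
      case False
      \<comment> \<open>At frequency n e the phase of the operator is n (e \<bullet> x + s x). On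
        the support of \<open>G\<close> this is the phase of the chirp, so the conjugate chirp
        removes all oscillation that grows with n.\<close>
      let ?u = "cis (2 * pi * real n * (e \<bullet> x + l / 2 * (x \<bullet> x)))"
      have ch: "cnj (chirp e l (real n) x) = cnj ?u * cgauss 1 x" unfolding chirp_eq by (simp add: cgauss_1)
      have uu: "?u * cnj ?u = 1" by (simp add: cis_cnj cis_mult)
      have ee: "e \<bullet> e = 1" using e by (simp add: dot_square_norm)
      have "(LINT \<eta>|lborel. osc e s m G x \<eta> * (cis (2 * pi * (0 \<bullet> \<eta>)) * cgauss 1 (\<eta> - real n *\<^sub>R e)))
        = (LINT \<zeta>|lborel. osc e s m G x (\<zeta> + real n *\<^sub>R e) * (cis (2 * pi * (0 \<bullet> (\<zeta> + real n *\<^sub>R e))) * cgauss 1 (\<zeta> + real n *\<^sub>R e - real n *\<^sub>R e)))"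
        by (rule integral_shift(1)[symmetric]) (unfold osc_def amp_def phase_def, measurable)
      also have "\<dots> = (LINT \<zeta>|lborel. ?u * of_real (real n powr m) * (cis (2 * pi * (?\<phi> x \<bullet> \<zeta>)) * of_real (G x) * (cgauss 1 \<zeta> * of_real (W n \<zeta>))))"
      proof (rule Bochner_Integration.integral_cong[OF refl])
        fix \<zeta>
        have "cis (2 * pi * phase e s (x, \<zeta> + real n *\<^sub>R e)) = cis (2 * pi * (?\<phi> x \<bullet> \<zeta>)) * ?u"
          unfolding phase_eq cis_mult
          by (rule arg_cong[where f=cis]) (simp add: inner_simps ee s[OF False] inner_commute[of x e] algebra_simps)
        moreover have "jw m (\<zeta> + real n *\<^sub>R e) = real n powr m * W n \<zeta>" using n by (simp add: W_def)
        ultimately show "osc e s m G x (\<zeta> + real n *\<^sub>R e) * (cis (2 * pi * (0 \<bullet> (\<zeta> + real n *\<^sub>R e))) * cgauss 1 (\<zeta> + real n *\<^sub>R e - real n *\<^sub>R e))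
          = ?u * of_real (real n powr m) * (cis (2 * pi * (?\<phi> x \<bullet> \<zeta>)) * of_real (G x) * (cgauss 1 \<zeta> * of_real (W n \<zeta>)))"
          unfolding osc_def amp_def fst_conv snd_conv inner_zero_left add_diff_cancel_right' by (simp only: of_real_mult mult_zero_right mult_zero_left cis_zero mult_1_left mult_ac)
      qed
      also have "\<dots> = ?u * of_real (real n powr m) * (LINT \<zeta>|lborel. cis (2 * pi * (?\<phi> x \<bullet> \<zeta>)) * of_real (G x) * (cgauss 1 \<zeta> * of_real (W n \<zeta>)))"
        by (simp only: integral_mult_right_zero)
      finally have 1: "(LINT \<eta>|lborel. osc e s m G x \<eta> * (cis (2 * pi * (0 \<bullet> \<eta>)) * cgauss 1 (\<eta> - real n *\<^sub>R e))) = \<dots>" .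
      have 2: "(LINT \<zeta>|lborel. k x \<zeta> * (cgauss 1 \<zeta> * of_real (W n \<zeta>)))
         = cgauss 1 x * (LINT \<zeta>|lborel. cis (2 * pi * (?\<phi> x \<bullet> \<zeta>)) * of_real (G x) * (cgauss 1 \<zeta> * of_real (W n \<zeta>)))"
        unfolding k_def integral_mult_right_zero[symmetric] by (simp only: mult_ac)
      have "u * r * I * (u' * g) = r * (g * I)" if "u * u' = 1" for u r I u' g :: complex
      proof -
        have "u * r * I * (u' * g) = (u * u') * (r * (g * I))" by (simp only: mult_ac)
        then show ?thesis using that by simp
      qed
      from this[OF uu] show ?thesis unfolding 1 2 ch .
    qed
    then have "?B n = of_real (real n powr m) * (LINT x|lborel. LINT \<zeta>|lborel. k x \<zeta> * (cgauss 1 \<zeta> * of_real (W n \<zeta>)))"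
      unfolding bil_def by (simp only: integral_mult_right_zero)
    also have "(LINT x|lborel. LINT \<zeta>|lborel. k x \<zeta> * (cgauss 1 \<zeta> * of_real (W n \<zeta>))) = (LINT \<zeta>|lborel. h \<zeta> * (cgauss 1 \<zeta> * of_real (W n \<zeta>)))"
      by (rule swap) (use W[OF n] in auto)
    finally show ?thesis .
  qed
  have "(\<lambda>n. LINT \<zeta>|lborel. h \<zeta> * (cgauss 1 \<zeta> * of_real (W (Suc n) \<zeta>))) \<longlonglongrightarrow> (LINT \<zeta>|lborel. h \<zeta> * (cgauss 1 \<zeta> * of_real 1))"
  proof (rule integral_dominated_convergence)
    show "integrable lborel (\<lambda>\<zeta>::real^'n. (H * 4 powr \<bar>m\<bar>) * (jw \<bar>m\<bar> \<zeta> * norm (cgauss 1 \<zeta>)))"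
      by (intro integrable_mult_right schwartz_integrable_weight g1)
    show "AE \<zeta> in lborel. (\<lambda>n. h \<zeta> * (cgauss 1 \<zeta> * of_real (W (Suc n) \<zeta>))) \<longlonglongrightarrow> h \<zeta> * (cgauss 1 \<zeta> * of_real 1)"
      by (intro AE_I2 tendsto_intros lim)
    show "AE \<zeta> in lborel. norm (h \<zeta> * (cgauss 1 \<zeta> * of_real (W (Suc n) \<zeta>))) \<le> (H * 4 powr \<bar>m\<bar>) * (jw \<bar>m\<bar> \<zeta> * norm (cgauss 1 \<zeta>))" for n
    proof (rule AE_I2)
      fix \<zeta>
      have "norm (h \<zeta>) * (norm (cgauss 1 \<zeta>) * W (Suc n) \<zeta>) \<le> H * (norm (cgauss 1 \<zeta>) * (4 powr \<bar>m\<bar> * jw \<bar>m\<bar> \<zeta>))"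
        using W[of "Suc n" \<zeta>] order_trans[OF norm_ge_zero h[of \<zeta>]] by (intro mult_mono mult_left_mono h) auto
      then show "norm (h \<zeta> * (cgauss 1 \<zeta> * of_real (W (Suc n) \<zeta>))) \<le> (H * 4 powr \<bar>m\<bar>) * (jw \<bar>m\<bar> \<zeta> * norm (cgauss 1 \<zeta>))"
        using W[of "Suc n" \<zeta>] by (simp add: norm_mult mult_ac)
    qed
  qed measurable
  note DC = this
  \<comment> \<open>Without the weight the integral over \<zeta> is a Fourier transform of
    \<open>cgauss 1\<close>, which reproduces \<open>cgauss 1\<close> at the displaced
    point.\<close>
  have L: "(LINT \<zeta>|lborel. h \<zeta> * (cgauss 1 \<zeta> * of_real 1)) = of_real c"
  proof -
    have "(LINT \<zeta>|lborel. h \<zeta> * (cgauss 1 \<zeta> * of_real 1)) = (LINT x|lborel. LINT \<zeta>|lborel. k x \<zeta> * (cgauss 1 \<zeta> * of_real 1))"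
      by (rule swap[of "\<lambda>_. 1" 1 0, symmetric]) auto
    also have "\<dots> = (LINT x|lborel. of_real (?w x))"
    proof (rule Bochner_Integration.integral_cong[OF refl])
      fix x
      have "k x \<zeta> * (cgauss 1 \<zeta> * of_real 1) = (of_real (G x) * cgauss 1 x) * (cgauss 1 \<zeta> * cis (- 2 * pi * (\<zeta> \<bullet> (- ?\<phi> x))))" for \<zeta>
      proof -
        have "- 2 * pi * (\<zeta> \<bullet> (- ?\<phi> x)) = 2 * pi * (?\<phi> x \<bullet> \<zeta>)"
          unfolding inner_minus_right inner_commute[of \<zeta>] by simp
        then show ?thesis unfolding k_def by (simp only: of_real_1 mult_1_right mult_1_left mult_ac)
      qed
      then have "(LINT \<zeta>|lborel. k x \<zeta> * (cgauss 1 \<zeta> * of_real 1)) = (of_real (G x) * cgauss 1 x) * fourier (cgauss 1) (- ?\<phi> x)"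
        unfolding fourier_def by (simp only: integral_mult_right_zero)
      also have "fourier (cgauss 1) (- ?\<phi> x) = cgauss 1 (?\<phi> x)"
      proof -
        have "fourier (cgauss 1) (- y) = cgauss 1 y" for y :: "real^'n"
          using fourier_gauss[of 1 "- y"] by (simp add: cgauss_def)
        then show ?thesis .
      qed
      finally show "(LINT \<zeta>|lborel. k x \<zeta> * (cgauss 1 \<zeta> * of_real 1)) = of_real (?w x)"
        by (simp only: cgauss_1 of_real_mult mult_ac)
    qed
    finally show ?thesis by (simp only: c_def integral_complex_of_real)
  qed
  have "(\<lambda>n. norm (LINT \<zeta>|lborel. h \<zeta> * (cgauss 1 \<zeta> * of_real (W (Suc n) \<zeta>)))) \<longlonglongrightarrow> norm (complex_of_real c)"
    by (rule tendsto_norm[OF DC[unfolded L]])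
  then have "eventually (\<lambda>n. norm (LINT \<zeta>|lborel. h \<zeta> * (cgauss 1 \<zeta> * of_real (W (Suc n) \<zeta>))) > c / 2) sequentially"
    using c by (intro order_tendstoD) auto
  then obtain N where N: "\<And>n. n \<ge> N \<Longrightarrow> norm (LINT \<zeta>|lborel. h \<zeta> * (cgauss 1 \<zeta> * of_real (W (Suc n) \<zeta>))) > c / 2"
    by (auto simp: eventually_sequentially)
  \<comment> \<open>The limit was taken along \<open>Suc n\<close> to stay away from n = 0, which
    shifts the threshold by one. Half of the limit is kept as the lower bound.\<close>
  have "c / 2 * real n powr m \<le> norm (?B n)" if n: "n \<ge> Suc N" for n
  proof -
    obtain n' where n': "n = Suc n'" "n' \<ge> N" using n by (metis Suc_le_D Suc_le_mono)
    have "c / 2 * real n powr m \<le> norm (LINT \<zeta>|lborel. h \<zeta> * (cgauss 1 \<zeta> * of_real (W n \<zeta>))) * real n powr m"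
      using N[OF n'(2)] by (intro mult_right_mono) (auto simp: n'(1))
    also have "\<dots> = norm (?B n)" using B[of n] n by (simp add: norm_mult)
    finally show ?thesis .
  qed
  then show ?thesis using c by (intro exI[of _ "c / 2"] conjI exI[of _ "Suc N"]) auto
qed

end


section \<open>The classes SG\<close>

text \<open>The order of the indices follows \<open>SG m1 m2\<close>: the first index belongs to
  \<eta>, which is the second component of a point.\<close>

definition sgw :: "real \<times> real \<Rightarrow> (real^'n) \<times> (real^'n) \<Rightarrow> real" where
  "sgw m z = jw (fst m) (snd z) * jw (snd m) (fst z)"

text \<open>Among basis vectors, \<open>snd v = 0\<close> singles out the x-directions, and a
  derivative lowers only the order of its own variable.\<close>

definition sgs :: "(real^'n) \<times> (real^'n) \<Rightarrow> real \<times> real" where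
  "sgs v = (if snd v = 0 then (0, - 1) else (- 1, 0))"

interpretation sg: weight "sgw :: real \<times> real \<Rightarrow> (real^'n) \<times> (real^'n) \<Rightarrow> real" sgs
  by unfold_locales (auto simp: sgw_def powr_add)

lemma Basis_prod_cases:
  assumes "v \<in> (Basis :: ((real^'n) \<times> (real^'n)) set)"
  obtains a where "v = (a, 0)" "a \<in> Basis" | b where "v = (0, b)" "b \<in> Basis" "b \<noteq> 0"
  using assms by (auto simp: Basis_prod_def)

lemma symb_imp_SG:
  assumes "symb sgw sgs (m1, m2) F" shows "F \<in> SG m1 m2"
proof -
  have "\<exists>C. \<forall>x \<eta>. norm (phase_deriv \<alpha> \<beta> F (x, \<eta>))
        \<le> C * japanese \<eta> powr (m1 - real (length \<alpha>)) * japanese x powr (m2 - real (length \<beta>))" for \<alpha> \<beta>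
  proof -
    let ?vs = "map (\<lambda>i. (0, axis i 1)) \<alpha> @ map (\<lambda>i. (axis i 1, 0)) \<beta> :: ((real^'a) \<times> (real^'a)) list"
    have "?vs \<in> lists Basis" by (auto simp: Basis_prod_def Basis_vec)
    then have "symb sgw sgs ((m1, m2) + sum_list (map sgs ?vs)) (iter_deriv ?vs F)"
      by (rule symb_iter_deriv[OF assms])
    moreover have "sum_list (map sgs (map (\<lambda>i. (0, axis i 1) :: (real^'a) \<times> (real^'a)) \<alpha>)) = (- real (length \<alpha>), 0)"
      by (induction \<alpha>) (auto simp: sgs_def zero_prod_def axis_eq_0_iff)
    moreover have "sum_list (map sgs (map (\<lambda>i. (axis i 1, 0) :: (real^'a) \<times> (real^'a)) \<beta>)) = (0, - real (length \<beta>))"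
      by (induction \<beta>) (auto simp: sgs_def zero_prod_def)
    ultimately have "symb sgw sgs (m1 - real (length \<alpha>), m2 - real (length \<beta>)) (phase_deriv \<alpha> \<beta> F)"
      by (simp add: phase_deriv_def)
    from symb_bound[OF this] show ?thesis by (simp add: sgw_def mult.assoc)
  qed
  then show ?thesis using symb_smooth[OF assms] by (simp add: SG_def)
qed

lemma symb_fst:
  fixes f :: "real^'n \<Rightarrow> 'b::real_normed_vector"
  assumes "classical m f" shows "symb sgw sgs (0, m) (\<lambda>z. f (fst z))"
proof (rule symbI)
  fix k
  have "\<forall>m f. symk jw (\<lambda>_. - 1) k m (f :: real^'n \<Rightarrow> 'b) \<longrightarrow> symk sgw sgs k (0, m) (\<lambda>z. f (fst z))"
  proof (induction k)
    case 0
    then show ?case by (auto simp: sgw_def)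
  next
    case (Suc k)
    show ?case
    proof (intro allI impI)
      fix m and f :: "real^'n \<Rightarrow> 'b"
      assume f: "symk jw (\<lambda>_. - 1) (Suc k) m f"
      show "symk sgw sgs (Suc k) (0, m) (\<lambda>z. f (fst z))"
      proof (rule symk_SucI[where D="\<lambda>z v. dir_deriv (fst v) f (fst z)"])
        show "\<exists>C. \<forall>z. norm (f (fst z)) \<le> C * sgw (0, m) z"
          using f by (auto simp: sgw_def)
        have D: "(f has_derivative (\<lambda>v. dir_deriv v f x)) (at x)" for x
          using f by (intro has_derivative_dir_deriv) simp
        show "((\<lambda>z. f (fst z)) has_derivative (\<lambda>v. dir_deriv (fst v) f (fst z))) (at z)" for z :: "(real^'n) \<times> (real^'n)"
          by (rule has_derivative_compose[OF _ D]) (auto intro!: derivative_eq_intros)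
        show "symk sgw sgs k ((0, m) + sgs v) (\<lambda>z. dir_deriv (fst v) f (fst z))" if "v \<in> Basis" for v
          using that
        proof (cases rule: Basis_prod_cases)
          case (1 a)
          then show ?thesis using f Suc.IH[rule_format, of "m - 1" "dir_deriv a f"] by (auto simp: sgs_def)
        next
          case (2 b)
          have "dir_deriv 0 f x = 0" for x using linear_0[OF has_derivative_linear[OF D]] .
          then show ?thesis using 2 by (simp add: sg.symk_zero)
        qed
      qed
    qed
  qed
  then show "symk sgw sgs k (0, m) (\<lambda>z. f (fst z))" using assms by (blast dest: symbD)
qed

text \<open>Interchanging the variables interchanges the two orders, and basis directions are mapped
  to basis directions. It carries the symbol estimates of the first statement over to the
  second.\<close>

lemma symb_swap:
  fixes F :: "(real^'n) \<times> (real^'n) \<Rightarrow> 'b::real_normed_vector"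
  assumes "symb sgw sgs (m1, m2) F" shows "symb sgw sgs (m2, m1) (\<lambda>z. F (snd z, fst z))"
proof (rule symbI)
  fix k
  have bd: "\<exists>C. \<forall>z. norm (F (snd z, fst z)) \<le> C * sgw (m2, m1) z"
    if "\<exists>C. \<forall>z. norm (F z) \<le> C * sgw (m1, m2) z" for m1 m2 and F :: "(real^'n) \<times> (real^'n) \<Rightarrow> 'b"
  proof -
    have "sgw (m2, m1) z = sgw (m1, m2) (snd z, fst z)" for z :: "(real^'n) \<times> (real^'n)"
      by (simp add: sgw_def mult.commute)
    then show ?thesis using that by metis
  qed
  have "\<forall>m1 m2 F. symk sgw sgs k (m1, m2) (F :: (real^'n) \<times> (real^'n) \<Rightarrow> 'b) \<longrightarrow> symk sgw sgs k (m2, m1) (\<lambda>z. F (snd z, fst z))"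
  proof (induction k)
    case 0
    then show ?case using bd by (simp only: symk.simps) blast
  next
    case (Suc k)
    show ?case
    proof (intro allI impI)
      fix m1 m2 and F :: "(real^'n) \<times> (real^'n) \<Rightarrow> 'b"
      assume F: "symk sgw sgs (Suc k) (m1, m2) F"
      show "symk sgw sgs (Suc k) (m2, m1) (\<lambda>z. F (snd z, fst z))"
      proof (rule symk_SucI[where D="\<lambda>z v. dir_deriv (snd v, fst v) F (snd z, fst z)"])
        show "\<exists>C. \<forall>z. norm (F (snd z, fst z)) \<le> C * sgw (m2, m1) z"
          using F by (intro bd) simp
        have D: "(F has_derivative (\<lambda>v. dir_deriv v F x)) (at x)" for x
          using F unfolding symk.simps by (blast intro: has_derivative_dir_deriv)
        show "((\<lambda>z. F (snd z, fst z)) has_derivative (\<lambda>v. dir_deriv (snd v, fst v) F (snd z, fst z))) (at z)" for z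
          by (rule has_derivative_compose[OF _ D]) (auto intro!: derivative_eq_intros)
        show "symk sgw sgs k ((m2, m1) + sgs v) (\<lambda>z. dir_deriv (snd v, fst v) F (snd z, fst z))" if "v \<in> Basis" for v
          using that
        proof (cases rule: Basis_prod_cases)
          case (1 a)
          then have "a \<noteq> 0" "(0, a) \<in> Basis" by (auto simp: Basis_prod_def)
          then have "symk sgw sgs k (m1 - 1, m2) (dir_deriv (0, a) F)" using F by (auto simp: sgs_def)
          then show ?thesis using Suc.IH[rule_format, of "m1 - 1" m2] 1 by (auto simp: sgs_def)
        next
          case (2 b)
          then have "(b, 0) \<in> Basis" by (auto simp: Basis_prod_def)
          then have "symk sgw sgs k (m1, m2 - 1) (dir_deriv (b, 0) F)" using F by (auto simp: sgs_def)
          then show ?thesis using Suc.IH[rule_format, of m1 "m2 - 1"] 2 by (auto simp: sgs_def)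
        qed
      qed
    qed
  qed
  then show "symk sgw sgs k (m2, m1) (\<lambda>z. F (snd z, fst z))" using assms by (blast dest: symbD)
qed

lemma symb_snd:
  fixes f :: "real^'n \<Rightarrow> 'b::real_normed_vector"
  assumes "classical m f" shows "symb sgw sgs (m, 0) (\<lambda>z. f (snd z))"
  using symb_swap[OF symb_fst[OF assms]] by simp

lemma classical_linear: "bounded_linear L \<Longrightarrow> classical 1 L"
  by (rule symbI, rule symk_bounded_linear) auto

lemma symb_phase:
  fixes e :: "real^'n"
  assumes s: "classical 1 s"
  shows "symb sgw sgs (1, 1) (phase e s)"
proof -
  have "symb sgw sgs (1, 1) (\<lambda>z. (\<Sum>b\<in>Basis. (fst z \<bullet> b) * (snd z \<bullet> b)) + s (fst z) * (e \<bullet> snd z))"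
  proof (intro sg.symb_add sg.symb_sum finite_Basis)
    fix b :: "real^'n"
    show "symb sgw sgs (1, 1) (\<lambda>z. (fst z \<bullet> b) * (snd z \<bullet> b))"
      using sg.symb_mult[OF symb_fst[OF classical_linear[OF bounded_linear_inner_left]] symb_snd[OF classical_linear[OF bounded_linear_inner_left]], of b b]
      by simp
    show "symb sgw sgs (1, 1) (\<lambda>z. s (fst z) * (e \<bullet> snd z))"
      using sg.symb_mult[OF symb_fst[OF s] symb_snd[OF classical_linear[OF bounded_linear_inner_right]], of e]
      by simp
  qed
  moreover have "phase e s = (\<lambda>z. (\<Sum>b\<in>Basis. (fst z \<bullet> b) * (snd z \<bullet> b)) + s (fst z) * (e \<bullet> snd z))"
    unfolding phase_def[abs_def] by (auto simp flip: euclidean_inner)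
  ultimately show ?thesis by simp
qed

lemma classical_jw: "m' \<le> m \<Longrightarrow> classical m (jw m' :: 'a::euclidean_space \<Rightarrow> real)"
  by (rule symbI, rule symk_jw_mono[OF _ order_refl symk_jw])

lemma symb_amp:
  fixes G :: "real^'n \<Rightarrow> real"
  assumes "classical m2 G" "m' \<le> m"
  shows "symb sgw sgs (m, m2) (amp m' G)"
proof -
  have "symb sgw sgs ((0, m2) + (m, 0)) (\<lambda>z. complex_of_real (G (fst z) * jw m' (snd z)))"
    by (intro sg.symb_of_real sg.symb_mult symb_fst symb_snd assms classical_jw)
  then show ?thesis by (simp add: amp_def[abs_def])
qed

section \<open>The mixed Hessian of the phase and its determinant\<close>

lemma det_replace_column: "det (\<chi> i l. if l = k then c i else if i = l then 1 else (0::real)) = c (k :: 'n::finite)"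
  using cramer_lemma[where A="mat 1 :: real^'n^'n" and k=k and x="\<chi> i. c i"]
  unfolding matrix_vector_mul_lid det_I by (simp add: mat_def cong: if_cong)

text \<open>The phase is linear in \<eta>, so the \<eta>-derivative is the displaced point itself
  and the mixed Hessian is the identity plus the product of the gradient of \<open>s\<close> with e.
  Swapping the variables gives the transposed matrix.\<close>

lemma phase_derivs:
  fixes s :: "real^'n \<Rightarrow> real"
  assumes sc: "classical m s"
  shows "dir_deriv (axis i 1, 0) (dir_deriv (0, axis l 1) (phase e s)) (x, \<eta>)
      = (if i = l then 1 else 0) + dir_deriv (axis i 1) s x * (e $ l)"
    and "dir_deriv (axis i 1, 0) (dir_deriv (0, axis l 1) (\<lambda>z. phase e s (snd z, fst z))) (x, \<eta>)
      = (if i = l then 1 else 0) + dir_deriv (axis l 1) s \<eta> * (e $ i)"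
proof -
  have s: "(s has_derivative (\<lambda>v. dir_deriv v s x)) (at x)" for x
    by (rule symb_has_derivative[OF sc])
  have s0: "dir_deriv 0 s x = 0" for x using linear_0[OF has_derivative_linear[OF s]] .
  have sf: "((\<lambda>z. s (fst z)) has_derivative (\<lambda>v. dir_deriv (fst v) s (fst z))) (at z)" for z :: "(real^'n) \<times> (real^'n)"
    by (rule has_derivative_compose[OF _ s]) (auto intro!: derivative_eq_intros)
  have ss: "((\<lambda>z. s (snd z)) has_derivative (\<lambda>v. dir_deriv (snd v) s (snd z))) (at z)" for z :: "(real^'n) \<times> (real^'n)"
    by (rule has_derivative_compose[OF _ s]) (auto intro!: derivative_eq_intros)
  have 1: "dir_deriv (0, axis l 1) (phase e s) = (\<lambda>z. fst z $ l + s (fst z) * (e $ l))"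
  proof
    fix z
    have "(phase e s has_derivative (\<lambda>v. (fst z \<bullet> snd v + fst v \<bullet> snd z) + (s (fst z) * (e \<bullet> snd v) + dir_deriv (fst v) s (fst z) * (e \<bullet> snd z)))) (at z)"
      unfolding phase_def[abs_def] by (auto intro!: derivative_eq_intros sf)
    from dir_deriv_eqI[OF this] show "dir_deriv (0, axis l 1) (phase e s) z = fst z $ l + s (fst z) * (e $ l)"
      by (simp add: s0 inner_axis)
  qed
  have "((\<lambda>z. fst z $ l + s (fst z) * (e $ l)) has_derivative (\<lambda>v. fst v $ l + dir_deriv (fst v) s (fst z) * (e $ l))) (at z)" for z :: "(real^'n) \<times> (real^'n)"
    by (auto intro!: derivative_eq_intros sf bounded_linear.has_derivative[OF bounded_linear_vec_nth])
  from dir_deriv_eqI[OF this] show "dir_deriv (axis i 1, 0) (dir_deriv (0, axis l 1) (phase e s)) (x, \<eta>)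
      = (if i = l then 1 else 0) + dir_deriv (axis i 1) s x * (e $ l)"
    unfolding 1 by (simp add: axis_def)
  have 2: "dir_deriv (0, axis l 1) (\<lambda>z. phase e s (snd z, fst z)) = (\<lambda>z. fst z $ l + dir_deriv (axis l 1) s (snd z) * (e \<bullet> fst z))"
  proof
    fix z
    have "((\<lambda>z. phase e s (snd z, fst z)) has_derivative (\<lambda>v. (snd z \<bullet> fst v + snd v \<bullet> fst z) + (s (snd z) * (e \<bullet> fst v) + dir_deriv (snd v) s (snd z) * (e \<bullet> fst z)))) (at z)"
      unfolding phase_def fst_conv snd_conv by (auto intro!: derivative_eq_intros ss)
    from dir_deriv_eqI[OF this] show "dir_deriv (0, axis l 1) (\<lambda>z. phase e s (snd z, fst z)) z = fst z $ l + dir_deriv (axis l 1) s (snd z) * (e \<bullet> fst z)"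
      by (simp add: inner_axis inner_commute[of "axis l 1"])
  qed
  show "dir_deriv (axis i 1, 0) (dir_deriv (0, axis l 1) (\<lambda>z. phase e s (snd z, fst z))) (x, \<eta>)
      = (if i = l then 1 else 0) + dir_deriv (axis l 1) s \<eta> * (e $ i)"
  proof -
    let ?d = "dir_deriv (axis l 1) s"
    have d: "classical (m + - 1) ?d" by (rule symb_dir_deriv[OF sc]) (simp add: Basis_vec)
    have d0: "dir_deriv 0 ?d x = 0" for x using linear_0[OF has_derivative_linear[OF symb_has_derivative[OF d]]] .
    have dz: "((\<lambda>z. ?d (snd z)) has_derivative (\<lambda>v. dir_deriv (snd v) ?d (snd z))) (at z)" for z :: "(real^'n) \<times> (real^'n)"
      by (rule has_derivative_compose[OF _ symb_has_derivative[OF d]]) (auto intro!: derivative_eq_intros)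
    have "((\<lambda>z. fst z $ l + ?d (snd z) * (e \<bullet> fst z)) has_derivative
        (\<lambda>v. fst v $ l + (?d (snd z) * (e \<bullet> fst v) + dir_deriv (snd v) ?d (snd z) * (e \<bullet> fst z)))) (at z)" for z :: "(real^'n) \<times> (real^'n)"
      by (auto intro!: derivative_eq_intros dz bounded_linear.has_derivative[OF bounded_linear_vec_nth])
    from dir_deriv_eqI[OF this] show ?thesis
      unfolding 2 by (simp add: d0 inner_axis) (simp add: axis_def)
  qed
qed

text \<open>For a coordinate direction e the rank-one perturbation affects a single column, so
  Cramer's lemma evaluates the determinant as 1 plus the derivative of \<open>s\<close> along
  e.\<close>

lemma nondegenerate_phase:
  fixes s :: "real^'n \<Rightarrow> real"
  assumes s: "classical m s" and d: "\<And>x. \<bar>dir_deriv (axis k 1) s x\<bar> \<le> 1 / 2"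
  shows "nondegenerate (phase (axis k 1) s)"
    and "nondegenerate (\<lambda>z. phase (axis k 1) s (snd z, fst z))"
proof -
  let ?M = "\<lambda>x. (\<chi> i l. if l = k then (if i = k then 1 else 0) + dir_deriv (axis i 1) s x else if i = l then 1 else 0) :: real^'n^'n"
  have M: "det (?M x) = 1 + dir_deriv (axis k 1) s x" for x
    by (subst det_replace_column) simp
  \<comment> \<open>The determinant is at least 1/2; the smaller constant provides the strict
    inequality of \<open>nondegenerate\<close>.\<close>
  have pos: "\<bar>1 + dir_deriv (axis k 1) s x\<bar> > 1 / 4" for x using d[of x] by linarith
  have 1: "(\<chi> i l. dir_deriv (axis i 1, 0) (dir_deriv (0, axis l 1) (phase (axis k 1) s)) (x, \<eta>)) = ?M x" for x \<eta>
    unfolding phase_derivs(1)[OF s] by (auto simp: vec_eq_iff axis_def)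
  have 2: "(\<chi> i l. dir_deriv (axis i 1, 0) (dir_deriv (0, axis l 1) (\<lambda>z. phase (axis k 1) s (snd z, fst z))) (x, \<eta>)) = transpose (?M \<eta>)" for x \<eta>
    unfolding phase_derivs(2)[OF s] by (auto simp: vec_eq_iff axis_def transpose_def)
  show "nondegenerate (phase (axis k 1) s)"
    unfolding nondegenerate_def 1 M using pos by (intro exI[of _ "1 / 4"]) auto
  show "nondegenerate (\<lambda>z. phase (axis k 1) s (snd z, fst z))"
    unfolding nondegenerate_def 2 det_transpose M using pos by (intro exI[of _ "1 / 4"]) auto
qed


section \<open>Cutoff functions\<close>

text \<open>The powers of 1 / t close the family under differentiation: the derivative of member j
  is a combination of members j + 1 and j + 2. All derivatives of the flat exponential are thereby
  covered.\<close>

definition flatexp :: "nat \<Rightarrow> real \<Rightarrow> real" where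
  "flatexp j t = (if t > 0 then (1 / t) ^ j * exp (- 1 / t) else 0)"

lemma power_le_fact_exp: "0 \<le> u \<Longrightarrow> u ^ j \<le> fact j * exp (u :: real)"
proof -
  assume u: "0 \<le> u"
  have "(\<Sum>n\<in>{j}. inverse (fact n) * u ^ n) \<le> (\<Sum>n. inverse (fact n) * u ^ n)"
    using u by (intro sum_le_suminf summable_exp) auto
  then have "inverse (fact j) * u ^ j \<le> exp u" by (simp add: exp_def scaleR_conv_of_real)
  then show ?thesis by (simp add: field_simps)
qed

lemma flat_bounds: "0 \<le> flatexp j t" "flatexp j t \<le> fact j"
  using power_le_fact_exp[of "1 / t" j] by (auto simp: flatexp_def exp_minus field_simps)

lemma flat_has_derivative:
  "(flatexp j has_real_derivative (flatexp (Suc (Suc j)) t - j * flatexp (Suc j) t)) (at t)"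
proof (cases t "0 :: real" rule: linorder_cases)
  case less
  have "((\<lambda>t. 0) has_real_derivative 0) (at t)" by simp
  moreover have "eventually (\<lambda>x. flatexp j x = 0) (nhds t)"
    using eventually_nhds_in_open[of "{..<0}" t] less by (auto elim!: eventually_mono simp: flatexp_def)
  ultimately show ?thesis
    using less by (subst DERIV_cong_ev[OF refl _ refl, of _ "\<lambda>_. 0"]) (auto simp: flatexp_def)
next
  case greater
  have "((\<lambda>t. (1 / t) ^ j * exp (- 1 / t)) has_real_derivative
     (flatexp (Suc (Suc j)) t - j * flatexp (Suc j) t)) (at t)"
  proof (cases j)
    case 0
    then show ?thesis
      using greater by (auto intro!: derivative_eq_intros simp: flatexp_def field_simps power2_eq_square)
  next
    case (Suc i)
    have u: "((\<lambda>t. 1 / t) has_real_derivative - (1 / t * (1 / t))) (at t)"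
      and ex: "((\<lambda>t. exp (- 1 / t)) has_real_derivative exp (- 1 / t) * (1 / t * (1 / t))) (at t)"
      using greater by (auto intro!: derivative_eq_intros simp: power2_eq_square)
    have "(1 + of_nat i) * (- (1 / t * (1 / t)) * (1 / t) ^ i) * exp (- 1 / t) + exp (- 1 / t) * (1 / t * (1 / t)) * (1 / t) ^ Suc i
      = flatexp (Suc (Suc j)) t - j * flatexp (Suc j) t"
      using greater Suc unfolding flatexp_def by (simp add: algebra_simps)
    with DERIV_mult[OF DERIV_power_Suc[OF u, of i] ex] show ?thesis
      unfolding Suc by (simp only:)
  qed
  moreover have "eventually (\<lambda>x. flatexp j x = (1 / x) ^ j * exp (- 1 / x)) (nhds t)"
    using eventually_nhds_in_open[of "{0<..}" t] greater by (auto elim!: eventually_mono simp: flatexp_def)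
  ultimately show ?thesis
    using greater by (subst DERIV_cong_ev[OF refl _ refl, of _ "\<lambda>t. (1 / t) ^ j * exp (- 1 / t)"]) auto
next
  case equal
  have "((\<lambda>h. (flatexp j (0 + h) - flatexp j 0) / h) \<longlongrightarrow> 0) (at 0)"
  proof (rule Lim_null_comparison)
    \<comment> \<open>For h > 0 the quotient equals h times member j + 2 of the family, which is
      bounded by a factorial.\<close>
    have "norm ((flatexp j (0 + h) - flatexp j 0) / h) \<le> fact (Suc (Suc j)) * \<bar>h\<bar>" for h
    proof (cases "h > 0")
      case True
      then have "flatexp j h / h = flatexp (Suc (Suc j)) h * h" by (simp add: flatexp_def field_simps)
      then show ?thesis
        using True flat_bounds[of "Suc (Suc j)" h] flat_bounds(1)[of j h] mult_right_mono[OF flat_bounds(2)[of "Suc (Suc j)" h], of h]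
        by (simp add: flatexp_def[of j 0] abs_mult)
    next
      case False
      then have "flatexp j (0 + h) = 0" "flatexp j 0 = 0" by (auto simp: flatexp_def)
      then show ?thesis by (simp del: fact_Suc)
    qed
    then show "\<forall>\<^sub>F h in at 0. norm ((flatexp j (0 + h) - flatexp j 0) / h) \<le> fact (Suc (Suc j)) * \<bar>h\<bar>" by simp
    show "((\<lambda>h. fact (Suc (Suc j)) * \<bar>h\<bar>) \<longlongrightarrow> 0) (at (0::real))" by (auto intro!: tendsto_eq_intros)
  qed
  then show ?thesis using equal by (simp add: DERIV_def flatexp_def)
qed

lemma flat_comp_has_derivative:
  assumes "(q has_derivative D) (at x)"
  shows "((\<lambda>x. flatexp j (q x)) has_derivative (\<lambda>v. (flatexp (Suc (Suc j)) (q x) - j * flatexp (Suc j) (q x)) * D v)) (at x)"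
  using has_derivative_compose[OF assms flat_has_derivative[unfolded has_field_derivative_def]] by simp

text \<open>Satisfied by smooth functions of compact support. In this form the symbol estimates for
  cutoffs and phases can be carried through products and square roots without tracking
  supports.\<close>

abbreviation rapid :: "('a::euclidean_space \<Rightarrow> 'b::real_normed_vector) \<Rightarrow> bool" where
  "rapid f \<equiv> (\<forall>m. classical m f)"

lemma rapid_mult: "rapid f \<Longrightarrow> classical m h \<Longrightarrow> rapid (\<lambda>x. f x * h x :: real)"
proof
  fix m' assume "rapid f" "classical m h"
  then have "classical ((m' - m) + m) (\<lambda>x. f x * h x)" by (intro jw.symb_mult) auto
  then show "classical m' (\<lambda>x. f x * h x)" by simp
qed

lemma jw_compact_bound:
  fixes f :: "'a::euclidean_space \<Rightarrow> real"
  assumes f: "\<And>x. \<bar>f x\<bar> \<le> K" and supp: "\<And>x. f x \<noteq> 0 \<Longrightarrow> norm x \<le> R" and R: "R \<ge> 0"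
  shows "\<exists>C. \<forall>x. norm (f x) \<le> C * jw m x"
proof (intro exI allI)
  fix x
  have K: "K \<ge> 0" using order_trans[OF abs_ge_zero f[of 0]] .
  show "norm (f x) \<le> K * (1 + R) powr \<bar>m\<bar> * jw m x"
  proof (cases "f x = 0")
    case False
    have "japanese x \<le> 1 + R" using japanese_le[of x] supp[OF False] by simp
    then have "jw (- m) x \<le> (1 + R) powr \<bar>m\<bar>"
      using powr_mono_japanese[of "- m" "\<bar>m\<bar>" x] powr_mono2[of "\<bar>m\<bar>" "japanese x" "1 + R"]
        abs_ge_minus_self[of m] by simp
    then have "jw (- m) x * jw m x \<le> (1 + R) powr \<bar>m\<bar> * jw m x" by (rule mult_right_mono) simp
    then have "K * 1 \<le> K * ((1 + R) powr \<bar>m\<bar> * jw m x)"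
      using K by (intro mult_left_mono) (simp_all flip: powr_add)
    then show ?thesis using f[of x] by (simp add: mult.assoc)
  qed (use K in simp)
qed

lemma rapid_flat: "rapid (\<lambda>x::'a::euclidean_space. flatexp j (a - x \<bullet> x))"
proof (intro allI symbI)
  fix m k
  show "symk jw (\<lambda>_. - 1) k m (\<lambda>x::'a. flatexp j (a - x \<bullet> x))"
  proof (induction k arbitrary: j m)
    have bd: "\<exists>C. \<forall>x::'a. norm (flatexp j (a - x \<bullet> x)) \<le> C * jw m x" for j m
    proof (rule jw_compact_bound)
      show "\<bar>flatexp j (a - x \<bullet> x)\<bar> \<le> fact j" for x :: 'a using flat_bounds by simp
      show "norm x \<le> sqrt \<bar>a\<bar>" if "flatexp j (a - x \<bullet> x) \<noteq> 0" for x :: 'a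
        using that by (auto simp: flatexp_def norm_eq_sqrt_inner split: if_splits)
    qed simp
    {
      case 0
      then show ?case using bd by simp
    next
      case (Suc k)
      show ?case
      proof (rule symk_SucI)
        show "\<exists>C. \<forall>x::'a. norm (flatexp j (a - x \<bullet> x)) \<le> C * jw m x" by (rule bd)
        show "((\<lambda>x::'a. flatexp j (a - x \<bullet> x)) has_derivative
          (\<lambda>v. (flatexp (Suc (Suc j)) (a - x \<bullet> x) - j * flatexp (Suc j) (a - x \<bullet> x)) * (- 2 * (x \<bullet> v)))) (at x)" for x
          by (rule flat_comp_has_derivative) (auto intro!: derivative_eq_intros simp: inner_commute)
        fix v :: 'a
        have "symk jw (\<lambda>_. - 1) k ((m - 2) + 1) (\<lambda>x. (flatexp (Suc (Suc j)) (a - x \<bullet> x) - j * flatexp (Suc j) (a - x \<bullet> x)) * (- 2 * (x \<bullet> v)))"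
          by (intro jw.symk_mult jw.symk_diff jw.symk_cmult Suc symk_bounded_linear bounded_linear_inner_left) simp
        then show "symk jw (\<lambda>_. - 1) k (m + - 1) (\<lambda>x. (flatexp (Suc (Suc j)) (a - x \<bullet> x) - j * flatexp (Suc j) (a - x \<bullet> x)) * (- 2 * (x \<bullet> v)))"
          by simp
      qed
    }
  qed
qed

text \<open>For large \<open>t\<close> the function \<open>flatexp j t\<close> behaves like the \<open>j\<close>-th power of \<open>1 / t\<close>.\<close>

lemma classical_flat:
  assumes b: "b \<ge> 0"
  shows "classical 0 (\<lambda>x::'a::euclidean_space. flatexp 0 (x \<bullet> x - b))"
proof (rule symbI)
  fix k
  have "symk jw (\<lambda>_. - 1) k (- 2 * real j) (\<lambda>x::'a. flatexp j (x \<bullet> x - b))" for j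
  proof (induction k arbitrary: j)
    have bd: "\<exists>C. \<forall>x::'a. norm (flatexp j (x \<bullet> x - b)) \<le> C * jw (- 2 * real j) x" for j
    proof (intro exI allI)
      fix x :: 'a
      let ?t = "x \<bullet> x - b"
      have J: "jw (- 2 * real j) x = (1 / (1 + x \<bullet> x)) ^ j"
        by (simp add: japanese_powr_eq powr_minus powr_realpow add_pos_nonneg power_one_over inverse_eq_divide)
      show "norm (flatexp j ?t) \<le> ((2 + b) ^ j * (fact j * exp 1)) * jw (- 2 * real j) x"
      proof (cases "?t > 0")
        case True
        have "(1 + x \<bullet> x) / ?t = 1 + (1 + b) * (1 / ?t)" using True by (simp add: field_simps)
        also have "\<dots> \<le> (2 + b) * (1 + 1 / ?t)"
        proof -
          have "1 + (1 + b) * u \<le> (2 + b) * (1 + u)" if "u \<ge> 0" for u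
            using b that by (simp add: algebra_simps)
          from this[of "1 / ?t"] show ?thesis using True by simp
        qed
        finally have "((1 + x \<bullet> x) / ?t) ^ j \<le> ((2 + b) * (1 + 1 / ?t)) ^ j"
          using True by (intro power_mono) (auto simp: add_nonneg_nonneg)
        also have "\<dots> \<le> (2 + b) ^ j * (fact j * exp (1 + 1 / ?t))"
          unfolding power_mult_distrib using True b by (intro mult_left_mono power_le_fact_exp) auto
        finally have "((1 + x \<bullet> x) / ?t) ^ j * exp (- 1 / ?t) \<le> (2 + b) ^ j * (fact j * exp (1 + 1 / ?t)) * exp (- 1 / ?t)"
          by (rule mult_right_mono) simp
        also have "\<dots> = (2 + b) ^ j * (fact j * exp 1)" by (simp add: mult.assoc flip: exp_add)
        finally have "((1 + x \<bullet> x) / ?t) ^ j * exp (- 1 / ?t) * (1 / (1 + x \<bullet> x)) ^ j \<le> ((2 + b) ^ j * (fact j * exp 1)) * (1 / (1 + x \<bullet> x)) ^ j"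
          by (rule mult_right_mono) (simp add: add_nonneg_nonneg)
        moreover have "((1 + x \<bullet> x) / ?t) ^ j * exp (- 1 / ?t) * (1 / (1 + x \<bullet> x)) ^ j = flatexp j ?t"
        proof -
          have "1 + x \<bullet> x \<noteq> 0" using inner_ge_zero[of x] by linarith
          then have "((1 + x \<bullet> x) / ?t) * (1 / (1 + x \<bullet> x)) = 1 / ?t" by simp
          then have "((1 + x \<bullet> x) / ?t) ^ j * (1 / (1 + x \<bullet> x)) ^ j = (1 / ?t) ^ j" by (simp only: power_mult_distrib[symmetric])
          then show ?thesis using True unfolding flatexp_def by (simp add: mult_ac)
        qed
        ultimately show ?thesis using flat_bounds(1)[of j ?t] unfolding J by simp
      qed (use b in \<open>simp add: flatexp_def\<close>)
    qed
    {
      case 0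
      show ?case using bd by simp
    next
      case (Suc k)
      show ?case
      proof (rule symk_SucI)
        show "\<exists>C. \<forall>x::'a. norm (flatexp j (x \<bullet> x - b)) \<le> C * jw (- 2 * real j) x" by (rule bd)
        show "((\<lambda>x::'a. flatexp j (x \<bullet> x - b)) has_derivative
          (\<lambda>v. (flatexp (Suc (Suc j)) (x \<bullet> x - b) - j * flatexp (Suc j) (x \<bullet> x - b)) * (2 * (x \<bullet> v)))) (at x)" for x
          by (rule flat_comp_has_derivative) (auto intro!: derivative_eq_intros simp: inner_commute)
        fix v :: 'a
        have "symk jw (\<lambda>_. - 1) k (- 2 * real (Suc j) + 1) (\<lambda>x. (flatexp (Suc (Suc j)) (x \<bullet> x - b) - j * flatexp (Suc j) (x \<bullet> x - b)) * (2 * (x \<bullet> v)))"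
          by (intro jw.symk_mult jw.symk_diff jw.symk_cmult symk_bounded_linear bounded_linear_inner_left Suc
                symk_jw_mono[OF _ order_refl Suc[of "Suc (Suc j)"]]) auto
        then show "symk jw (\<lambda>_. - 1) k (- 2 * real j + - 1) (\<lambda>x. (flatexp (Suc (Suc j)) (x \<bullet> x - b) - j * flatexp (Suc j) (x \<bullet> x - b)) * (2 * (x \<bullet> v)))"
          by (simp add: algebra_simps)
      qed
    }
  qed
  from this[of 0] show "symk jw (\<lambda>_. - 1) k 0 (\<lambda>x::'a. flatexp 0 (x \<bullet> x - b))" by simp
qed

text \<open>The derivative is a w^{a - 1} times a derivative of w, again a power times a known
  symbol, so the induction runs over all exponents. The positive lower bound controls negative
  powers.\<close>

lemma classical_powr:
  fixes w :: "'a::euclidean_space \<Rightarrow> real"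
  assumes w: "classical 0 w" and bd: "\<And>x. c \<le> w x" "\<And>x. w x \<le> K" and c: "c > 0"
  shows "classical 0 (\<lambda>x. w x powr a)"
proof (rule symbI)
  fix k
  show "symk jw (\<lambda>_. - 1) k 0 (\<lambda>x. w x powr a)"
  proof (induction k arbitrary: a)
    have b: "\<exists>C. \<forall>x. norm (w x powr a) \<le> C * jw 0 x" for a
    proof (intro exI allI)
      fix x
      show "norm (w x powr a) \<le> (c powr a + K powr a) * jw 0 x"
      proof (cases "a \<ge> 0")
        case True
        then have "w x powr a \<le> K powr a" using bd[of x] c by (intro powr_mono2) auto
        then show ?thesis by simp (smt (verit) powr_ge_zero)
      next
        case False
        then have "w x powr a \<le> c powr a" using bd[of x] c by (intro powr_mono2') auto
        then show ?thesis by simp (smt (verit) powr_ge_zero)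
      qed
    qed
    {
      case 0
      show ?case using b by simp
    next
      case (Suc k)
      show ?case
      proof (rule symk_SucI)
        show "\<exists>C. \<forall>x. norm (w x powr a) \<le> C * jw 0 x" by (rule b)
        show "((\<lambda>x. w x powr a) has_derivative (\<lambda>v. a * (w x powr (a - 1) * dir_deriv v w x))) (at x)" for x
        proof -
          have p: "w x > 0" using bd(1)[of x] c by simp
          have "((\<lambda>x. w x powr a) has_derivative (\<lambda>v. w x powr a * (0 * ln (w x) + dir_deriv v w x * a / w x))) (at x)"
            by (rule has_derivative_powr[OF symb_has_derivative[OF w] has_derivative_const]) (use p in auto)
          moreover have "w x powr (a - 1) = w x powr a / w x" using p by (simp add: powr_diff)
          ultimately show ?thesis by (simp add: field_simps)
        qed
        fix v :: 'a assume v: "v \<in> Basis"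
        have "symk jw (\<lambda>_. - 1) k (0 + (0 + - 1)) (\<lambda>x. w x powr (a - 1) * dir_deriv v w x)"
          by (rule jw.symk_mult[OF Suc symbD[OF symb_dir_deriv[OF w v]]])
        then show "symk jw (\<lambda>_. - 1) k (0 + - 1) (\<lambda>x. a * (w x powr (a - 1) * dir_deriv v w x))"
          by (intro jw.symk_cmult) simp
      qed
    }
  qed
qed

lemma classical_imp_bounded:
  fixes f :: "'a::euclidean_space \<Rightarrow> real"
  assumes "classical 0 f" obtains K where "K > 0" "\<And>x. \<bar>f x\<bar> \<le> K"
  using jw.bound_pos[OF symb_bound[OF assms]] that by auto

text \<open>The usual quotient f / (f + h), with f vanishing for |x| \<ge> 2 and h vanishing for |x|
  \<le> 1. The two transition regions overlap enough for one argument to be at least 1 everywhere,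
  and this bounds the denominator below by exp (- 1).\<close>

lemma plateau:
  obtains cut :: "'a::euclidean_space \<Rightarrow> real" where "rapid cut" "\<And>x. norm x \<le> 1 \<Longrightarrow> cut x = 1"
proof -
  let ?f = "\<lambda>x::'a. flatexp 0 (4 - x \<bullet> x)"
  let ?h = "\<lambda>x::'a. flatexp 0 (x \<bullet> x - 1)"
  have mono: "flatexp 0 t \<ge> exp (- 1)" if "t \<ge> 1" for t
    using that by (simp add: flatexp_def)
  have lower: "?f x + ?h x \<ge> exp (- 1)" for x
  proof (cases "x \<bullet> x \<le> 3")
    case True
    then show ?thesis using mono[of "4 - x \<bullet> x"] flat_bounds(1)[of 0 "x \<bullet> x - 1"] by linarith
  next
    case False
    then show ?thesis using mono[of "x \<bullet> x - 1"] flat_bounds(1)[of 0 "4 - x \<bullet> x"] by linarith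
  qed
  have upper: "?f x + ?h x \<le> 2" for x
    using flat_bounds(2)[of 0 "4 - x \<bullet> x"] flat_bounds(2)[of 0 "x \<bullet> x - 1"] by simp
  have "classical 0 (\<lambda>x. ?f x + ?h x)"
    by (intro jw.symb_add classical_flat rapid_flat[rule_format]) simp
  then have "classical 0 (\<lambda>x. (?f x + ?h x) powr (- 1))"
    by (rule classical_powr[OF _ lower upper]) simp
  then have "rapid (\<lambda>x. ?f x * (?f x + ?h x) powr (- 1))"
    by (rule rapid_mult[OF rapid_flat])
  moreover have "?f x * (?f x + ?h x) powr (- 1) = 1" if "norm x \<le> 1" for x
  proof -
    have "x \<bullet> x \<le> 1" using that by (simp add: norm_eq_sqrt_inner)
    then have "?h x = 0" "?f x > 0" by (auto simp: flatexp_def)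
    then show ?thesis by (simp add: powr_minus)
  qed
  ultimately show thesis by (rule that)
qed

text \<open>The factor \<open>exp 1\<close> normalises the value at the origin to 1. The support
  lies in the unit ball, where the cutoffs are 1 and the phases have their prescribed form.\<close>

definition bump :: "'a::euclidean_space \<Rightarrow> real" where
  "bump x = exp 1 * flatexp 0 (1 - x \<bullet> x)"

lemma rapid_bump: "rapid bump"
  unfolding bump_def[abs_def] using rapid_flat[of 0 1] by (auto intro: jw.symb_cmult)

lemma bump_props: "bump 0 = 1" "0 \<le> bump x \<and> bump x \<le> 1" "bump x \<noteq> 0 \<Longrightarrow> norm x \<le> 1"
proof -
  show "bump (0::'a) = 1" by (simp add: bump_def flatexp_def flip: exp_add)
  show "0 \<le> bump x \<and> bump x \<le> 1"
  proof (cases "x \<bullet> x < 1")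
    case True
    then have "exp 1 * exp (- 1 / (1 - x \<bullet> x)) \<le> exp 0"
      unfolding exp_add[symmetric] by (intro exp_le_cancel_iff[THEN iffD2]) (simp add: field_simps)
    then show ?thesis using True by (simp add: bump_def flatexp_def)
  qed (simp add: bump_def flatexp_def)
  show "bump x \<noteq> 0 \<Longrightarrow> norm x \<le> 1"
    by (auto simp: bump_def flatexp_def norm_eq_sqrt_inner split: if_splits)
qed


section \<open>The phases\<close>

lemma classical_inner_self: "classical 2 (\<lambda>x::'a::euclidean_space. x \<bullet> x)"
proof -
  have "classical (1 + 1) (\<lambda>x::'a. (x \<bullet> b) * (x \<bullet> b))" for b
    by (intro jw.symb_mult symbI symk_bounded_linear bounded_linear_inner_left) auto
  then have "classical 2 (\<lambda>x::'a. \<Sum>b\<in>Basis. (x \<bullet> b) * (x \<bullet> b))"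
    by (intro jw.symb_sum) auto
  then show ?thesis by (simp flip: euclidean_inner)
qed

lemma rapid_derivative_bounded:
  fixes f :: "'a::euclidean_space \<Rightarrow> real"
  assumes "rapid f" "v \<in> Basis" obtains K where "K > 0" "\<And>x. \<bar>f x\<bar> \<le> K" "\<And>x. \<bar>dir_deriv v f x\<bar> \<le> K"
proof -
  have "classical 0 f" "classical 0 (dir_deriv v f)"
    using assms(1) symb_dir_deriv[OF assms(1)[rule_format, of 1] assms(2)] by auto
  then obtain K K' where K: "K > 0" "\<And>x. \<bar>f x\<bar> \<le> K" "K' > 0" "\<And>x. \<bar>dir_deriv v f x\<bar> \<le> K'"
    using classical_imp_bounded by metis
  show thesis
  proof (rule that[of "K + K'"])
    show "K + K' > 0" "\<bar>f x\<bar> \<le> K + K'" "\<bar>dir_deriv v f x\<bar> \<le> K + K'" for x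
      using K(1,3) K(2,4)[of x] by linarith+
  qed
qed

text \<open>The truncated square has a bounded derivative, and the small factor l brings it below
  1/2. Since l does not depend on n, it affects only constants in the norm estimates.\<close>

lemma quadratic_phase:
  fixes e :: "'a::euclidean_space"
  assumes e: "e \<in> Basis"
  obtains l s where "l > 0" "rapid s" "\<And>x. \<bar>dir_deriv e s x\<bar> \<le> 1 / 2"
    "\<And>x::'a. norm x \<le> 1 \<Longrightarrow> s x = l / 2 * (x \<bullet> x)"
proof -
  obtain cut :: "'a \<Rightarrow> real" where cut: "rapid cut" "\<And>x. norm x \<le> 1 \<Longrightarrow> cut x = 1"
  proof (rule plateau[where 'a='a], goal_cases)
    case (1 cut)
    show ?case by (rule 1(1)[OF 1(2,3)])
  qed
  let ?u = "\<lambda>x. cut x * (x \<bullet> x)"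
  have u: "rapid ?u" by (rule rapid_mult[OF cut(1) classical_inner_self])
  obtain K where K: "K > 0" "\<And>x. \<bar>dir_deriv e ?u x\<bar> \<le> K"

  proof (rule rapid_derivative_bounded[OF u e], goal_cases)
    case (1 K)
    show ?case by (rule 1(1)[OF 1(2,4)])
  qed
  define l where "l = 1 / K"
  show thesis
  proof (rule that[of l "\<lambda>x. l / 2 * ?u x"])
    show "l > 0" using K by (simp add: l_def)
    show "rapid (\<lambda>x. l / 2 * ?u x)" by (intro allI jw.symb_cmult u[rule_format])
    show "\<bar>dir_deriv e (\<lambda>x. l / 2 * ?u x) x\<bar> \<le> 1 / 2" for x
    proof -
      have "((\<lambda>x. l / 2 * ?u x) has_derivative (\<lambda>v. l / 2 * dir_deriv v ?u x)) (at x)"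
        by (rule bounded_linear.has_derivative[OF bounded_linear_mult_right symb_has_derivative[OF u[rule_format, of 0]]])
      then have eq: "dir_deriv e (\<lambda>x. l / 2 * ?u x) x = l / 2 * dir_deriv e ?u x"
        by (rule dir_deriv_eqI)
      have "\<bar>l / 2 * dir_deriv e ?u x\<bar> \<le> l / 2 * K"
        unfolding abs_mult using K by (intro mult_mono) (auto simp: l_def)
      moreover have "l / 2 * K = 1 / 2" using K(1) by (simp add: l_def)
      ultimately show ?thesis unfolding eq by linarith
    qed
    show "l / 2 * ?u x = l / 2 * (x \<bullet> x)" if "norm x \<le> 1" for x using cut(2)[OF that] by simp
  qed
qed

lemma sqrt_one_plus:
  fixes w :: real
  assumes "\<bar>w\<bar> \<le> 1 / 2"
  shows "\<bar>(1 + w) powr (1 / 2) - 1\<bar> \<le> \<bar>w\<bar>" "(1 + w) powr (- 1 / 2) \<le> 2" "\<bar>(1 + w) powr (- 1 / 2) - 1\<bar> \<le> 2 * \<bar>w\<bar>"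
proof -
  define r where "r = (1 + w) powr (1 / 2)"
  have rr: "r * r = 1 + w" using assms by (simp add: r_def flip: powr_add)
  have r0: "r \<ge> 0" by (simp add: r_def)
  have r: "r \<ge> 1 / 2"
  proof (rule ccontr)
    assume "\<not> r \<ge> 1 / 2"
    then have "r * r \<le> 1 / 2 * (1 / 2)" using r0 by (intro mult_mono) auto
    then show False using rr assms by simp
  qed
  have "\<bar>r - 1\<bar> * 1 \<le> \<bar>r - 1\<bar> * (r + 1)" using r0 by (intro mult_left_mono) auto
  also have "\<dots> = \<bar>(r - 1) * (r + 1)\<bar>" using r0 by (simp add: abs_mult)
  also have "(r - 1) * (r + 1) = w" using rr by (simp add: algebra_simps)
  finally show 1: "\<bar>(1 + w) powr (1 / 2) - 1\<bar> \<le> \<bar>w\<bar>" by (simp add: r_def)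
  have inv: "(1 + w) powr (- 1 / 2) = 1 / r" by (simp add: r_def powr_minus inverse_eq_divide)
  show 2: "(1 + w) powr (- 1 / 2) \<le> 2" unfolding inv using r by (simp add: divide_le_eq)
  have "1 / r - 1 = (1 / r) * (1 - r)" using r by (simp add: right_diff_distrib)
  then have "\<bar>1 / r - 1\<bar> = (1 / r) * \<bar>1 - r\<bar>" using r by (simp add: abs_mult)
  also have "\<dots> \<le> 2 * \<bar>w\<bar>" using 1 2 r unfolding inv by (intro mult_mono) (auto simp: r_def)
  finally show "\<bar>(1 + w) powr (- 1 / 2) - 1\<bar> \<le> 2 * \<bar>w\<bar>" unfolding inv .
qed

lemma one_plus_powr_has_derivative:
  fixes w :: "'a::euclidean_space \<Rightarrow> real"
  assumes w: "(w has_derivative D) (at x)" and bd: "\<bar>w x\<bar> \<le> 1 / 2"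
  shows "((\<lambda>x. (1 + w x) powr (1 / 2) - 1) has_derivative (\<lambda>v. 1 / 2 * ((1 + w x) powr (- 1 / 2) * D v))) (at x)"
proof -
  have p: "1 + w x > 0" using bd by linarith
  have "((\<lambda>x. (1 + w x) powr (1 / 2)) has_derivative (\<lambda>v. (1 + w x) powr (1 / 2) * (0 * ln (1 + w x) + (0 + D v) * (1 / 2) / (1 + w x)))) (at x)"
    by (rule has_derivative_powr[OF has_derivative_add[OF has_derivative_const w] has_derivative_const]) (use p in auto)
  from has_derivative_diff[OF this has_derivative_const[of 1]]
  have "((\<lambda>x. (1 + w x) powr (1 / 2) - 1) has_derivative (\<lambda>v. (1 + w x) powr (1 / 2) * (D v * (1 / 2) / (1 + w x)))) (at x)"
    by simp
  moreover have "(1 + w x) powr (- 1 / 2) = (1 + w x) powr (1 / 2) / (1 + w x)"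
    using p powr_diff[of "1 + w x" "1 / 2" 1] by simp
  ultimately show ?thesis by (simp add: mult_ac)
qed

text \<open>The function itself is bounded by |w|, and its first derivative is a derivative of w
  times a symbol of order 0. One differentiation therefore reduces the claim to products, without
  induction on the order.\<close>

lemma rapid_sqrt:
  fixes w :: "'a::euclidean_space \<Rightarrow> real"
  assumes w: "rapid w" and bd: "\<And>x. \<bar>w x\<bar> \<le> 1 / 2"
  shows "rapid (\<lambda>x. (1 + w x) powr (1 / 2) - 1)"
proof (intro allI symbI)
  fix m k
  have b: "\<exists>C. \<forall>x. norm ((1 + w x) powr (1 / 2) - 1) \<le> C * jw m x"
    using symb_bound[OF w[rule_format, of m]] sqrt_one_plus(1)[OF bd] order_trans by (metis real_norm_def)
  have p: "classical 0 (\<lambda>x. (1 + w x) powr (- 1 / 2))"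
  proof (rule classical_powr)
    show "classical 0 (\<lambda>x. 1 + w x)"
      by (intro jw.symb_add w[rule_format] symbI symk_const) simp
    show "1 / 2 \<le> 1 + w x" "1 + w x \<le> 2" for x using bd[of x] by auto
  qed simp
  show "symk jw (\<lambda>_. - 1) k m (\<lambda>x. (1 + w x) powr (1 / 2) - 1)"
  proof (cases k)
    case 0
    then show ?thesis using b by simp
  next
    case (Suc n)
    show ?thesis unfolding Suc
    proof (rule symk_SucI)
      show "\<exists>C. \<forall>x. norm ((1 + w x) powr (1 / 2) - 1) \<le> C * jw m x" by (rule b)
      show "((\<lambda>x. (1 + w x) powr (1 / 2) - 1) has_derivative (\<lambda>v. 1 / 2 * ((1 + w x) powr (- 1 / 2) * dir_deriv v w x))) (at x)" for x
        by (rule one_plus_powr_has_derivative[OF symb_has_derivative[OF w[rule_format, of 0]] bd])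
      fix v :: 'a assume v: "v \<in> Basis"
      have "symk jw (\<lambda>_. - 1) n (0 + (m + - 1)) (\<lambda>x. (1 + w x) powr (- 1 / 2) * dir_deriv v w x)"
        by (intro jw.symk_mult symbD[OF p] symbD[OF symb_dir_deriv[OF w[rule_format] v]])
      then show "symk jw (\<lambda>_. - 1) n (m + - 1) (\<lambda>x. 1 / 2 * ((1 + w x) powr (- 1 / 2) * dir_deriv v w x))"
        by (intro jw.symk_cmult) simp
    qed
  qed
qed

text \<open>Solving \<open>y + l (y\<^sup>2 + p) / 2 = t\<close> for \<open>y\<close> gives \<open>y = (sqrt (1 + w) - 1) / l\<close> with
  \<open>w = 2 l t - l\<^sup>2 p\<close>; here \<open>t\<close> is the coordinate along \<open>e\<close> and \<open>p\<close> the squared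
  length of the remaining coordinates, both cut off.\<close>

lemma straightening_phase:
  fixes e :: "'a::euclidean_space"
  assumes e: "e \<in> Basis"
  obtains l s where "l > 0" "rapid s" "\<And>x. \<bar>dir_deriv e s x\<bar> \<le> 1 / 2"
    "\<And>x::'a. norm x \<le> 1 \<Longrightarrow> e \<bullet> (x + s x *\<^sub>R e) + l / 2 * ((x + s x *\<^sub>R e) \<bullet> (x + s x *\<^sub>R e)) = e \<bullet> x"
proof -
  obtain cut :: "'a \<Rightarrow> real" where cut: "rapid cut" "\<And>x. norm x \<le> 1 \<Longrightarrow> cut x = 1"
  proof (rule plateau[where 'a='a], goal_cases)
    case (1 cut)
    show ?case by (rule 1(1)[OF 1(2,3)])
  qed
  define A where "A x = cut x * (e \<bullet> x)" for x
  define B where "B x = cut x * (x \<bullet> x - (e \<bullet> x) * (e \<bullet> x))" for x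
  have lin: "classical 1 (\<lambda>x. e \<bullet> x)" by (intro symbI symk_bounded_linear bounded_linear_inner_right) simp
  have A: "rapid A" unfolding A_def[abs_def] by (rule rapid_mult[OF cut(1) lin])
  have "classical (1 + 1) (\<lambda>x. (e \<bullet> x) * (e \<bullet> x))" by (rule jw.symb_mult[OF lin lin])
  then have "classical 2 (\<lambda>x. x \<bullet> x - (e \<bullet> x) * (e \<bullet> x))"
    by (intro jw.symb_diff[OF classical_inner_self]) simp
  then have B: "rapid B" unfolding B_def[abs_def] by (rule rapid_mult[OF cut(1)])
  obtain K1 where K1: "K1 > 0" "\<And>x. \<bar>A x\<bar> \<le> K1" "\<And>x. \<bar>dir_deriv e A x\<bar> \<le> K1"
  proof (rule rapid_derivative_bounded[OF A e], goal_cases)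
    case (1 K)
    show ?case by (rule 1(1)[OF 1(2-4)])
  qed
  obtain K2 where K2: "K2 > 0" "\<And>x. \<bar>B x\<bar> \<le> K2" "\<And>x. \<bar>dir_deriv e B x\<bar> \<le> K2"
  proof (rule rapid_derivative_bounded[OF B e], goal_cases)
    case (1 K)
    show ?case by (rule 1(1)[OF 1(2-4)])
  qed
  define K where "K = K1 + K2 + 1"
  have K: "K \<ge> 1" "\<bar>A x\<bar> \<le> K" "\<bar>B x\<bar> \<le> K" "\<bar>dir_deriv e A x\<bar> \<le> K" "\<bar>dir_deriv e B x\<bar> \<le> K" for x
    using K1(1) K1(2,3)[of x] K2(1) K2(2,3)[of x] by (auto simp: K_def)
  \<comment> \<open>The derivative of \<open>s\<close> will be bounded by 6 l K^2 + l K \<le> 6/14 +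
    1/14 = 1/2. The same choice gives |w| \<le> 3 l K \<le> 3/14, well inside the domain of the
    square root.\<close>
  define l where "l = 1 / (14 * K * K)"
  have KK: "K * K \<ge> 1 * K" using K(1) by (intro mult_right_mono) auto
  have l: "l > 0" "l * (K * K) = 1 / 14" using K(1) by (auto simp: l_def)
  have l1: "l \<le> 1" using l mult_left_mono[of 1 "K * K" l] KK K(1) by linarith
  have "l * K \<le> l * (K * K)" using KK l(1) by (intro mult_left_mono) auto
  then have lK: "l * K \<le> 1 / 14" unfolding l .
  define w where "w x = 2 * l * A x - l * l * B x" for x
  have w_rapid: "rapid w" unfolding w_def[abs_def] using A B by (intro allI jw.symb_diff jw.symb_cmult) auto
  have w: "\<bar>w x\<bar> \<le> 3 * (l * K)" for x
  proof -
    have "\<bar>2 * l * A x\<bar> \<le> 2 * (l * K)" using K(2)[of x] l by (simp add: abs_mult)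
    moreover have "\<bar>l * l * B x\<bar> \<le> l * K"
    proof -
      have "l * (l * \<bar>B x\<bar>) \<le> 1 * (l * K)" using K(3)[of x] l l1 K(1) by (intro mult_mono) auto
      then show ?thesis using l by (simp add: abs_mult mult_ac)
    qed
    ultimately show ?thesis unfolding w_def by linarith
  qed
  then have w2: "\<bar>w x\<bar> \<le> 1 / 2" for x using lK order_trans[OF w[of x]] by force
  \<comment> \<open>The solution y minus the original coordinate along e, both in their cut-off
    versions; the displacement is thus rapid although neither coordinate alone would be
    bounded.\<close>
  define s where "s x = 1 / l * ((1 + w x) powr (1 / 2) - 1) - A x" for x
  show thesis
  proof (rule that[of l s])
    show "l > 0" by (rule l)
    show "rapid s" unfolding s_def[abs_def]
      by (intro allI jw.symb_diff[OF jw.symb_cmult[OF rapid_sqrt[OF w_rapid w2, rule_format]] A[rule_format]])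
    fix x :: 'a
    show "\<bar>dir_deriv e s x\<bar> \<le> 1 / 2"
    proof -
      let ?A = "dir_deriv e A x" and ?B = "dir_deriv e B x" and ?r = "(1 + w x) powr (- 1 / 2)"
      have dA: "(A has_derivative (\<lambda>v. dir_deriv v A x)) (at x)" and dB: "(B has_derivative (\<lambda>v. dir_deriv v B x)) (at x)"
        using A B by (auto intro: symb_has_derivative)
      have "(w has_derivative (\<lambda>v. 2 * l * dir_deriv v A x - l * l * dir_deriv v B x)) (at x)"
        unfolding w_def[abs_def]
        by (intro has_derivative_diff bounded_linear.has_derivative[OF bounded_linear_mult_right] dA dB)
      then have "(s has_derivative (\<lambda>v. 1 / l * (1 / 2 * (?r * (2 * l * dir_deriv v A x - l * l * dir_deriv v B x))) - dir_deriv v A x)) (at x)"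
        unfolding s_def[abs_def]
        by (intro has_derivative_diff bounded_linear.has_derivative[OF bounded_linear_mult_right] one_plus_powr_has_derivative w2 dA)
      from dir_deriv_eqI[OF this, of e]
      have "dir_deriv e s x = 1 / l * (1 / 2 * (?r * (2 * l * ?A - l * l * ?B))) - ?A" .
      also have "2 * l * ?A - l * l * ?B = l * (2 * ?A - l * ?B)" by (simp add: algebra_simps)
      also have "1 / l * (1 / 2 * (?r * (l * (2 * ?A - l * ?B)))) = 1 / 2 * (?r * (2 * ?A - l * ?B))" using l(1) by simp
      \<comment> \<open>The term of order one in \<open>?A\<close> cancels, since y agrees with the
        coordinate to first order. What is left has a factor of size l K.\<close>
      finally have eq: "dir_deriv e s x = ?A * (?r - 1) - l / 2 * (?r * ?B)"
        by (simp add: algebra_simps)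
      have "\<bar>?A * (?r - 1)\<bar> \<le> K * (2 * (3 * (l * K)))"
        unfolding abs_mult using K(1) K(4)[of x] order_trans[OF sqrt_one_plus(3)[OF w2] mult_left_mono[OF w, of 2]]
        by (intro mult_mono) auto
      moreover have "\<bar>l / 2 * (?r * ?B)\<bar> \<le> l / 2 * (2 * K)"
        unfolding abs_mult using K(1) K(5)[of x] sqrt_one_plus(2)[OF w2[of x]] l by (intro mult_mono) auto
      moreover have "K * (2 * (3 * (l * K))) = 6 * (l * (K * K))" "l / 2 * (2 * K) = l * K" by simp_all
      ultimately show ?thesis unfolding eq using l lK by linarith
    qed
    assume x: "norm x \<le> 1"
    define y where "y = e \<bullet> x + s x"
    have ee: "e \<bullet> e = 1" using e by simp
    have ly: "1 + l * y = (1 + w x) powr (1 / 2)"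
      using l cut(2)[OF x] by (simp add: y_def s_def A_def)
    have "(1 + l * y) * (1 + l * y) = 1 + w x"
      unfolding ly using w2[of x] by (simp flip: powr_add)
    then have "2 * l * y + l * l * (y * y) = 2 * l * (e \<bullet> x) - l * l * (x \<bullet> x - (e \<bullet> x) * (e \<bullet> x))"
      using cut(2)[OF x] by (simp add: w_def A_def B_def algebra_simps)
    then have "l * (2 * y + l * (y * y)) = l * (2 * (e \<bullet> x) - l * (x \<bullet> x - (e \<bullet> x) * (e \<bullet> x)))"
      by (simp add: algebra_simps)
    then have eq: "2 * y + l * (y * y) = 2 * (e \<bullet> x) - l * (x \<bullet> x - (e \<bullet> x) * (e \<bullet> x))"
      using l(1) by simp
    have 1: "e \<bullet> (x + s x *\<^sub>R e) = y" using ee by (simp add: y_def inner_add_right)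
    have 2: "(x + s x *\<^sub>R e) \<bullet> (x + s x *\<^sub>R e) = x \<bullet> x - (e \<bullet> x) * (e \<bullet> x) + y * y"
      using ee by (simp add: y_def inner_simps inner_commute[of x e] algebra_simps)
    show "e \<bullet> (x + s x *\<^sub>R e) + l / 2 * ((x + s x *\<^sub>R e) \<bullet> (x + s x *\<^sub>R e)) = e \<bullet> x"
      unfolding 1 2 using eq by (simp add: algebra_simps)
  qed
qed

section \<open>The counterexamples\<close>

lemma phase_amp_SG:
  fixes s :: "real^'n \<Rightarrow> real"
  assumes s: "rapid s" and m: "m' \<le> m"
  shows "phase e s \<in> SG 1 1" "(\<lambda>z. phase e s (snd z, fst z)) \<in> SG 1 1"
    "amp m' bump \<in> SG_minf_x m" "compact_supp_x (amp m' (bump :: real^'n \<Rightarrow> real))"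
    "(\<lambda>z. amp m' bump (snd z, fst z :: real^'n)) \<in> SG_minf_eta m"
    "compact_supp_eta (\<lambda>z. amp m' (bump :: real^'n \<Rightarrow> real) (snd z, fst z))"
proof -
  note ph = symb_phase[OF s[rule_format]]
  note am = symb_amp[OF rapid_bump[rule_format] m]
  show "phase e s \<in> SG 1 1" "(\<lambda>z. phase e s (snd z, fst z)) \<in> SG 1 1"
    using ph symb_swap[OF ph] by (auto intro: symb_imp_SG)
  show "amp m' bump \<in> SG_minf_x m" "(\<lambda>z. amp m' bump (snd z, fst z :: real^'n)) \<in> SG_minf_eta m"
    using am symb_swap[OF am] by (auto simp: SG_minf_x_def SG_minf_eta_def intro: symb_imp_SG)
  have "amp m' (bump :: real^'n \<Rightarrow> real) (x, \<eta>) = 0" if "norm x \<ge> 2" for x \<eta> :: "real^'n"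
    using bump_props(3)[of x] that by (auto simp: amp_def)
  then show "compact_supp_x (amp m' (bump :: real^'n \<Rightarrow> real))"
    "compact_supp_eta (\<lambda>z. amp m' (bump :: real^'n \<Rightarrow> real) (snd z, fst z))"
    unfolding compact_supp_x_def compact_supp_eta_def by (auto intro!: exI[of _ 2])
qed

text \<open>The whole space and, for p = \<infinity>, the closure of the Schwartz functions are
  handled by one claim, as the argument works with test functions common to both.\<close>

abbreviation unbounded_on ::
  "(real^'n \<Rightarrow> complex) \<Rightarrow> ennreal \<Rightarrow> ((real^'n \<Rightarrow> complex) \<Rightarrow> real^'n \<Rightarrow> complex) \<Rightarrow> bool" where
  "unbounded_on g p A \<equiv> (\<forall>X. X = mod_space g p \<or> X = mod_space_tilde_inf g \<and> p = \<infinity> \<longrightarrow>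
     \<not> extends_to_bounded_operator A X (mod_norm g p))"

text \<open>One lower bound for the bilinear form refutes two operators. For the exponent q the
  input has transform \<open>F n\<close> and is tested with \<open>U n\<close>; for the conjugate
  exponent the input of the swapped operator has transform \<open>U n\<close> and is tested with
  \<open>F n\<close>.\<close>

lemma unbounded_on_of_bil:
  fixes g :: "real^'n \<Rightarrow> complex" and e :: "real^'n"
  assumes g: "g \<in> schwartz" "g \<noteq> (\<lambda>t. 0)"
    and q: "1 \<le> q" "1 \<le> q'" "enn2real (1 / q) + enn2real (1 / q') = 1"
    and cont: "continuous_on UNIV s" "continuous_on UNIV (bump :: real^'n \<Rightarrow> real)"
    and F: "\<And>n::nat. F n \<in> schwartz" and U: "\<And>n::nat. U n \<in> schwartz"
    and norms: "\<And>n::nat. n \<ge> 1 \<Longrightarrow> norms_le g q (F n) (a * real n powr k1)"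
      "\<And>n::nat. n \<ge> 1 \<Longrightarrow> norms_le g q' (U n) (b * real n powr k2)"
    and ab: "0 \<le> a" "0 \<le> b" and k: "k1 + k2 < m" and c: "c > 0" and n0: "n0 \<ge> 1"
    and bil: "\<And>n::nat. n \<ge> n0 \<Longrightarrow> c * real n powr m \<le> norm (bil e s m bump (F n) (U n))"
  shows "unbounded_on g q (FIO (phase e s) (amp m bump)) \<and>
    unbounded_on g q' (FIO (\<lambda>z. phase e s (snd z, fst z)) (\<lambda>z. amp m bump (snd z, fst z)))"
proof (intro conjI allI impI)
  fix X assume X: "X = mod_space g q \<or> X = mod_space_tilde_inf g \<and> q = \<infinity>"
  show "\<not> extends_to_bounded_operator (FIO (phase e s) (amp m bump)) X (mod_norm g q)"
  proof (rule not_bounded_operator[OF g q X F U norms ab k c n0])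
    fix f and n :: nat assume n: "n \<ge> n0" and f: "fourier f = F n"
    show "FIO (phase e s) (amp m bump) f \<in> borel_measurable borel \<and>
      (\<exists>B M. \<forall>x. norm (FIO (phase e s) (amp m bump) f x) \<le> B * jw M x) \<and>
      c * real n powr m \<le> norm (LINT t|lborel. FIO (phase e s) (amp m bump) f t * U n t)"
      using FIO_pairing[OF cont bump_props(2) F f, of e m "U n"] bil[OF n] by simp
  qed
next
  let ?A = "FIO (\<lambda>z. phase e s (snd z, fst z)) (\<lambda>z. amp m bump (snd z, fst z))"
  fix X assume X: "X = mod_space g q' \<or> X = mod_space_tilde_inf g \<and> q' = \<infinity>"
  have qq: "enn2real (1 / q') + enn2real (1 / q) = 1" and kk: "k2 + k1 < m" using q k by auto
  show "\<not> extends_to_bounded_operator ?A X (mod_norm g q')"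
  proof (rule not_bounded_operator[OF g q(2,1) qq X U F norms(2,1) ab(2,1) kk c n0])
    fix f and n :: nat assume n: "n \<ge> n0" and f: "fourier f = U n"
    show "?A f \<in> borel_measurable borel \<and> (\<exists>B M. \<forall>x. norm (?A f x) \<le> B * jw M x) \<and>
      c * real n powr m \<le> norm (LINT t|lborel. ?A f t * F n t)"
      using FIO_swap_pairing[OF cont bump_props(2) F U f, of e m n] bil[OF n] by simp
  qed
qed

text \<open>The input carries the gain here: its norm decays like the power of n in
  \<open>norms_le_wchirp\<close>, while the modulated Gaussian it is tested with has bounded norm.
  Writing the condition as 1/q \<le> 1/2 includes q = \<infinity>.\<close>

lemma unbounded_ge_2:
  fixes g :: "real^'n \<Rightarrow> complex"
  assumes g: "g \<in> schwartz" "g \<noteq> (\<lambda>t. 0)"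
    and q: "1 \<le> q" "1 \<le> q'" "enn2real (1 / q) + enn2real (1 / q') = 1"
    and q2: "enn2real (1 / q) \<le> 1 / 2"
    and m: "m \<le> 0" "- real CARD('n) * (1 / 2 - enn2real (1 / q)) < m"
  shows "\<exists>s. rapid s \<and> (\<forall>x. \<bar>dir_deriv (axis k 1) s x\<bar> \<le> 1 / 2) \<and>
    unbounded_on g q (FIO (phase (axis k 1) s) (amp m bump)) \<and>
    unbounded_on g q' (FIO (\<lambda>z. phase (axis k 1) s (snd z, fst z)) (\<lambda>z. amp m bump (snd z, fst z)))"
proof -
  let ?e = "axis k 1 :: real^'n"
  let ?r = "- real CARD('n) * (1 / 2 - enn2real (1 / q))"
  have e: "?e \<in> Basis" "norm ?e = 1" by (auto simp: Basis_vec)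
  obtain l s where l: "l > 0" and s: "rapid s" "\<And>x. \<bar>dir_deriv ?e s x\<bar> \<le> 1 / 2"
    "\<And>x. norm x \<le> 1 \<Longrightarrow> ?e \<bullet> (x + s x *\<^sub>R ?e) + l / 2 * ((x + s x *\<^sub>R ?e) \<bullet> (x + s x *\<^sub>R ?e)) = ?e \<bullet> x"
  proof (rule straightening_phase[OF e(1)], goal_cases)
    case (1 l s)
    show ?case by (rule 1(1)[OF 1(2-5)])
  qed
  have cont: "continuous_on UNIV s" "continuous_on UNIV (bump :: real^'n \<Rightarrow> real)"
    using s(1) rapid_bump[where 'a="real^'n"] by (auto intro: symb_continuous)
  let ?F = "\<lambda>n::nat. wchirp m ?e l (real n)"
  \<comment> \<open>The trivial translation by 0 gives the function the shape required by
    \<open>norms_le_const\<close>.\<close>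
  let ?U = "\<lambda>(n::nat) x. cis (2 * pi * ((- real n *\<^sub>R ?e) \<bullet> x)) * cgauss 1 (x - 0)"
  have g1: "(cgauss 1 :: real^'n \<Rightarrow> complex) \<in> schwartz" by (rule cgauss_schwartz) simp
  have F: "?F n \<in> schwartz" and U: "?U n \<in> schwartz" for n
    by (rule wchirp_schwartz, intro schwartz_modulate schwartz_shift g1)
  obtain C where C: "C > 0" "\<And>n::nat. n \<ge> 1 \<Longrightarrow> norms_le g q (?F n) (C * real n powr ?r)"
    using norms_le_wchirp[OF g(1) q(1) q2 m(1) l e(2)] by auto
  obtain D where D: "D > 0" "\<And>n::nat. n \<ge> 1 \<Longrightarrow> norms_le g q' (?U n) (D * real n powr 0)"
  proof -
    obtain D where D: "D > 0" "\<And>a b. norms_le g q' (\<lambda>t. cis (2 * pi * (a \<bullet> t)) * cgauss 1 (t - b)) D"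
      using norms_le_const[OF g1 g(1) q(2)] by blast
    show thesis
    proof (rule that[OF D(1)])
      fix n :: nat assume "n \<ge> 1"
      then have eq: "D * real n powr 0 = D" by simp
      show "norms_le g q' (?U n) (D * real n powr 0)" unfolding eq by (rule D(2))
    qed
  qed
  obtain c where c: "c > 0" "\<And>n. n \<ge> 1 \<Longrightarrow> c * n powr m \<le> norm (bil ?e s m bump (wchirp m ?e l n) (\<lambda>x. cis (2 * pi * ((- n *\<^sub>R ?e) \<bullet> x)) * cgauss 1 (x - 0)))"
    using bil_wchirp[OF cont bump_props(2) bump_props(1), of ?e l m] s(3) bump_props(3) by blast
  have k: "?r + 0 < m" using m by simp
  have c': "c * real n powr m \<le> norm (bil ?e s m bump (?F n) (?U n))" if "n \<ge> 1" for n :: nat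
    using c(2)[of "real n"] that by simp
  show ?thesis
    using unbounded_on_of_bil[OF g q cont F U C(2) D(2) less_imp_le[OF C(1)] less_imp_le[OF D(1)] k c(1) order_refl c'] s by blast
qed

lemma unbounded_le_2:
  fixes g :: "real^'n \<Rightarrow> complex"
  assumes g: "g \<in> schwartz" "g \<noteq> (\<lambda>t. 0)"
    and q: "1 \<le> q" "1 \<le> q'" "enn2real (1 / q) + enn2real (1 / q') = 1"
    and q2: "enn2real (1 / q') \<le> 1 / 2"
    and m: "- real CARD('n) * (1 / 2 - enn2real (1 / q')) < m"
  shows "\<exists>s. rapid s \<and> (\<forall>x. \<bar>dir_deriv (axis k 1) s x\<bar> \<le> 1 / 2) \<and>
    unbounded_on g q (FIO (phase (axis k 1) s) (amp m bump)) \<and>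
    unbounded_on g q' (FIO (\<lambda>z. phase (axis k 1) s (snd z, fst z)) (\<lambda>z. amp m bump (snd z, fst z)))"
proof -
  let ?e = "axis k 1 :: real^'n"
  let ?r = "- real CARD('n) * (1 / 2 - enn2real (1 / q'))"
  have e: "?e \<in> Basis" "norm ?e = 1" by (auto simp: Basis_vec)
  obtain l s where l: "l > 0" and s: "rapid s" "\<And>x. \<bar>dir_deriv ?e s x\<bar> \<le> 1 / 2"
    "\<And>x. norm x \<le> 1 \<Longrightarrow> s x = l / 2 * (x \<bullet> x)"
  proof (rule quadratic_phase[OF e(1)], goal_cases)
    case (1 l s)
    show ?case by (rule 1(1)[OF 1(2-5)])
  qed
  have cont: "continuous_on UNIV s" "continuous_on UNIV (bump :: real^'n \<Rightarrow> real)"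
    using s(1) rapid_bump[where 'a="real^'n"] by (auto intro: symb_continuous)
  let ?F = "\<lambda>(n::nat) \<eta>. cis (2 * pi * (0 \<bullet> \<eta>)) * cgauss 1 (\<eta> - real n *\<^sub>R ?e)"
  let ?U = "\<lambda>(n::nat) x. cnj (chirp ?e l (real n) x)"
  have g1: "(cgauss 1 :: real^'n \<Rightarrow> complex) \<in> schwartz" by (rule cgauss_schwartz) simp
  have F: "?F n \<in> schwartz" and U: "?U n \<in> schwartz" for n
    by (intro schwartz_modulate schwartz_shift g1, intro schwartz_cnj chirp_schwartz)
  obtain C where C: "C > 0" "\<And>n::nat. n \<ge> 1 \<Longrightarrow> norms_le g q' (?U n) (C * real n powr ?r)"
    using norms_le_chirp[OF g(1) q(2) q2 l, of ?e] by auto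
  obtain D where D: "D > 0" "\<And>n::nat. n \<ge> 1 \<Longrightarrow> norms_le g q (?F n) (D * real n powr 0)"
  proof -
    obtain D where D: "D > 0" "\<And>a b. norms_le g q (\<lambda>t. cis (2 * pi * (a \<bullet> t)) * cgauss 1 (t - b)) D"
      using norms_le_const[OF g1 g(1) q(1)] by blast
    show thesis
    proof (rule that[OF D(1)])
      fix n :: nat assume "n \<ge> 1"
      then have eq: "D * real n powr 0 = D" by simp
      show "norms_le g q (?F n) (D * real n powr 0)" unfolding eq by (rule D(2))
    qed
  qed
  obtain c n0 where c: "c > 0" "n0 \<ge> 1" "\<And>n::nat. n \<ge> n0 \<Longrightarrow> c * real n powr m \<le> norm (bil ?e s m bump (?F n) (?U n))"
    using bil_chirp[OF cont bump_props(2) bump_props(1) e(2), of l m] s(3) bump_props(3) by blast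
  have k: "0 + ?r < m" using m by simp
  show ?thesis
    using unbounded_on_of_bil[OF g q cont F U D(2) C(2) less_imp_le[OF D(1)] less_imp_le[OF C(1)] k c] s by blast
qed

text \<open>Combines both regimes. The order m' may lie below m because the weight of order m' is
  also a symbol of order m.\<close>

lemma unbounded_operators:
  fixes g :: "real^'n \<Rightarrow> complex"
  assumes g: "g \<in> schwartz" "g \<noteq> (\<lambda>t. 0)"
    and q: "1 \<le> q" "1 \<le> q'" "enn2real (1 / q) + enn2real (1 / q') = 1"
    and m: "- real CARD('n) * \<bar>1 / 2 - enn2real (1 / q)\<bar> < m"
  shows "\<exists>s m'. rapid s \<and> (\<forall>x. \<bar>dir_deriv (axis k 1) s x\<bar> \<le> 1 / 2) \<and> m' \<le> m \<and>
    unbounded_on g q (FIO (phase (axis k 1) s) (amp m' bump)) \<and>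
    unbounded_on g q' (FIO (\<lambda>z. phase (axis k 1) s (snd z, fst z)) (\<lambda>z. amp m' bump (snd z, fst z)))"
proof (cases "enn2real (1 / q) < 1 / 2")
  case True
  \<comment> \<open>For q > 2 the threshold is strictly negative, so \<open>min m 0\<close> still
    exceeds it and satisfies the sign condition of \<open>unbounded_ge_2\<close>. At q = 2 the
    threshold is 0 and m is positive; that case belongs to the other regime.\<close>
  then have "- real CARD('n) * (1 / 2 - enn2real (1 / q)) < 0"
    by (simp add: mult_less_0_iff)
  with m True have "- real CARD('n) * (1 / 2 - enn2real (1 / q)) < min m 0" by (simp add: abs_if)
  from unbounded_ge_2[OF g q _ _ this, of k] True show ?thesis
    by (intro exI[of _ "min m 0"] ex_comm[THEN iffD1]) auto
next
  case False
  then have "\<bar>1 / 2 - enn2real (1 / q)\<bar> = 1 / 2 - enn2real (1 / q')" "enn2real (1 / q') \<le> 1 / 2"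
    using q(3) by linarith+
  then show ?thesis using unbounded_le_2[OF g q, of m k] m by auto
qed

lemma conjugate_exponent:
  fixes p :: ennreal
  assumes "1 \<le> p"
  obtains p' :: ennreal where "1 \<le> p'" "enn2real (1 / p) + enn2real (1 / p') = 1"
  using assms
proof (cases rule: exponent_cases)
  case 1
  then show ?thesis using that[of 1] by simp
next
  case (2 q)
  show ?thesis
  proof (cases "q = 1")
    case True
    then show ?thesis using that[of \<infinity>] 2 by simp
  next
    case False
    then have q: "q > 1" using 2 by simp
    have "1 \<le> q / (q - 1)" using q by (simp add: field_simps)
    then have "1 \<le> ennreal (q / (q - 1))" using ennreal_leI[of 1 "q / (q - 1)"] by simp
    moreover have "1 / q + 1 / (q / (q - 1)) = 1" using q by (simp add: field_simps)
    then have "enn2real (1 / p) + enn2real (1 / ennreal (q / (q - 1))) = 1"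
      using q unfolding 2(1) by (subst (1 2) enn2real_one_divide) auto
    ultimately show ?thesis by (rule that)
  qed
qed

theorem mainTheorem3:
  fixes g :: "real ^ 'n::finite \<Rightarrow> complex" and p :: ennreal
  assumes "g \<in> schwartz" and "g \<noteq> (\<lambda>t. 0)"
    and "1 \<le> p"
  shows
    "(\<forall>m1 :: real. m1 > - real CARD('n) * \<bar>1 / 2 - enn2real (1 / p)\<bar> \<longrightarrow>
       (\<exists>(\<Phi> :: (real ^ 'n) \<times> (real ^ 'n) \<Rightarrow> real) (\<sigma> :: (real ^ 'n) \<times> (real ^ 'n) \<Rightarrow> complex).
          \<Phi> \<in> SG 1 1 \<and> nondegenerate \<Phi> \<and>
          \<sigma> \<in> SG_minf_x m1 \<and> compact_supp_x \<sigma> \<and>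
          (p < \<infinity> \<longrightarrow> \<not> extends_to_bounded_operator (FIO \<Phi> \<sigma>) (mod_space g p) (mod_norm g p)) \<and>
          (p = \<infinity> \<longrightarrow> \<not> extends_to_bounded_operator (FIO \<Phi> \<sigma>) (mod_space_tilde_inf g) (mod_norm g \<infinity>))))
     \<and>
     (\<forall>m2 :: real. m2 > - real CARD('n) * \<bar>1 / 2 - enn2real (1 / p)\<bar> \<longrightarrow>
       (\<exists>(\<Phi> :: (real ^ 'n) \<times> (real ^ 'n) \<Rightarrow> real) (\<sigma> :: (real ^ 'n) \<times> (real ^ 'n) \<Rightarrow> complex).
          \<Phi> \<in> SG 1 1 \<and> nondegenerate \<Phi> \<and>
          \<sigma> \<in> SG_minf_eta m2 \<and> compact_supp_eta \<sigma> \<and>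
          (p < \<infinity> \<longrightarrow> \<not> extends_to_bounded_operator (FIO \<Phi> \<sigma>) (mod_space g p) (mod_norm g p)) \<and>
          (p = \<infinity> \<longrightarrow> \<not> extends_to_bounded_operator (FIO \<Phi> \<sigma>) (mod_space_tilde_inf g) (mod_norm g \<infinity>))))"
proof -
  note g = assms(1,2)
  obtain p' :: ennreal where p': "1 \<le> p'" "enn2real (1 / p) + enn2real (1 / p') = 1"
    by (rule conjugate_exponent[OF assms(3)])
  have pp': "enn2real (1 / p') + enn2real (1 / p) = 1" using p' by simp
  \<comment> \<open>Conjugate exponents have the same threshold, so the second statement for
    \<open>p\<close> is the swapped half of the construction for the conjugate exponent.\<close>
  have abs_eq: "\<bar>1 / 2 - enn2real (1 / p')\<bar> = \<bar>1 / 2 - enn2real (1 / p)\<bar>" using p' by linarith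
  \<comment> \<open>An arbitrary coordinate direction; the index type is inhabited, so one
    exists.\<close>
  define e :: "real^'n" where "e = axis undefined 1"
  show ?thesis
  proof (intro conjI allI impI)
    fix m1 assume "m1 > - real CARD('n) * \<bar>1 / 2 - enn2real (1 / p)\<bar>"
    from unbounded_operators[OF g assms(3) p' this, of undefined, folded e_def]
    show "\<exists>(\<Phi> :: (real ^ 'n) \<times> (real ^ 'n) \<Rightarrow> real) (\<sigma> :: (real ^ 'n) \<times> (real ^ 'n) \<Rightarrow> complex).
          \<Phi> \<in> SG 1 1 \<and> nondegenerate \<Phi> \<and>
          \<sigma> \<in> SG_minf_x m1 \<and> compact_supp_x \<sigma> \<and>
          (p < \<infinity> \<longrightarrow> \<not> extends_to_bounded_operator (FIO \<Phi> \<sigma>) (mod_space g p) (mod_norm g p)) \<and>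
          (p = \<infinity> \<longrightarrow> \<not> extends_to_bounded_operator (FIO \<Phi> \<sigma>) (mod_space_tilde_inf g) (mod_norm g \<infinity>))"
    proof (elim exE conjE, goal_cases)
      case (1 s m')
      note nd = nondegenerate_phase(1)[OF 1(1)[rule_format, of 0] 1(2)[unfolded e_def, rule_format], folded e_def]
      show ?case
      proof (intro exI[of _ "phase e s"] exI[of _ "amp m' bump"] conjI impI nd phase_amp_SG(1,3,4)[OF 1(1,3)])
        show "\<not> extends_to_bounded_operator (FIO (phase e s) (amp m' bump)) (mod_space g p) (mod_norm g p)"
          using 1(4) by blast
        assume "p = \<infinity>"
        then show "\<not> extends_to_bounded_operator (FIO (phase e s) (amp m' bump)) (mod_space_tilde_inf g) (mod_norm g \<infinity>)"
          using 1(4) by blast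
      qed
    qed
  next
    fix m2 assume "m2 > - real CARD('n) * \<bar>1 / 2 - enn2real (1 / p)\<bar>"
    then have "m2 > - real CARD('n) * \<bar>1 / 2 - enn2real (1 / p')\<bar>" unfolding abs_eq .
    from unbounded_operators[OF g p'(1) assms(3) pp' this, of undefined, folded e_def]
    show "\<exists>(\<Phi> :: (real ^ 'n) \<times> (real ^ 'n) \<Rightarrow> real) (\<sigma> :: (real ^ 'n) \<times> (real ^ 'n) \<Rightarrow> complex).
          \<Phi> \<in> SG 1 1 \<and> nondegenerate \<Phi> \<and>
          \<sigma> \<in> SG_minf_eta m2 \<and> compact_supp_eta \<sigma> \<and>
          (p < \<infinity> \<longrightarrow> \<not> extends_to_bounded_operator (FIO \<Phi> \<sigma>) (mod_space g p) (mod_norm g p)) \<and>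
          (p = \<infinity> \<longrightarrow> \<not> extends_to_bounded_operator (FIO \<Phi> \<sigma>) (mod_space_tilde_inf g) (mod_norm g \<infinity>))"
    proof (elim exE conjE, goal_cases)
      case (1 s m')
      note nd = nondegenerate_phase(2)[OF 1(1)[rule_format, of 0] 1(2)[unfolded e_def, rule_format], folded e_def]
      let ?\<Phi> = "\<lambda>z. phase e s (snd z, fst z)" and ?\<sigma> = "\<lambda>z. amp m' bump (snd z, fst z)"
      show ?case
      proof (intro exI[of _ ?\<Phi>] exI[of _ ?\<sigma>] conjI impI nd phase_amp_SG(2,5,6)[OF 1(1,3)])
        show "\<not> extends_to_bounded_operator (FIO ?\<Phi> ?\<sigma>) (mod_space g p) (mod_norm g p)"
          using 1(5) by blast
        assume "p = \<infinity>"
        then show "\<not> extends_to_bounded_operator (FIO ?\<Phi> ?\<sigma>) (mod_space_tilde_inf g) (mod_norm g \<infinity>)"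
          using 1(5) by blast
      qed
    qed
  qed
qed

end
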